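(* Let $k$ be a field, $P$ a finite poset which is Cohen–Macaulay over $k$, and $Q$ a poset ideal of $P$. Suppose that $\tilde\chi((-\infty,x)_P)=0$ for every $x\in(P\cup\{\infty\})\setminus Q$. Then $P\uplus Q$ is Cohen–Macaulay over $k$.
   Context: A poset ideal $Q$ of $P$ is a subset with $x\in Q$, $y<x$ implying $y\in Q$. $-\infty,\infty$ are new elements smaller/larger than everything; $(x,y)_P=\{z\in P: x<z<y\}$, so $(-\infty,\infty)_P=P$. The order complex $\Delta(P)$ is the simplicial complex of chains of $P$; $\tilde\chi(P)=\tilde\chi(\Delta(P))=\sum_{\sigma\in\Delta(P)}(-1)^{|\sigma|-1}$ (the empty chain included). $P$ is Cohen–Macaulay over $k$ if the Stanley–Reisner ring $k[\Delta(P)]$ is Cohen–Macaulay. The poset $P\uplus Q$ has underlying set $P\cup Q^\ast$, where $Q^\ast=\{x^\ast:x\in Q\}$ is a disjoint copy of $Q$, and $\alpha<\beta$ iff either $\alpha,\beta\in P$ and $\alpha<\beta$ in $P$; or $\alpha=x^\ast,\beta=y^\ast$ with $x<y$ in $P$; or $\alpha=x^\ast$ with $x\in Q$, $\beta\in P$ and $x\le\beta$ in $P$. *)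

theory Defs
  imports Main "HOL-Library.Poly_Mapping" "HOL-Library.Extended_Nat"
begin

definition is_ideal :: "'r::comm_ring_1 set \<Rightarrow> bool" where
  "is_ideal I \<longleftrightarrow> 0 \<in> I \<and> (\<forall>a\<in>I. \<forall>b\<in>I. a + b \<in> I) \<and> (\<forall>r. \<forall>a\<in>I. r * a \<in> I)"

definition gen_ideal :: "'r::comm_ring_1 set \<Rightarrow> 'r set" where
  "gen_ideal A = \<Inter>{I. is_ideal I \<and> A \<subseteq> I}"

definition is_prime_ideal :: "'r::comm_ring_1 set \<Rightarrow> bool" where
  "is_prime_ideal P \<longleftrightarrow> is_ideal P \<and> P \<noteq> UNIV \<and> (\<forall>a b. a * b \<in> P \<longrightarrow> a \<in> P \<or> b \<in> P)"

definition krull_dim_quot :: "'r::comm_ring_1 set \<Rightarrow> enat" where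
  "krull_dim_quot I = Sup {enat n | n. \<exists>p :: nat \<Rightarrow> 'r set.
      (\<forall>i\<le>n. is_prime_ideal (p i) \<and> I \<subseteq> p i) \<and> (\<forall>i<n. p i \<subset> p (Suc i))}"

text \<open>f_0, ..., f_{n-1} (elements of R, taken modulo I) form an (R/I)-regular
  sequence in the ideal m (a proper ideal of R containing I).\<close>
definition regular_seq_quot :: "'r::comm_ring_1 set \<Rightarrow> 'r set \<Rightarrow> nat \<Rightarrow> (nat \<Rightarrow> 'r) \<Rightarrow> bool" where
  "regular_seq_quot I m n f \<longleftrightarrow>
     (\<forall>i<n. f i \<in> m) \<and>
     (\<forall>i<n. \<forall>g. f i * g \<in> gen_ideal (I \<union> f ` {..<i}) \<longrightarrow> g \<in> gen_ideal (I \<union> f ` {..<i})) \<and>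
     gen_ideal (I \<union> f ` {..<n}) \<noteq> UNIV"

definition depth_quot :: "'r::comm_ring_1 set \<Rightarrow> 'r set \<Rightarrow> enat" where
  "depth_quot I m = Sup {enat n | n. \<exists>f. regular_seq_quot I m n f}"

type_synonym ('v, 'k) mpoly = "('v \<Rightarrow>\<^sub>0 nat) \<Rightarrow>\<^sub>0 'k"

definition pvar :: "'v \<Rightarrow> ('v, 'k::field) mpoly" where
  "pvar v = Poly_Mapping.single (Poly_Mapping.single v 1) 1"

text \<open>Simplicial complex on vertex set V given as a set of faces; the
  Stanley--Reisner ideal is generated by the squarefree monomials x^F of the
  non-faces F.  We work in the polynomial ring with one variable for every
  element of the type 'v; non-faces include the singletons {v}, v not in V, so
  the quotient is canonically isomorphic to k[x_v : v in V]/I_Delta.\<close>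
definition SR_ideal :: "'v set set \<Rightarrow> ('v, 'k::field) mpoly set" where
  "SR_ideal \<Delta> = gen_ideal {(\<Prod>v\<in>F. pvar v) | F. finite F \<and> F \<notin> \<Delta>}"

definition var_ideal :: "('v, 'k::field) mpoly set" where
  "var_ideal = gen_ideal (range pvar)"

text \<open>The graded k-algebra k[Delta] is Cohen--Macaulay iff depth = Krull dimension
  (depth with respect to the homogeneous maximal ideal).\<close>
definition SR_cohen_macaulay :: "'k::field itself \<Rightarrow> 'v set set \<Rightarrow> bool" where
  "SR_cohen_macaulay TYPE('k) \<Delta> \<longleftrightarrow>
     depth_quot (SR_ideal \<Delta> :: ('v,'k) mpoly set) var_ideal
       = krull_dim_quot (SR_ideal \<Delta> :: ('v,'k) mpoly set)"

definition partial_order_on' :: "'a set \<Rightarrow> ('a \<Rightarrow> 'a \<Rightarrow> bool) \<Rightarrow> bool" where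
  "partial_order_on' P le \<longleftrightarrow>
     (\<forall>x\<in>P. le x x) \<and>
     (\<forall>x\<in>P. \<forall>y\<in>P. le x y \<and> le y x \<longrightarrow> x = y) \<and>
     (\<forall>x\<in>P. \<forall>y\<in>P. \<forall>z\<in>P. le x y \<and> le y z \<longrightarrow> le x z)"

definition strict :: "('a \<Rightarrow> 'a \<Rightarrow> bool) \<Rightarrow> 'a \<Rightarrow> 'a \<Rightarrow> bool" where
  "strict le x y \<longleftrightarrow> le x y \<and> x \<noteq> y"

definition order_complex :: "'a set \<Rightarrow> ('a \<Rightarrow> 'a \<Rightarrow> bool) \<Rightarrow> 'a set set" where
  "order_complex P le = {F. F \<subseteq> P \<and> finite F \<and> (\<forall>x\<in>F. \<forall>y\<in>F. le x y \<or> le y x)}"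

definition cohen_macaulay_poset :: "'k::field itself \<Rightarrow> 'a set \<Rightarrow> ('a \<Rightarrow> 'a \<Rightarrow> bool) \<Rightarrow> bool" where
  "cohen_macaulay_poset TYPE('k) P le \<longleftrightarrow> SR_cohen_macaulay TYPE('k) (order_complex P le)"

definition red_euler_char :: "'a set \<Rightarrow> ('a \<Rightarrow> 'a \<Rightarrow> bool) \<Rightarrow> int" where
  "red_euler_char P le = (\<Sum>\<sigma>\<in>order_complex P le. - ((-1) ^ card \<sigma>))"

definition below :: "'a set \<Rightarrow> ('a \<Rightarrow> 'a \<Rightarrow> bool) \<Rightarrow> 'a \<Rightarrow> 'a set" where
  "below P le x = {z\<in>P. strict le z x}"

definition poset_ideal :: "'a set \<Rightarrow> ('a \<Rightarrow> 'a \<Rightarrow> bool) \<Rightarrow> 'a set \<Rightarrow> bool" where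
  "poset_ideal P le Q \<longleftrightarrow> Q \<subseteq> P \<and> (\<forall>x\<in>Q. \<forall>y\<in>P. strict le y x \<longrightarrow> y \<in> Q)"

section \<open>The poset P \<uplus> Q on P \<union> Q*, with Inl x = x and Inr x = x*\<close>

definition uplus_carrier :: "'a set \<Rightarrow> 'a set \<Rightarrow> ('a + 'a) set" where
  "uplus_carrier P Q = Inl ` P \<union> Inr ` Q"

fun uplus_less :: "('a \<Rightarrow> 'a \<Rightarrow> bool) \<Rightarrow> 'a set \<Rightarrow> 'a + 'a \<Rightarrow> 'a + 'a \<Rightarrow> bool" where
  "uplus_less le Q (Inl x) (Inl y) = strict le x y"
| "uplus_less le Q (Inr x) (Inr y) = strict le x y"
| "uplus_less le Q (Inr x) (Inl y) = (x \<in> Q \<and> le x y)"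
| "uplus_less le Q (Inl x) (Inr y) = False"

definition uplus_le :: "('a \<Rightarrow> 'a \<Rightarrow> bool) \<Rightarrow> 'a set \<Rightarrow> 'a + 'a \<Rightarrow> 'a + 'a \<Rightarrow> bool" where
  "uplus_le le Q a b \<longleftrightarrow> a = b \<or> uplus_less le Q a b"

end

theory Submission
  imports Defs "HOL-Library.FuncSet"
begin

text \<open>
  A regular sequence of length \<open>n\<close> on \<open>k[\<Delta>]\<close> makes the Koszul complex of the variables exact in degrees below
  \<open>n\<close>. Its strand of multidegree \<open>-1\<close> on \<open>U\<close> and \<open>0\<close> elsewhere is the cochain complex of \<open>\<Delta>\<close> with the vertices
  \<open>U\<close> deleted, and from these deletions one obtains that the links of \<open>\<Delta>\<close> have no cohomology below the top degree.
  Conversely, if the vertices of a complex with this property are coloured by \<open>n\<close> colours that are distinct on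
  each face, as those of an order complex are by rank, then the sums of the variables of one colour form a
  regular sequence.

  For the order complex of \<open>P\<close> the hypothesis on the Euler characteristics makes the link of a chain of \<open>P - Q\<close>
  acyclic in the top degree as well. Chains of \<open>P \<uplus> Q\<close> containing a given one are paired by adding or removing
  the unstarred copy of their largest starred element, or the starred copy of their smallest unstarred one.
  What is left over is a complex of chains of \<open>P\<close>, either acyclic or shifted by one degree, so the links of
  \<open>P \<uplus> Q\<close> have no cohomology below a top degree that is one more than that of \<open>P\<close>.
\<close>

section \<open>Cochains on families of finite sets\<close>

definition orient_sign :: "('v \<Rightarrow> nat) \<Rightarrow> 'v \<Rightarrow> 'v set \<Rightarrow> 'r::comm_ring_1" where
  "orient_sign \<nu> v G = (-1) ^ card {w \<in> G. \<nu> w < \<nu> v}"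

definition orients :: "('v \<Rightarrow> nat) \<Rightarrow> 'v set set \<Rightarrow> bool" where
  "orients \<nu> X \<longleftrightarrow> (\<forall>G\<in>X. finite G \<and> inj_on \<nu> G)"

definition convex_family :: "'v set set \<Rightarrow> bool" where
  "convex_family X \<longleftrightarrow> (\<forall>A\<in>X. \<forall>C\<in>X. \<forall>B. A \<subseteq> B \<and> B \<subseteq> C \<longrightarrow> B \<in> X)"

definition removable :: "'v set set \<Rightarrow> 'v set \<Rightarrow> 'v set" where
  "removable X G = {v \<in> G. G - {v} \<in> X}"

text \<open>With the weights \<open>x = (\<lambda>_. 1)\<close> this is the simplicial coboundary, with the variables of a polynomial
  ring as weights it is the differential of a Koszul complex.\<close>

definition weighted_coboundary ::
    "('v \<Rightarrow> nat) \<Rightarrow> ('v \<Rightarrow> 'r::comm_ring_1) \<Rightarrow> 'v set set \<Rightarrow> ('v set \<Rightarrow> 'r) \<Rightarrow> 'v set \<Rightarrow> 'r" where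
  "weighted_coboundary \<nu> x X c G = (\<Sum>v\<in>removable X G. orient_sign \<nu> v G * x v * c (G - {v}))"

abbreviation coboundary ::
    "('v \<Rightarrow> nat) \<Rightarrow> 'v set set \<Rightarrow> ('v set \<Rightarrow> 'r::comm_ring_1) \<Rightarrow> 'v set \<Rightarrow> 'r" where
  "coboundary \<nu> X \<equiv> weighted_coboundary \<nu> (\<lambda>_. 1) X"

lemma orientsD: "orients \<nu> X \<Longrightarrow> G \<in> X \<Longrightarrow> finite G" "orients \<nu> X \<Longrightarrow> G \<in> X \<Longrightarrow> inj_on \<nu> G"
  by (auto simp: orients_def)

lemma orients_subset: "orients \<nu> X \<Longrightarrow> Y \<subseteq> X \<Longrightarrow> orients \<nu> Y"
  by (auto simp: orients_def)

lemma convex_familyD: "convex_family X \<Longrightarrow> A \<in> X \<Longrightarrow> C \<in> X \<Longrightarrow> A \<subseteq> B \<Longrightarrow> B \<subseteq> C \<Longrightarrow> B \<in> X"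
  unfolding convex_family_def by blast

lemma finite_removable: "finite G \<Longrightarrow> finite (removable X G)"
  by (simp add: removable_def)

lemma card_removable: "finite G \<Longrightarrow> v \<in> removable X G \<Longrightarrow> card G = Suc (card (G - {v}))"
  by (simp add: removable_def card.remove del: card_Diff_insert)

lemma orient_sign_square [simp]: "orient_sign \<nu> v G * orient_sign \<nu> v G = 1"
  by (simp add: orient_sign_def flip: power_mult_distrib)

lemma orient_sign_square_left [simp]: "orient_sign \<nu> v G * (orient_sign \<nu> v G * a) = a"
  by (simp flip: mult.assoc)

lemma orient_sign_remove_above:
  assumes "\<nu> u \<le> \<nu> v"
  shows "orient_sign \<nu> u (G - {v}) = orient_sign \<nu> u G"
proof -
  have "{w \<in> G - {v}. \<nu> w < \<nu> u} = {w \<in> G. \<nu> w < \<nu> u}" using assms by auto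
  then show ?thesis by (simp add: orient_sign_def)
qed

lemma orient_sign_remove_below:
  assumes "finite G" "u \<in> G" "\<nu> u < \<nu> v"
  shows "orient_sign \<nu> v (G - {u}) = - orient_sign \<nu> v G"
proof -
  have "{w \<in> G. \<nu> w < \<nu> v} = insert u {w \<in> G - {u}. \<nu> w < \<nu> v}" using assms by auto
  then have "card {w \<in> G. \<nu> w < \<nu> v} = Suc (card {w \<in> G - {u}. \<nu> w < \<nu> v})"
    using assms(1) by (simp add: card_insert_if)
  then show ?thesis by (simp add: orient_sign_def)
qed

lemma orient_sign_swap:
  assumes "finite G" "u \<in> G" "v \<in> G" "\<nu> u \<noteq> \<nu> v"
  shows "orient_sign \<nu> u G * orient_sign \<nu> v (G - {u}) = - (orient_sign \<nu> v G * orient_sign \<nu> u (G - {v}))"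
  using assms by (cases "\<nu> u < \<nu> v") (auto simp: orient_sign_remove_below orient_sign_remove_above)

lemma weighted_coboundary_add:
  "weighted_coboundary \<nu> x X (\<lambda>G. b G + c G) G = weighted_coboundary \<nu> x X b G +
      weighted_coboundary \<nu> x X c G"
  by (simp add: weighted_coboundary_def algebra_simps sum.distrib)

lemma weighted_coboundary_diff:
  "weighted_coboundary \<nu> x X (\<lambda>G. b G - c G) G =
      weighted_coboundary \<nu> x X b G - weighted_coboundary \<nu> x X c G"
  by (simp add: weighted_coboundary_def algebra_simps sum_subtractf)

lemma weighted_coboundary_scale:
  "weighted_coboundary \<nu> x X (\<lambda>G. r * c G) G = r * weighted_coboundary \<nu> x X c G"
  by (simp add: weighted_coboundary_def algebra_simps sum_distrib_left)

lemma weighted_coboundary_sum: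
  "weighted_coboundary \<nu> x X (\<lambda>G. \<Sum>u\<in>A. c u G) G = (\<Sum>u\<in>A. weighted_coboundary \<nu> x X (c u) G)"
  unfolding weighted_coboundary_def sum_distrib_left by (rule sum.swap)

lemma weighted_coboundary_cong:
  assumes "\<And>v. v \<in> removable X G \<Longrightarrow> b (G - {v}) = c (G - {v})"
  shows "weighted_coboundary \<nu> x X b G = weighted_coboundary \<nu> x X c G"
  unfolding weighted_coboundary_def by (rule sum.cong) (use assms in auto)

lemma weighted_coboundary_eq_0:
  assumes "\<And>v. v \<in> removable X G \<Longrightarrow> c (G - {v}) = 0"
  shows "weighted_coboundary \<nu> x X c G = 0"
  unfolding weighted_coboundary_def by (rule sum.neutral) (use assms in auto)

lemma weighted_coboundary_subfamily:
  assumes "finite G" "Y \<subseteq> X" "\<And>v. v \<in> G \<Longrightarrow> G - {v} \<in> X - Y \<Longrightarrow> c (G - {v}) = 0"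
  shows "weighted_coboundary \<nu> x X c G = weighted_coboundary \<nu> x Y c G"
  unfolding weighted_coboundary_def
  by (rule sum.mono_neutral_right) (use assms in \<open>auto simp: removable_def\<close>)

lemma sum_antisymmetric:
  fixes f :: "'a \<Rightarrow> 'a \<Rightarrow> 'b::ab_group_add" and \<nu> :: "'a \<Rightarrow> 'c::linorder"
  assumes fin: "finite S" and S_sym: "sym S" "\<And>v w. (v, w) \<in> S \<Longrightarrow> \<nu> v \<noteq> \<nu> w"
    and f_antisym: "\<And>v w. (v, w) \<in> S \<Longrightarrow> f w v = - f v w"
  shows "(\<Sum>(v, w)\<in>S. f v w) = 0"
proof -
  let ?L = "{(v, w) \<in> S. \<nu> v < \<nu> w}" and ?U = "{(v, w) \<in> S. \<nu> w < \<nu> v}"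
  have S_eq: "S = ?L \<union> ?U" using S_sym(2) by (auto simp: neq_iff)
  have "(\<Sum>(v, w)\<in>?U. f v w) = (\<Sum>(v, w)\<in>?L. f w v)"
    by (rule sum.reindex_bij_witness[of _ prod.swap prod.swap]) (auto intro: symD[OF S_sym(1)])
  also have "\<dots> = - (\<Sum>(v, w)\<in>?L. f v w)"
    unfolding sum_negf[symmetric] using f_antisym by (intro sum.cong) auto
  moreover have "(\<Sum>(v, w)\<in>S. f v w) = (\<Sum>(v, w)\<in>?L. f v w) + (\<Sum>(v, w)\<in>?U. f v w)"
    by (subst S_eq, rule sum.union_disjoint) (auto intro: finite_subset[OF _ fin])
  ultimately show ?thesis by simp
qed

lemma weighted_coboundary_coboundary:
  fixes c :: "'v set \<Rightarrow> 'r::comm_ring_1"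
  assumes orients: "orients \<nu> X" and conv: "convex_family X" and G_in: "G \<in> X"
  shows "weighted_coboundary \<nu> x X (weighted_coboundary \<nu> x X c) G = 0"
proof -
  note fin = orientsD(1)[OF orients G_in] and inj = orientsD(2)[OF orients G_in]
  define f where "f v w = orient_sign \<nu> v G * orient_sign \<nu> w (G - {v}) * (x v * x w * c (G - {v} - {w}))"
    for v w
  let ?S = "{(v, w). v \<in> G \<and> w \<in> G \<and> v \<noteq> w \<and> G - {v} - {w} \<in> X}"
  have swap: "G - {v} - {w} = G - {w} - {v}" for v w by auto
  have "G - {v} \<in> X" if "G - {v} - {w} \<in> X" for v w
    by (rule convex_familyD[OF conv that G_in]) auto
  then have pairs: "(SIGMA v:removable X G. removable X (G - {v})) = ?S"
    by (auto simp: removable_def)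
  have "weighted_coboundary \<nu> x X (weighted_coboundary \<nu> x X c) G =
      (\<Sum>v\<in>removable X G. \<Sum>w\<in>removable X (G - {v}). f v w)"
    by (simp add: weighted_coboundary_def f_def sum_distrib_left mult_ac)
  also have "\<dots> = (\<Sum>(v, w)\<in>?S. f v w)"
    using fin by (simp add: sum.Sigma finite_removable pairs)
  also have "\<dots> = 0"
  proof (rule sum_antisymmetric[where \<nu> = \<nu>])
    show "finite ?S" using fin by (intro finite_subset[of ?S "G \<times> G"]) auto
    show "sym ?S" using swap by (auto simp: sym_def)
    show distinct: "\<nu> v \<noteq> \<nu> w" if "(v, w) \<in> ?S" for v w using that inj by (auto simp: inj_on_def)
    fix v w assume vw_in: "(v, w) \<in> ?S"
    then have "orient_sign \<nu> w G * orient_sign \<nu> v (G - {w}) =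
        (- (orient_sign \<nu> v G * orient_sign \<nu> w (G - {v})) :: 'r)"
      using fin distinct[OF vw_in] by (intro orient_sign_swap) auto
    then show "f w v = - f v w"
      by (simp add: f_def swap[of w v] mult.commute[of "x w"])
  qed
  finally show ?thesis .
qed

definition cone_homotopy :: "('v \<Rightarrow> nat) \<Rightarrow> 'v \<Rightarrow> ('v set \<Rightarrow> 'r::comm_ring_1) \<Rightarrow> 'v set \<Rightarrow> 'r" where
  "cone_homotopy \<nu> u c G = (if u \<in> G then 0 else orient_sign \<nu> u (insert u G) * c (insert u G))"

lemma removable_insert_apex:
  assumes insert_mem: "\<And>G. G \<in> X \<Longrightarrow> insert u G \<in> X" and delete_mem: "\<And>G. G \<in> X \<Longrightarrow> G - {u} \<in> X"
    and G_in: "G \<in> X" "u \<notin> G"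
  shows "removable X (insert u G) = insert u (removable X G)"
proof -
  have "insert u G - {v} \<in> X \<longleftrightarrow> G - {v} \<in> X" if "v \<in> G" for v
  proof -
    have "insert u G - {v} = insert u (G - {v})" "G - {v} = insert u G - {v} - {u}" using G_in(2) that by auto
    then show ?thesis using insert_mem delete_mem by metis
  qed
  then show ?thesis using G_in by (auto simp: removable_def)
qed

lemma cone_homotopy_remove:
  fixes c :: "'v set \<Rightarrow> 'r::comm_ring_1"
  assumes "finite G" "inj_on \<nu> (insert u G)" "u \<notin> G" "v \<in> G"
  shows "orient_sign \<nu> v G * cone_homotopy \<nu> u c (G - {v})
      = - (orient_sign \<nu> u (insert u G) * (orient_sign \<nu> v (insert u G) * c (insert u G - {v})))"
proof -
  let ?H = "insert u G"
  have H: "\<nu> u \<noteq> \<nu> v" "insert u (G - {v}) = ?H - {v}" "?H - {u} = G"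
    using assms by (auto simp: inj_on_def)
  have "orient_sign \<nu> v G = orient_sign \<nu> u ?H * (orient_sign \<nu> u ?H * orient_sign \<nu> v (?H - {u}) :: 'r)"
    using H(3) by simp
  also have "\<dots> = - (orient_sign \<nu> u ?H * (orient_sign \<nu> v ?H * orient_sign \<nu> u (?H - {v})))"
    using H assms(1,4) by (subst orient_sign_swap) auto
  finally show ?thesis using H(2) assms(3) by (simp add: cone_homotopy_def mult_ac)
qed

lemma cone_homotopy_coboundary:
  fixes c :: "'v set \<Rightarrow> 'r::comm_ring_1"
  assumes orients: "orients \<nu> X" and insert_mem: "\<And>G. G \<in> X \<Longrightarrow> insert u G \<in> X"
    and delete_mem: "\<And>G. G \<in> X \<Longrightarrow> G - {u} \<in> X"
    and G_in: "G \<in> X"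
  shows "weighted_coboundary \<nu> x X (cone_homotopy \<nu> u c) G +
      cone_homotopy \<nu> u (weighted_coboundary \<nu> x X c) G = x u * c G"
proof (cases "u \<in> G")
  case True
  have fin: "finite (removable X G)" using finite_removable[OF orientsD(1)[OF orients G_in]] .
  have "weighted_coboundary \<nu> x X (cone_homotopy \<nu> u c) G =
      (\<Sum>v\<in>removable X G. if v = u then x u * c G else 0)"
    unfolding weighted_coboundary_def cone_homotopy_def
    by (rule sum.cong) (use True in \<open>auto simp: insert_absorb mult.assoc mult.left_commute\<close>)
  also have "\<dots> = x u * c G" using fin True delete_mem[OF G_in] by (simp add: removable_def)
  finally show ?thesis using True by (simp add: cone_homotopy_def)
next
  case False
  let ?H = "insert u G" and ?R = "removable X G"
  have fin: "finite G" "finite ?R" using orientsD(1)[OF orients G_in] by (simp_all add: finite_removable)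
  have inj: "inj_on \<nu> ?H" by (rule orientsD(2)[OF orients insert_mem[OF G_in]])
  have "removable X ?H = insert u ?R" by (rule removable_insert_apex[OF insert_mem delete_mem G_in False])
  moreover have "u \<notin> ?R" using False by (simp add: removable_def)
  ultimately have "weighted_coboundary \<nu> x X c ?H =
      orient_sign \<nu> u ?H * x u * c G + (\<Sum>v\<in>?R. orient_sign \<nu> v ?H * x v * c (?H - {v}))"
    unfolding weighted_coboundary_def using fin False by simp
  then have homotopy: "cone_homotopy \<nu> u (weighted_coboundary \<nu> x X c) G =
      x u * c G + (\<Sum>v\<in>?R. orient_sign \<nu> u ?H * (orient_sign \<nu> v ?H * x v * c (?H - {v})))"
    using False by (simp add: cone_homotopy_def distrib_left sum_distrib_left mult.assoc)
  have "orient_sign \<nu> v G * x v * cone_homotopy \<nu> u c (G - {v})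
      = - (orient_sign \<nu> u ?H * (orient_sign \<nu> v ?H * x v * c (?H - {v})))" if "v \<in> ?R" for v
  proof -
    have "v \<in> G" using that by (simp add: removable_def)
    from cone_homotopy_remove[OF fin(1) inj False this, of c] show ?thesis
      by (simp add: mult.commute[of _ "x v"] mult.assoc mult.left_commute[of _ "x v"] flip: mult_minus_right)
  qed
  then have "weighted_coboundary \<nu> x X (cone_homotopy \<nu> u c) G
      = - (\<Sum>v\<in>?R. orient_sign \<nu> u ?H * (orient_sign \<nu> v ?H * x v * c (?H - {v})))"
    unfolding weighted_coboundary_def sum_negf[symmetric] by (rule sum.cong[OF refl])
  then show ?thesis using homotopy by simp
qed

section \<open>Exactness in a given degree\<close>

text \<open>Degrees are counted by cardinality: if \<open>X\<close> consists of the faces of a complex that contain a face \<open>F\<close>,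
  degree \<open>i\<close> is the reduced cohomology of the link of \<open>F\<close> in degree \<open>i - card F - 1\<close>.\<close>

definition cocycle :: "('v \<Rightarrow> nat) \<Rightarrow> 'v set set \<Rightarrow> nat \<Rightarrow> ('v set \<Rightarrow> 'k::comm_ring_1) \<Rightarrow> bool" where
  "cocycle \<nu> X i c \<longleftrightarrow> (\<forall>G\<in>X. card G = Suc i \<longrightarrow> coboundary \<nu> X c G = 0)"

definition exact_at :: "'k::field itself \<Rightarrow> ('v \<Rightarrow> nat) \<Rightarrow> 'v set set \<Rightarrow> nat \<Rightarrow> bool" where
  "exact_at TYPE('k) \<nu> X i \<longleftrightarrow>
     (\<forall>c :: 'v set \<Rightarrow> 'k. cocycle \<nu> X i c \<longrightarrow> (\<exists>b. \<forall>G\<in>X. card G = i \<longrightarrow> c G = coboundary \<nu> X b G))"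

lemma exact_atI:
  assumes "\<And>c :: 'v set \<Rightarrow> 'k::field. cocycle \<nu> X i c \<Longrightarrow> \<exists>b. \<forall>G\<in>X. card G = i \<longrightarrow> c G = coboundary \<nu> X b G"
  shows "exact_at TYPE('k) \<nu> X i"
  using assms by (simp add: exact_at_def)

lemma exact_atE:
  fixes c :: "'v set \<Rightarrow> 'k::field"
  assumes "exact_at TYPE('k) \<nu> X i" "cocycle \<nu> X i c"
  obtains b where "\<And>G. G \<in> X \<Longrightarrow> card G = i \<Longrightarrow> c G = coboundary \<nu> X b G"
  using assms unfolding exact_at_def by blast

lemma cocycleD: "cocycle \<nu> X i c \<Longrightarrow> G \<in> X \<Longrightarrow> card G = Suc i \<Longrightarrow> coboundary \<nu> X c G = 0"
  by (simp add: cocycle_def)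

lemma exact_at_trivial:
  assumes "\<And>G. G \<in> X \<Longrightarrow> card G \<noteq> i"
  shows "exact_at TYPE('k::field) \<nu> X i"
  using assms by (auto simp: exact_at_def)

lemma exact_at_cone:
  fixes X :: "'v set set"
  assumes orients: "orients \<nu> X" and X_cone: "\<And>G. G \<in> X \<Longrightarrow> insert u G \<in> X" "\<And>G. G \<in> X \<Longrightarrow> G - {u} \<in> X"
  shows "exact_at TYPE('k::field) \<nu> X i"
proof (rule exact_atI)
  fix c :: "'v set \<Rightarrow> 'k"
  assume cocycle: "cocycle \<nu> X i c"
  have "c G = coboundary \<nu> X (cone_homotopy \<nu> u c) G" if G_in: "G \<in> X" "card G = i" for G
  proof -
    have "cone_homotopy \<nu> u (coboundary \<nu> X c) G = 0"
      using cocycleD[OF cocycle X_cone(1)[OF G_in(1)]] orientsD(1)[OF orients G_in(1)] G_in(2)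
      by (simp add: cone_homotopy_def)
    then show ?thesis using cone_homotopy_coboundary[OF orients X_cone G_in(1), of "\<lambda>_. 1" c] by simp
  qed
  then show "\<exists>b. \<forall>G\<in>X. card G = i \<longrightarrow> c G = coboundary \<nu> X b G" by blast
qed

context
  fixes \<nu> :: "'v \<Rightarrow> nat" and X Y Z :: "'v set set"
  assumes orients: "orients \<nu> X" and convex: "convex_family X"
    and split: "X = Y \<union> Z" "Y \<inter> Z = {}"
    and lower: "\<And>G v. G \<in> Y \<Longrightarrow> v \<in> G \<Longrightarrow> G - {v} \<notin> Z"
begin

lemma mem_split: "G \<in> X \<longleftrightarrow> G \<in> Y \<or> G \<in> Z" "G \<in> Y \<Longrightarrow> G \<notin> Z"
  using split by auto

lemma coboundary_on_lower:
  "G \<in> Y \<Longrightarrow> coboundary \<nu> X c G = coboundary \<nu> Y c G"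
  by (rule weighted_coboundary_subfamily) (use mem_split lower orientsD(1)[OF orients] in auto)

lemma coboundary_on_upper:
  assumes "G \<in> Z" "card G = Suc i" "\<And>H. H \<in> Y \<Longrightarrow> card H = i \<Longrightarrow> c H = 0"
  shows "coboundary \<nu> X c G = coboundary \<nu> Z c G"
  by (rule weighted_coboundary_subfamily) (use assms mem_split orientsD(1)[OF orients] in auto)

definition extend_by_zero :: "('v set \<Rightarrow> 'k::comm_ring_1) \<Rightarrow> 'v set \<Rightarrow> 'k" where
  "extend_by_zero c G = (if G \<in> Z then c G else 0)"

lemma coboundary_extend_by_zero:
  assumes G_in: "G \<in> X"
  shows "coboundary \<nu> X (extend_by_zero c) G = (if G \<in> Z then coboundary \<nu> Z c G else 0)"
proof (cases "G \<in> Z")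
  case True
  have "coboundary \<nu> X (extend_by_zero c) G = coboundary \<nu> Z (extend_by_zero c) G"
    by (rule weighted_coboundary_subfamily)
       (use G_in mem_split orientsD(1)[OF orients] in \<open>auto simp: extend_by_zero_def\<close>)
  also have "\<dots> = coboundary \<nu> Z c G"
    by (rule weighted_coboundary_cong) (simp add: extend_by_zero_def removable_def)
  finally show ?thesis using True by simp
next
  case False
  then have "coboundary \<nu> X (extend_by_zero c) G = 0"
    using G_in mem_split(1) lower
    by (intro weighted_coboundary_eq_0) (auto simp: extend_by_zero_def removable_def)
  then show ?thesis using False by simp
qed

lemma exact_at_union:
  assumes exact_Y: "exact_at TYPE('k::field) \<nu> Y i" and exact_Z: "exact_at TYPE('k) \<nu> Z i"
  shows "exact_at TYPE('k) \<nu> X i"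
proof (rule exact_atI)
  fix c :: "'v set \<Rightarrow> 'k"
  assume cocycle: "cocycle \<nu> X i c"
  then have "cocycle \<nu> Y i c" using mem_split by (auto simp: cocycle_def coboundary_on_lower[symmetric])
  then obtain b where b_primitive: "\<And>G. G \<in> Y \<Longrightarrow> card G = i \<Longrightarrow> c G = coboundary \<nu> Y b G"
    using exact_atE[OF exact_Y] by blast
  define u where "u G = c G - coboundary \<nu> X b G" for G
  have u_lower: "u G = 0" if "G \<in> Y" "card G = i" for G
    using b_primitive[OF that] by (simp add: u_def coboundary_on_lower[OF that(1)])
  have "cocycle \<nu> Z i u"
    unfolding cocycle_def
  proof (intro ballI impI)
    fix G assume G_in: "G \<in> Z" "card G = Suc i"
    have "coboundary \<nu> Z u G = coboundary \<nu> X u G"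
      by (rule coboundary_on_upper[symmetric, OF G_in u_lower])
    also have "\<dots> = 0"
      unfolding u_def weighted_coboundary_diff
      using cocycleD[OF cocycle _ G_in(2)] weighted_coboundary_coboundary[OF orients convex] mem_split G_in(1)
      by auto
    finally show "coboundary \<nu> Z u G = 0" .
  qed
  then obtain e where e_primitive: "\<And>G. G \<in> Z \<Longrightarrow> card G = i \<Longrightarrow> u G = coboundary \<nu> Z e G"
    using exact_atE[OF exact_Z] by blast
  have "u G = coboundary \<nu> X (extend_by_zero e) G" if "G \<in> X" "card G = i" for G
    using that mem_split u_lower e_primitive by (auto simp: coboundary_extend_by_zero)
  then have "c G = coboundary \<nu> X (\<lambda>G. b G + extend_by_zero e G) G" if "G \<in> X" "card G = i" for G
    using that unfolding weighted_coboundary_add by (simp add: u_def algebra_simps)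
  then show "\<exists>b. \<forall>G\<in>X. card G = i \<longrightarrow> c G = coboundary \<nu> X b G" by blast
qed

lemma exact_at_upper:
  assumes exact_X: "exact_at TYPE('k::field) \<nu> X i" and exact_Y: "\<And>j. i = Suc j \<Longrightarrow> exact_at TYPE('k) \<nu> Y j"
  shows "exact_at TYPE('k) \<nu> Z i"
proof (rule exact_atI)
  fix c :: "'v set \<Rightarrow> 'k"
  assume "cocycle \<nu> Z i c"
  then have "cocycle \<nu> X i (extend_by_zero c)"
    using mem_split by (auto simp: cocycle_def coboundary_extend_by_zero)
  then obtain b where b_primitive: "\<And>G. G \<in> X \<Longrightarrow> card G = i \<Longrightarrow> extend_by_zero c G = coboundary \<nu> X b G"
    using exact_atE[OF exact_X] by blast
  have b_upper: "c G = coboundary \<nu> X b G" if "G \<in> Z" "card G = i" for G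
    using b_primitive[of G] that mem_split by (simp add: extend_by_zero_def)
  show "\<exists>b. \<forall>G\<in>Z. card G = i \<longrightarrow> c G = coboundary \<nu> Z b G"
  proof (cases i)
    case 0
    have "c G = coboundary \<nu> Z b G" if "G \<in> Z" "card G = i" for G
    proof -
      have "G = {}" using that 0 mem_split orientsD(1)[OF orients, of G] by auto
      then show ?thesis using b_upper that by (simp add: weighted_coboundary_def removable_def)
    qed
    then show ?thesis by blast
  next
    case (Suc j)
    have "cocycle \<nu> Y j b"
      using mem_split Suc
      by (auto simp: cocycle_def b_primitive[symmetric] extend_by_zero_def coboundary_on_lower[symmetric])
    then obtain e where e_primitive: "\<And>G. G \<in> Y \<Longrightarrow> card G = j \<Longrightarrow> b G = coboundary \<nu> Y e G"
      using exact_atE[OF exact_Y[OF Suc]] by blast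
    define u where "u G = b G - coboundary \<nu> X e G" for G
    have "c G = coboundary \<nu> Z u G" if G_in: "G \<in> Z" "card G = i" for G
    proof -
      have "coboundary \<nu> Z u G = coboundary \<nu> X u G"
        by (rule coboundary_on_upper[symmetric, OF G_in(1) G_in(2)[unfolded Suc]])
           (use e_primitive in \<open>auto simp: u_def coboundary_on_lower\<close>)
      also have "\<dots> = coboundary \<nu> X b G"
        unfolding u_def weighted_coboundary_diff
        using weighted_coboundary_coboundary[OF orients convex] mem_split G_in(1) by auto
      finally show ?thesis using b_upper[OF G_in] by simp
    qed
    then show ?thesis by blast
  qed
qed

lemma exact_at_lower:
  assumes exact_X: "exact_at TYPE('k::field) \<nu> X i" and exact_Z: "exact_at TYPE('k) \<nu> Z (Suc i)"
  shows "exact_at TYPE('k) \<nu> Y i"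
proof (rule exact_atI)
  fix c :: "'v set \<Rightarrow> 'k"
  assume cocycle: "cocycle \<nu> Y i c"
  have u_lower: "coboundary \<nu> X c G = 0" if "G \<in> Y" "card G = Suc i" for G
    using cocycleD[OF cocycle that] by (simp add: coboundary_on_lower[OF that(1)])
  have "cocycle \<nu> Z (Suc i) (coboundary \<nu> X c)"
    unfolding cocycle_def
  proof (intro ballI impI)
    fix G assume G_in: "G \<in> Z" "card G = Suc (Suc i)"
    have "coboundary \<nu> Z (coboundary \<nu> X c) G = coboundary \<nu> X (coboundary \<nu> X c) G"
      by (rule coboundary_on_upper[symmetric, OF G_in u_lower])
    then show "coboundary \<nu> Z (coboundary \<nu> X c) G = 0"
      using weighted_coboundary_coboundary[OF orients convex] mem_split G_in(1) by auto
  qed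
  then obtain b where b_primitive: "\<And>G. G \<in> Z \<Longrightarrow> card G = Suc i \<Longrightarrow> coboundary \<nu> X c G = coboundary \<nu> Z b G"
    using exact_atE[OF exact_Z] by blast
  have "cocycle \<nu> X i (\<lambda>G. c G - extend_by_zero b G)"
    unfolding cocycle_def weighted_coboundary_diff using mem_split u_lower b_primitive
    by (auto simp: coboundary_extend_by_zero)
  then obtain e where e_primitive: "\<And>G. G \<in> X \<Longrightarrow> card G = i \<Longrightarrow> c G - extend_by_zero b G = coboundary \<nu> X e G"
    using exact_atE[OF exact_X] by blast
  have "c G = coboundary \<nu> Y e G" if "G \<in> Y" "card G = i" for G
    using e_primitive[of G] that mem_split by (auto simp: extend_by_zero_def coboundary_on_lower)
  then show "\<exists>b. \<forall>G\<in>Y. card G = i \<longrightarrow> c G = coboundary \<nu> Y b G" by blast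
qed

end

lemma exact_at_filtration:
  fixes key :: "'v set \<Rightarrow> 'b" and rank :: "'b \<Rightarrow> nat"
  assumes orients: "orients \<nu> X" and convex: "convex_family X" and finite: "finite X"
    and mono: "\<And>G H. G \<in> X \<Longrightarrow> H \<in> X \<Longrightarrow> G \<subseteq> H \<Longrightarrow> key G = key H \<or> rank (key G) < rank (key H)"
    and levels: "\<And>k. k \<in> key ` X \<Longrightarrow> exact_at TYPE('k::field) \<nu> {G \<in> X. key G = k} i"
  shows "exact_at TYPE('k) \<nu> X i"
proof -
  have "exact_at TYPE('k) \<nu> {G \<in> X. key G \<in> K} i"
    if "finite K" "K \<subseteq> key ` X" "convex_family {G \<in> X. key G \<in> K}" for K
    using that
  proof (induction K rule: finite_ranking_induct[where f = rank])
    case empty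
    show ?case by (rule exact_at_trivial) simp
  next
    case (insert k K)
    let ?X = "{G \<in> X. key G \<in> insert k K}" and ?Y = "{G \<in> X. key G \<in> K}" and ?Z = "{G \<in> X. key G = k}"
    show ?case
    proof (cases "k \<in> K")
      case True
      then show ?thesis using insert by (simp add: insert_absorb)
    next
      case False
      have not_below: "key G \<noteq> k" if "G \<in> ?X" "H \<in> ?Y" "G \<subseteq> H" for G H
        using mono[of G H] insert.hyps(2)[of "key H"] False that by auto
      have "convex_family ?Y"
        unfolding convex_family_def
      proof clarify
        fix A C B assume "A \<in> X" "key A \<in> K" "C \<in> X" "key C \<in> K" "A \<subseteq> B" "B \<subseteq> C"
        then show "B \<in> X \<and> key B \<in> K"
          using convex_familyD[OF insert.prems(2), of A C B] not_below[of B C] by auto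
      qed
      then have exact_Y: "exact_at TYPE('k) \<nu> ?Y i" using insert by auto
      have exact_Z: "exact_at TYPE('k) \<nu> ?Z i" using insert.prems levels by simp
      show ?thesis
        by (rule exact_at_union[OF _ insert.prems(2) _ _ _ exact_Y exact_Z])
           (use False not_below orients_subset[OF orients] in auto)
    qed
  qed
  from this[of "key ` X"] show ?thesis
    using convex finite by (simp add: Collect_conj_eq[of "\<lambda>G. G \<in> X"] inf_absorb1 subset_eq)
qed

lemma exact_at_transfer:
  fixes f :: "'v set \<Rightarrow> 'w set"
  assumes inj: "inj_on f X"
    and card: "\<And>G. G \<in> X \<Longrightarrow> card G = card (f G) + s"
    and removable_bij: "\<And>G. G \<in> X \<Longrightarrow> bij_betw \<pi> (removable X G) (removable (f ` X) (f G))"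
    and f_remove: "\<And>G v. G \<in> X \<Longrightarrow> v \<in> removable X G \<Longrightarrow> f (G - {v}) = f G - {\<pi> v}"
    and sign: "\<And>G v. G \<in> X \<Longrightarrow> v \<in> removable X G \<Longrightarrow> orient_sign \<nu> v G = (orient_sign \<nu>' (\<pi> v) (f G) :: 'k)"
    and exact: "exact_at TYPE('k::field) \<nu>' (f ` X) i"
  shows "exact_at TYPE('k) \<nu> X (i + s)"
proof (rule exact_atI)
  have chain_map: "coboundary \<nu> X (\<lambda>G. d (f G)) G = coboundary \<nu>' (f ` X) d (f G)"
    if G_in: "G \<in> X" for G and d :: "'w set \<Rightarrow> 'k"
  proof -
    have "coboundary \<nu> X (\<lambda>G. d (f G)) G =
        (\<Sum>v\<in>removable X G. orient_sign \<nu>' (\<pi> v) (f G) * 1 * d (f G - {\<pi> v}))"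
      unfolding weighted_coboundary_def
      by (rule sum.cong[OF refl]) (simp only: f_remove[OF G_in] sign[OF G_in])
    also have "\<dots> = coboundary \<nu>' (f ` X) d (f G)"
      unfolding weighted_coboundary_def by (rule sum.reindex_bij_betw[OF removable_bij[OF G_in]])
    finally show ?thesis .
  qed
  fix c :: "'v set \<Rightarrow> 'k"
  assume cocycle: "cocycle \<nu> X (i + s) c"
  define d where "d H = c (inv_into X f H)" for H
  have d_f: "d (f G) = c G" if "G \<in> X" for G using that inj by (simp add: d_def)
  have "coboundary \<nu>' (f ` X) d (f G) = coboundary \<nu> X c G" if "G \<in> X" for G
    unfolding chain_map[OF that, symmetric]
    by (rule weighted_coboundary_cong) (simp add: d_f removable_def)
  then have "cocycle \<nu>' (f ` X) i d"
    using cocycle card by (auto simp: cocycle_def)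
  then obtain b where b_primitive: "\<And>H. H \<in> f ` X \<Longrightarrow> card H = i \<Longrightarrow> d H = coboundary \<nu>' (f ` X) b H"
    using exact_atE[OF exact] by blast
  have "c G = coboundary \<nu> X (\<lambda>G. b (f G)) G" if "G \<in> X" "card G = i + s" for G
    using b_primitive[of "f G"] d_f chain_map card that by simp
  then show "\<exists>b. \<forall>G\<in>X. card G = i + s \<longrightarrow> c G = coboundary \<nu> X b G" by blast
qed

lemma exact_at_collapse:
  fixes \<pi> :: "'v \<Rightarrow> 'w" and X :: "'v set set"
  assumes X_above_F: "F \<in> X" "\<And>G. G \<in> X \<Longrightarrow> F \<subseteq> G" "\<And>G. G \<in> X \<Longrightarrow> finite G" and D_subset: "D \<subseteq> F"
    and \<pi>_inj: "inj_on ((`) \<pi>) X" "\<And>G. G \<in> X \<Longrightarrow> inj_on \<pi> (G - D)" "\<And>G. G \<in> X \<Longrightarrow> \<pi> ` (G - D) = \<pi> ` G"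
    and removable_eq: "\<And>G. G \<in> X \<Longrightarrow> removable X G = G - F"
      "\<And>H. H \<in> (`) \<pi> ` X \<Longrightarrow> removable ((`) \<pi> ` X) H = H - \<pi> ` F"
    and less: "\<And>G v w. G \<in> X \<Longrightarrow> v \<in> G - F \<Longrightarrow> w \<in> G \<Longrightarrow> \<nu> w < \<nu> v \<longleftrightarrow> w \<notin> D \<and> \<nu>' (\<pi> w) < \<nu>' (\<pi> v)"
    and exact: "exact_at TYPE('k::field) \<nu>' ((`) \<pi> ` X) i"
  shows "exact_at TYPE('k) \<nu> X (i + card D)"
proof (rule exact_at_transfer[OF \<pi>_inj(1) _ _ _ _ exact, where \<pi> = \<pi>])
  fix G assume G_in: "G \<in> X"
  have diff: "\<pi> ` (G - A) = \<pi> ` G - \<pi> ` (A - D)" if "D \<subseteq> A" "A \<subseteq> G" for A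
  proof -
    have "\<pi> ` (G - A) = \<pi> ` ((G - D) - (A - D))" using that(1) by (intro arg_cong[where f = "(`) \<pi>"]) auto
    also have "\<dots> = \<pi> ` G - \<pi> ` (A - D)"
      using inj_on_image_set_diff[OF \<pi>_inj(2)[OF G_in], of "G - D" "A - D"] that(2) \<pi>_inj(3)[OF G_in] by auto
    finally show ?thesis .
  qed
  have "D \<subseteq> G" using D_subset X_above_F(2)[OF G_in] by (rule subset_trans)
  then have "card G = card (G - D) + card D"
    using X_above_F(3)[OF G_in] by (simp add: card_Diff_subset card_mono finite_subset[of D G])
  then show "card G = card (\<pi> ` G) + card D"
    using card_image[OF \<pi>_inj(2)[OF G_in]] \<pi>_inj(3)[OF G_in] by simp
  have "\<pi> ` (G - F) = \<pi> ` G - \<pi> ` F" using diff[OF D_subset X_above_F(2)[OF G_in]] \<pi>_inj(3)[OF X_above_F(1)]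
    by simp
  then show "bij_betw \<pi> (removable X G) (removable ((`) \<pi> ` X) (\<pi> ` G))"
    using G_in D_subset \<pi>_inj(2)[OF G_in] by (auto simp: bij_betw_def removable_eq intro: inj_on_subset)
  fix v assume "v \<in> removable X G"
  then have v_in: "v \<in> G - F" using removable_eq(1)[OF G_in] by simp
  have "insert v D \<subseteq> G" "insert v D - D = {v}" using v_in D_subset X_above_F(2)[OF G_in] by auto
  then have "\<pi> ` (G - insert v D) = \<pi> ` G - {\<pi> v}" using diff[of "insert v D"] by auto
  moreover have "G - insert v D = G - {v} - D" by auto
  moreover have "G - {v} \<in> X" using \<open>v \<in> removable X G\<close> by (simp add: removable_def)
  ultimately show "\<pi> ` (G - {v}) = \<pi> ` G - {\<pi> v}" using \<pi>_inj(3)[of "G - {v}"] by simp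
  let ?below = "{w \<in> G - D. \<nu>' (\<pi> w) < \<nu>' (\<pi> v)}"
  have "{w \<in> G. \<nu> w < \<nu> v} = ?below" using less[OF G_in v_in] by auto
  moreover have "\<pi> ` ?below = {w \<in> \<pi> ` G. \<nu>' w < \<nu>' (\<pi> v)}"
    unfolding \<pi>_inj(3)[OF G_in, symmetric] by auto
  moreover have "inj_on \<pi> ?below" by (rule inj_on_subset[OF \<pi>_inj(2)[OF G_in]]) auto
  ultimately have "card {w \<in> G. \<nu> w < \<nu> v} = card {w \<in> \<pi> ` G. \<nu>' w < \<nu>' (\<pi> v)}"
    using card_image[of \<pi> ?below] by simp
  then show "orient_sign \<nu> v G = (orient_sign \<nu>' (\<pi> v) (\<pi> ` G) :: 'k)" by (simp add: orient_sign_def)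
qed

definition inversion_sign :: "('v \<Rightarrow> nat) \<Rightarrow> ('v \<Rightarrow> nat) \<Rightarrow> 'v set \<Rightarrow> 'r::comm_ring_1" where
  "inversion_sign \<nu> \<mu> G = (-1) ^ card {(v, w). v \<in> G \<and> w \<in> G \<and> \<nu> v < \<nu> w \<and> \<mu> w < \<mu> v}"

lemma inversion_sign_square [simp]: "inversion_sign \<nu> \<mu> G * inversion_sign \<nu> \<mu> G = 1"
  by (simp add: inversion_sign_def flip: power_mult_distrib)

lemma inversion_sign_square_left [simp]: "inversion_sign \<nu> \<mu> G * (inversion_sign \<nu> \<mu> G * a) = a"
  by (simp flip: mult.assoc)

lemma orient_sign_reorient:
  assumes fin: "finite G" and inj: "inj_on \<nu> G" "inj_on \<mu> G" and v_in: "v \<in> G"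
  shows "orient_sign \<mu> v G = inversion_sign \<nu> \<mu> G * orient_sign \<nu> v G * inversion_sign \<nu> \<mu> (G - {v})"
proof -
  let ?I = "\<lambda>G. {(v, w). v \<in> G \<and> w \<in> G \<and> \<nu> v < \<nu> w \<and> \<mu> w < \<mu> v}"
  let ?above = "{w \<in> G. \<nu> v < \<nu> w \<and> \<mu> w < \<mu> v}" and ?below = "{w \<in> G. \<nu> w < \<nu> v \<and> \<mu> v < \<mu> w}"
    and ?both = "{w \<in> G. \<nu> w < \<nu> v \<and> \<mu> w < \<mu> v}"
  have compare: "(\<nu> w < \<nu> v \<or> \<nu> v < \<nu> w) \<and> (\<mu> w < \<mu> v \<or> \<mu> v < \<mu> w)" if "w \<in> G" "w \<noteq> v" for w
    using inj v_in that unfolding inj_on_def by (metis linorder_neqE_nat)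
  have fin_I: "finite (?I (G - {v}))" by (rule finite_subset[of _ "G \<times> G"]) (use fin in auto)
  let ?J = "Pair v ` ?above \<union> (\<lambda>w. (w, v)) ` ?below"
  have "?I G = ?I (G - {v}) \<union> ?J" using v_in by auto
  then have "card (?I G) = card (?I (G - {v}) \<union> ?J)" by (rule arg_cong)
  also have "\<dots> = card (?I (G - {v})) + card ?J"
    using fin fin_I by (intro card_Un_disjoint) auto
  also have "card ?J = card ?above + card ?below"
    using fin by (subst card_Un_disjoint) (auto simp: card_image inj_on_def)
  finally have inversions: "card (?I G) = card (?I (G - {v})) + (card ?above + card ?below)" .
  have "{w \<in> G. \<mu> w < \<mu> v} = ?above \<union> ?both" "{w \<in> G. \<nu> w < \<nu> v} = ?below \<union> ?both"
    using compare less_irrefl by blast+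
  then have "card {w \<in> G. \<mu> w < \<mu> v} = card ?above + card ?both"
      "card {w \<in> G. \<nu> w < \<nu> v} = card ?below + card ?both"
    using fin by (simp_all add: card_Un_disjoint[symmetric] disjoint_iff)
  then show ?thesis
    unfolding orient_sign_def inversion_sign_def inversions
    by (simp add: power_add mult_ac flip: power_mult_distrib)
qed

lemma exact_at_reorient:
  fixes X :: "'v set set"
  assumes orients: "orients \<nu> X" "orients \<mu> X" and exact: "exact_at TYPE('k::field) \<nu> X i"
  shows "exact_at TYPE('k) \<mu> X i"
proof (rule exact_atI)
  let ?e = "inversion_sign \<nu> \<mu> :: 'v set \<Rightarrow> 'k"
  have reorient: "coboundary \<mu> X c G = ?e G * coboundary \<nu> X (\<lambda>H. ?e H * c H) G" if "G \<in> X" for c G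
    unfolding weighted_coboundary_def sum_distrib_left
    using orientsD[OF orients(1) that] orientsD(2)[OF orients(2) that]
    by (intro sum.cong) (auto simp: removable_def orient_sign_reorient[of G \<nu> \<mu>] mult_ac)
  fix c :: "'v set \<Rightarrow> 'k"
  assume cocycle: "cocycle \<mu> X i c"
  have "cocycle \<nu> X i (\<lambda>H. ?e H * c H)"
    unfolding cocycle_def
  proof (intro ballI impI)
    fix G assume G_in: "G \<in> X" "card G = Suc i"
    then have "?e G * coboundary \<nu> X (\<lambda>H. ?e H * c H) G = 0"
      using cocycleD[OF cocycle G_in] reorient by simp
    then show "coboundary \<nu> X (\<lambda>H. ?e H * c H) G = 0"
      by (metis inversion_sign_square_left mult_zero_right)
  qed
  then obtain b where b_primitive: "\<And>G. G \<in> X \<Longrightarrow> card G = i \<Longrightarrow> ?e G * c G = coboundary \<nu> X b G"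
    using exact_atE[OF exact] by blast
  have "c G = coboundary \<mu> X (\<lambda>H. ?e H * b H) G" if G_in: "G \<in> X" "card G = i" for G
  proof -
    have "coboundary \<mu> X (\<lambda>H. ?e H * b H) G = ?e G * coboundary \<nu> X b G"
      using reorient[OF G_in(1)] by simp
    then show ?thesis using b_primitive[OF G_in] by (metis inversion_sign_square_left)
  qed
  then show "\<exists>b. \<forall>G\<in>X. card G = i \<longrightarrow> c G = coboundary \<mu> X b G" by blast
qed

section \<open>Simplicial complexes\<close>

definition simplicial :: "'v set set \<Rightarrow> bool" where
  "simplicial \<Delta> \<longleftrightarrow> {} \<in> \<Delta> \<and> (\<forall>G\<in>\<Delta>. \<forall>F. F \<subseteq> G \<longrightarrow> F \<in> \<Delta>)"

definition star :: "'v set set \<Rightarrow> 'v set \<Rightarrow> 'v set set" where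
  "star \<Delta> F = {G \<in> \<Delta>. F \<subseteq> G}"

definition deletion :: "'v set set \<Rightarrow> 'v set \<Rightarrow> 'v set set" where
  "deletion \<Delta> U = {G \<in> \<Delta>. G \<inter> U = {}}"

text \<open>This is Reisner's condition that the links of all faces have vanishing reduced cohomology in all degrees
  in which a complex of dimension \<open>n - 1\<close> should have none.\<close>

definition reisner :: "'k::field itself \<Rightarrow> ('v \<Rightarrow> nat) \<Rightarrow> 'v set set \<Rightarrow> nat \<Rightarrow> bool" where
  "reisner TYPE('k) \<nu> \<Delta> n \<longleftrightarrow> (\<forall>F\<in>\<Delta>. \<forall>i<n. exact_at TYPE('k) \<nu> (star \<Delta> F) i)"

lemma simplicialD: "simplicial \<Delta> \<Longrightarrow> G \<in> \<Delta> \<Longrightarrow> F \<subseteq> G \<Longrightarrow> F \<in> \<Delta>"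
  by (auto simp: simplicial_def)

lemma convex_family_simplicial:
  assumes "simplicial \<Delta>" and P_convex: "\<And>A B C. A \<subseteq> B \<Longrightarrow> B \<subseteq> C \<Longrightarrow> P A \<Longrightarrow> P C \<Longrightarrow> P B"
  shows "convex_family {G \<in> \<Delta>. P G}"
  unfolding convex_family_def
proof (intro ballI allI impI)
  fix A B C assume "A \<in> {G \<in> \<Delta>. P G}" "C \<in> {G \<in> \<Delta>. P G}" "A \<subseteq> B \<and> B \<subseteq> C"
  then show "B \<in> {G \<in> \<Delta>. P G}" using simplicialD[OF assms(1), of C B] P_convex[of A B C] by simp
qed

lemma convex_family_star: "simplicial \<Delta> \<Longrightarrow> convex_family (star \<Delta> F)"
  unfolding star_def by (rule convex_family_simplicial) auto

lemma removable_star: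
  "simplicial \<Delta> \<Longrightarrow> G \<in> star \<Delta> F \<Longrightarrow> removable (star \<Delta> F) G = G - F"
  using simplicialD[of \<Delta> G] by (auto simp: removable_def star_def)

section \<open>Ideals, depth and Krull dimension\<close>

context
begin

interpretation ideal: module "(*) :: 'r::comm_ring_1 \<Rightarrow> 'r \<Rightarrow> 'r"
  by unfold_locales (simp_all add: algebra_simps)

lemma is_ideal_eq_subspace: "is_ideal = ideal.subspace"
  by (auto simp: fun_eq_iff is_ideal_def ideal.subspace_def)

lemma gen_ideal_eq_span: "gen_ideal = ideal.span"
  by (simp add: fun_eq_iff gen_ideal_def is_ideal_eq_subspace ideal.span_def hull_def)

lemmas is_ideal_0 = ideal.subspace_0[folded is_ideal_eq_subspace]
  and is_ideal_add = ideal.subspace_add[folded is_ideal_eq_subspace]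
  and is_ideal_mult_left = ideal.subspace_scale[folded is_ideal_eq_subspace]
  and is_ideal_diff = ideal.subspace_diff[folded is_ideal_eq_subspace]
  and is_ideal_sum = ideal.subspace_sum[folded is_ideal_eq_subspace]

lemma is_ideal_mult_right: "is_ideal I \<Longrightarrow> a \<in> I \<Longrightarrow> a * r \<in> I"
  using is_ideal_mult_left[of I a r] by (simp add: mult.commute)

lemmas is_ideal_gen_ideal = ideal.subspace_span[folded is_ideal_eq_subspace gen_ideal_eq_span]
  and gen_ideal_superset = ideal.span_superset[folded gen_ideal_eq_span]
  and gen_ideal_mono = ideal.span_mono[folded gen_ideal_eq_span]
  and gen_ideal_minimal = ideal.span_minimal[folded is_ideal_eq_subspace gen_ideal_eq_span]
  and gen_ideal_ideal = ideal.span_eq_iff[THEN iffD2, folded is_ideal_eq_subspace gen_ideal_eq_span]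
  and gen_ideal_insert_iff = ideal.span_breakdown_eq[folded gen_ideal_eq_span]

end

lemma gen_ideal_Un_image_iff:
  assumes I_ideal: "is_ideal I" and "finite A"
  shows "a \<in> gen_ideal (I \<union> f ` A) \<longleftrightarrow> (\<exists>h. a - (\<Sum>i\<in>A. h i * f i) \<in> I)"
  using assms(2)
proof (induction A arbitrary: a rule: finite_induct)
  case empty
  then show ?case using I_ideal by (simp add: gen_ideal_ideal)
next
  case (insert x A)
  have "a \<in> gen_ideal (I \<union> f ` insert x A) \<longleftrightarrow> (\<exists>g h. a - g * f x - (\<Sum>i\<in>A. h i * f i) \<in> I)"
    by (simp add: gen_ideal_insert_iff insert.IH)
  also have "\<dots> \<longleftrightarrow> (\<exists>h. a - (\<Sum>i\<in>insert x A. h i * f i) \<in> I)"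
  proof
    assume "\<exists>g h. a - g * f x - (\<Sum>i\<in>A. h i * f i) \<in> I"
    then obtain g h where gh: "a - g * f x - (\<Sum>i\<in>A. h i * f i) \<in> I" by blast
    have "(\<Sum>i\<in>A. (h(x := g)) i * f i) = (\<Sum>i\<in>A. h i * f i)"
      by (rule sum.cong) (use insert.hyps in auto)
    then have "a - (\<Sum>i\<in>insert x A. (h(x := g)) i * f i) \<in> I"
      using gh insert.hyps by (simp add: algebra_simps)
    then show "\<exists>h. a - (\<Sum>i\<in>insert x A. h i * f i) \<in> I" by blast
  qed (use insert.hyps in \<open>auto simp: algebra_simps\<close>)
  finally show ?case .
qed

lemma is_prime_idealD:
  assumes "is_prime_ideal p"
  shows "is_ideal p" "1 \<notin> p" "a * b \<in> p \<Longrightarrow> a \<in> p \<or> b \<in> p"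
  using assms is_ideal_mult_left[of p 1] by (auto simp: is_prime_ideal_def)

lemma is_ideal_Union_chain:
  assumes "C \<noteq> {}" "\<And>I. I \<in> C \<Longrightarrow> is_ideal I" "subset.chain A C"
  shows "is_ideal (\<Union>C)"
  unfolding is_ideal_def
proof (intro conjI ballI allI)
  show "0 \<in> \<Union>C" using assms is_ideal_0 by blast
next
  fix a b assume "a \<in> \<Union>C" "b \<in> \<Union>C"
  then obtain I J where "I \<in> C" "J \<in> C" "a \<in> I" "b \<in> J" by blast
  moreover from this have "I \<subseteq> J \<or> J \<subseteq> I" using assms(3) by (auto simp: subset_chain_def)
  ultimately obtain K where "K \<in> C" "a \<in> K" "b \<in> K" by blast
  then show "a + b \<in> \<Union>C" using assms(2) is_ideal_add by blast
next
  fix r a assume "a \<in> \<Union>C"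
  then show "r * a \<in> \<Union>C" using assms(2) is_ideal_mult_left by blast
qed

lemma maximal_disjoint_ideal_prime:
  assumes S_mult: "1 \<in> S" "\<And>a b. a \<in> S \<Longrightarrow> b \<in> S \<Longrightarrow> a * b \<in> S"
    and q_avoids: "is_ideal q" "q \<inter> S = {}" and maximal: "\<And>I. is_ideal I \<Longrightarrow> q \<subseteq> I \<Longrightarrow> I \<inter> S = {} \<Longrightarrow> I = q"
  shows "is_prime_ideal q"
proof -
  have meets_S: "\<exists>s g. s \<in> S \<and> s - g * a \<in> q" if "a \<notin> q" for a
  proof -
    have "gen_ideal (insert a q) \<noteq> q" using that gen_ideal_superset[of "insert a q"] by auto
    then have "gen_ideal (insert a q) \<inter> S \<noteq> {}"
      using maximal[OF is_ideal_gen_ideal] gen_ideal_superset[of "insert a q"] by blast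
    then show ?thesis by (auto simp: gen_ideal_insert_iff gen_ideal_ideal[OF q_avoids(1)])
  qed
  have "a \<in> q \<or> b \<in> q" if ab_in: "a * b \<in> q" for a b
  proof (rule ccontr)
    assume "\<not> (a \<in> q \<or> b \<in> q)"
    then obtain s g t h where s_in: "s \<in> S" "s - g * a \<in> q" and t_in: "t \<in> S" "t - h * b \<in> q"
      using meets_S by metis
    have "t * (s - g * a) + g * a * (t - h * b) + g * h * (a * b) \<in> q"
      using is_ideal_mult_left[OF q_avoids(1) s_in(2), of t] is_ideal_mult_left[OF q_avoids(1) t_in(2), of "g * a"]
        is_ideal_mult_left[OF q_avoids(1) ab_in, of "g * h"]
      by (intro is_ideal_add[OF q_avoids(1)])
    then have "s * t \<in> q" by (simp add: algebra_simps)
    then show False using S_mult(2)[OF s_in(1) t_in(1)] q_avoids(2) by auto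
  qed
  then show ?thesis using q_avoids S_mult(1) by (auto simp: is_prime_ideal_def)
qed

lemma prime_ideal_disjoint_from_multiplicative:
  fixes J S :: "'r::comm_ring_1 set"
  assumes J_avoids: "is_ideal J" "J \<inter> S = {}" and S_mult: "1 \<in> S" "\<And>a b. a \<in> S \<Longrightarrow> b \<in> S \<Longrightarrow> a * b \<in> S"
  obtains q where "is_prime_ideal q" "J \<subseteq> q" "q \<inter> S = {}"
proof -
  let ?A = "{I. is_ideal I \<and> J \<subseteq> I \<and> I \<inter> S = {}}"
  have "\<exists>q\<in>?A. \<forall>I\<in>?A. q \<subseteq> I \<longrightarrow> I = q"
  proof (rule subset_Zorn_nonempty)
    show "?A \<noteq> {}" using J_avoids by auto
    fix C assume C_chain: "C \<noteq> {}" "subset.chain ?A C"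
    have C_A: "is_ideal I" "J \<subseteq> I" "I \<inter> S = {}" if "I \<in> C" for I
      using C_chain(2) that by (auto simp: subset_chain_def)
    have "J \<subseteq> \<Union>C" "\<Union>C \<inter> S = {}" using C_chain(1) C_A by blast+
    then show "\<Union>C \<in> ?A" using is_ideal_Union_chain[OF C_chain(1) C_A(1) C_chain(2)] by simp
  qed
  then obtain q where q_avoids: "is_ideal q" "J \<subseteq> q" "q \<inter> S = {}"
    and maximal: "\<And>I. is_ideal I \<Longrightarrow> q \<subseteq> I \<Longrightarrow> I \<inter> S = {} \<Longrightarrow> I = q"
    by (auto dest: subset_trans)
  show ?thesis using that[OF maximal_disjoint_ideal_prime[OF S_mult q_avoids(1,3) maximal] q_avoids(2,3)] .
qed

text \<open>The prime \<open>q\<close> is disjoint from the multiplicative set of the products of a power of \<open>f\<close> and an element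
  outside \<open>p\<close>.\<close>

lemma prime_ideal_below_nonzerodivisor:
  assumes p_prime: "is_prime_ideal p" "f \<in> p" and J_ideal: "is_ideal J" "J \<subseteq> p"
    and nonzerodivisor: "\<And>g. f * g \<in> J \<Longrightarrow> g \<in> J"
  obtains q where "is_prime_ideal q" "J \<subseteq> q" "q \<subset> p"
proof -
  let ?S = "{f ^ k * s |k s. s \<notin> p}"
  have in_S: "f ^ k * s \<in> ?S" if "s \<notin> p" for k s using that by blast
  note one = is_prime_idealD(2)[OF p_prime(1)]
  have "s \<in> J" if "f ^ k * s \<in> J" for k s
    using that
  proof (induction k)
    case (Suc k)
    have "f * (f ^ k * s) \<in> J" using Suc.prems by (simp only: power_Suc mult.assoc)
    then show ?case by (rule Suc.IH[OF nonzerodivisor])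
  qed simp
  then have "J \<inter> ?S = {}" using J_ideal(2) by auto
  moreover have "1 \<in> ?S" using in_S[OF one, of 0] by simp
  moreover have "a * b \<in> ?S" if ab_in: "a \<in> ?S" "b \<in> ?S" for a b
  proof -
    obtain k s l t where a_eq: "a = f ^ k * s" "s \<notin> p" and b_eq: "b = f ^ l * t" "t \<notin> p" using ab_in by blast
    have "s * t \<notin> p" using a_eq(2) b_eq(2) is_prime_idealD(3)[OF p_prime(1), of s t] by blast
    moreover have "a * b = f ^ (k + l) * (s * t)" by (simp add: a_eq b_eq power_add ac_simps)
    ultimately show ?thesis using in_S by simp
  qed
  ultimately obtain q where q_prime: "is_prime_ideal q" "J \<subseteq> q" "q \<inter> ?S = {}"
    by (rule prime_ideal_disjoint_from_multiplicative[OF J_ideal(1)]) blast+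
  have "q \<subseteq> p" using q_prime(3) in_S[of _ 0] by auto
  moreover have "f \<notin> q" using q_prime(3) in_S[OF one, of 1] by auto
  ultimately show ?thesis using that q_prime p_prime(2) by blast
qed

lemma prime_chain_of_regular_seq:
  assumes reg: "regular_seq_quot I m n f" and "l \<le> n"
  shows "\<exists>p. (\<forall>i\<in>{l..n}. is_prime_ideal (p i) \<and> gen_ideal (I \<union> f ` {..<i}) \<subseteq> p i) \<and>
     (\<forall>i\<in>{l..<n}. p i \<subset> p (Suc i))"
  using assms(2)
proof (induction l rule: inc_induct)
  case base
  have "1 \<notin> gen_ideal (I \<union> f ` {..<n})"
    using reg is_ideal_mult_left[OF is_ideal_gen_ideal, of 1 "I \<union> f ` {..<n}"]
    by (auto simp: regular_seq_quot_def)
  then obtain q where "is_prime_ideal q" "gen_ideal (I \<union> f ` {..<n}) \<subseteq> q"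
    using prime_ideal_disjoint_from_multiplicative[OF is_ideal_gen_ideal, of "I \<union> f ` {..<n}" "{1}"] by auto
  then show ?case by (intro exI[of _ "\<lambda>_. q"]) auto
next
  case (step l)
  from step.IH obtain p
    where p_primes: "\<forall>i\<in>{Suc l..n}. is_prime_ideal (p i) \<and> gen_ideal (I \<union> f ` {..<i}) \<subseteq> p i"
    and p_chain: "\<forall>i\<in>{Suc l..<n}. p i \<subset> p (Suc i)" by (elim exE conjE)
  let ?J = "gen_ideal (I \<union> f ` {..<l})"
  have prime: "is_prime_ideal (p (Suc l))" and sub: "gen_ideal (I \<union> f ` {..<Suc l}) \<subseteq> p (Suc l)"
    using p_primes step.hyps by auto
  have "f l \<in> p (Suc l)" using sub gen_ideal_superset[of "I \<union> f ` {..<Suc l}"] by auto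
  moreover have "?J \<subseteq> p (Suc l)"
    using sub gen_ideal_mono[of "I \<union> f ` {..<l}" "I \<union> f ` {..<Suc l}"] by fastforce
  moreover have "g \<in> ?J" if "f l * g \<in> ?J" for g
    using reg that step.hyps unfolding regular_seq_quot_def by blast
  ultimately obtain q where q_prime: "is_prime_ideal q" "?J \<subseteq> q" "q \<subset> p (Suc l)"
    by (rule prime_ideal_below_nonzerodivisor[OF prime _ is_ideal_gen_ideal])
  have "is_prime_ideal ((p(l := q)) i) \<and> gen_ideal (I \<union> f ` {..<i}) \<subseteq> (p(l := q)) i" if "i \<in> {l..n}" for i
    using p_primes q_prime that by (cases "i = l") auto
  moreover have "(p(l := q)) i \<subset> (p(l := q)) (Suc i)" if "i \<in> {l..<n}" for i
    using p_chain q_prime that by (cases "i = l") auto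
  ultimately show ?case by (intro exI[of _ "p(l := q)"] conjI ballI) blast+
qed

lemma depth_quot_le_krull_dim_quot: "depth_quot I m \<le> krull_dim_quot I"
  unfolding depth_quot_def
proof (rule Sup_least, clarify)
  fix n f assume "regular_seq_quot I m n f"
  from prime_chain_of_regular_seq[OF this le0] obtain p
    where p_primes: "\<forall>i\<in>{0..n}. is_prime_ideal (p i) \<and> gen_ideal (I \<union> f ` {..<i}) \<subseteq> p i"
      and p_chain: "\<forall>i\<in>{0..<n}. p i \<subset> p (Suc i)"
    by (elim exE conjE)
  have "I \<subseteq> p i" if "i \<le> n" for i
    using p_primes that gen_ideal_superset[of "I \<union> f ` {..<i}"] by fastforce
  then show "enat n \<le> krull_dim_quot I"
    unfolding krull_dim_quot_def using p_primes p_chain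
    by (intro Sup_upper CollectI exI[of _ n] conjI exI[of _ p]) simp_all
qed

lemma krull_dim_quot_antimono:
  assumes "I \<subseteq> J"
  shows "krull_dim_quot J \<le> krull_dim_quot I"
  unfolding krull_dim_quot_def
proof (rule Sup_subset_mono, rule Collect_mono, clarify)
  fix n p assume "\<forall>i\<le>n. is_prime_ideal (p i) \<and> J \<subseteq> p i" "\<forall>i<n. p i \<subset> p (Suc i)"
  then show "\<exists>m. enat n = enat m \<and> (\<exists>p. (\<forall>i\<le>m. is_prime_ideal (p i) \<and> I \<subseteq> p i) \<and> (\<forall>i<m. p i \<subset> p (Suc i)))"
    using subset_trans[OF assms] by (intro exI[of _ n] conjI exI[of _ p]) simp_all
qed

lemma regular_seq_quot_take:
  assumes reg: "regular_seq_quot I m n f" and "k \<le> n"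
  shows "regular_seq_quot I m k f"
proof -
  have "gen_ideal (I \<union> f ` {..<k}) \<subseteq> gen_ideal (I \<union> f ` {..<n})"
    using assms(2) by (intro gen_ideal_mono) auto
  then have "gen_ideal (I \<union> f ` {..<k}) \<noteq> UNIV" using reg unfolding regular_seq_quot_def by force
  then show ?thesis using assms unfolding regular_seq_quot_def by (meson less_le_trans)
qed

lemma regular_seq_quot_of_depth:
  assumes "enat (Suc k) \<le> depth_quot I m"
  obtains f where "regular_seq_quot I m (Suc k) f"
proof -
  have "enat k < depth_quot I m" using assms by (metis Suc_ile_eq)
  then obtain l f where "enat k < enat l" "regular_seq_quot I m l f"
    unfolding depth_quot_def less_Sup_iff by auto
  then show ?thesis using that regular_seq_quot_take[of I m l f "Suc k"] by simp
qed

section \<open>Stanley--Reisner ideals\<close>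

abbreviation lookup :: "('a \<Rightarrow>\<^sub>0 'b::zero) \<Rightarrow> 'a \<Rightarrow> 'b" where
  "lookup \<equiv> Poly_Mapping.lookup"

abbreviation keys :: "('a \<Rightarrow>\<^sub>0 'b::zero) \<Rightarrow> 'a set" where
  "keys \<equiv> Poly_Mapping.keys"

definition unit_exp :: "'v \<Rightarrow> 'v \<Rightarrow>\<^sub>0 nat" where
  "unit_exp v = Poly_Mapping.single v 1"

definition exponent :: "('v \<Rightarrow> nat) \<Rightarrow> 'v set \<Rightarrow> 'v \<Rightarrow>\<^sub>0 nat" where
  "exponent f G = (\<Sum>v\<in>G. Poly_Mapping.single v (f v))"

definition squarefree_exp :: "'v set \<Rightarrow> 'v \<Rightarrow>\<^sub>0 nat" where
  "squarefree_exp = exponent (\<lambda>_. 1)"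

lemma lookup_unit_exp: "lookup (unit_exp v) w = (if w = v then 1 else 0)"
  by (simp add: unit_exp_def lookup_single when_def eq_commute)

lemma keys_unit_exp [simp]: "keys (unit_exp v) = {v}"
  by (simp add: unit_exp_def)

lemma lookup_exponent: "finite G \<Longrightarrow> lookup (exponent f G) v = (if v \<in> G then f v else 0)"
  by (simp add: exponent_def lookup_sum lookup_single when_def)

lemma keys_exponent: "finite G \<Longrightarrow> keys (exponent f G) = {v \<in> G. 0 < f v}"
  by (auto simp: in_keys_iff lookup_exponent split: if_splits)

lemma lookup_squarefree_exp: "finite F \<Longrightarrow> lookup (squarefree_exp F) v = (if v \<in> F then 1 else 0)"
  by (simp add: squarefree_exp_def lookup_exponent)

lemma keys_squarefree_exp [simp]: "finite F \<Longrightarrow> keys (squarefree_exp F) = F"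
  by (simp add: squarefree_exp_def keys_exponent)

lemma keys_add_nat: "keys (a + b :: 'v \<Rightarrow>\<^sub>0 nat) = keys a \<union> keys b"
  by (auto simp: in_keys_iff lookup_add)

lemma unit_exp_plus_minus: "v \<in> keys m \<Longrightarrow> unit_exp v + (m - unit_exp v) = m"
  by (rule poly_mapping_eqI) (auto simp: lookup_add lookup_minus lookup_unit_exp in_keys_iff)

lemma squarefree_exp_minus_unit_exp:
  assumes "finite F" "v \<in> F"
  shows "squarefree_exp F - unit_exp v = squarefree_exp (F - {v})"
proof (rule poly_mapping_eqI)
  fix w show "lookup (squarefree_exp F - unit_exp v) w = lookup (squarefree_exp (F - {v})) w"
    using assms by (cases "w = v") (simp_all add: lookup_minus lookup_squarefree_exp lookup_unit_exp)
qed

lemma pvar_eq_single: "pvar v = (Poly_Mapping.single (unit_exp v) 1 :: ('v, 'k::field) mpoly)"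
  by (simp add: pvar_def unit_exp_def)

lemma prod_pvar:
  "finite F \<Longrightarrow> (\<Prod>v\<in>F. pvar v) = (Poly_Mapping.single (squarefree_exp F) 1 :: ('v, 'k::field) mpoly)"
  by (induction F rule: finite_induct) (simp_all add: squarefree_exp_def exponent_def pvar_def mult_single)

lemma lookup_single_times:
  fixes p :: "('v, 'k::field) mpoly"
  shows "lookup (Poly_Mapping.single a c * p) (a + b) = c * lookup p b"
  by (simp add: lookup_mult lookup_single when_mult)

lemma lookup_single_times_eq_0:
  fixes p :: "('v, 'k::field) mpoly"
  assumes "\<And>b. m \<noteq> a + b"
  shows "lookup (Poly_Mapping.single a c * p) m = 0"
  using assms by (simp add: lookup_mult lookup_single when_mult)

lemma lookup_pvar_times:
  fixes p :: "('v, 'k::field) mpoly"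
  shows "lookup (pvar v * p) m = (if v \<in> keys m then lookup p (m - unit_exp v) else 0)"
proof (cases "v \<in> keys m")
  case True
  then show ?thesis
    using lookup_single_times[of "unit_exp v" 1 p "m - unit_exp v"]
    by (simp add: unit_exp_plus_minus pvar_eq_single)
next
  case False
  then have "m \<noteq> unit_exp v + b" for b by (auto simp: keys_add_nat)
  then show ?thesis using False by (simp add: pvar_eq_single lookup_single_times_eq_0)
qed

lemma poly_mapping_eq_sum_single:
  fixes p :: "'a \<Rightarrow>\<^sub>0 'b::comm_monoid_add"
  shows "p = (\<Sum>m\<in>keys p. Poly_Mapping.single m (lookup p m))"
  by (rule poly_mapping_eqI) (auto simp: lookup_sum lookup_single when_def in_keys_iff)

lemma is_ideal_SR_ideal: "is_ideal (SR_ideal \<Delta>)"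
  unfolding SR_ideal_def by (rule is_ideal_gen_ideal)

lemma prod_pvar_in_SR_ideal:
  "finite G \<Longrightarrow> G \<notin> \<Delta> \<Longrightarrow> (\<Prod>v\<in>G. pvar v) \<in> SR_ideal \<Delta>"
  unfolding SR_ideal_def by (rule subsetD[OF gen_ideal_superset]) blast

lemma single_in_SR_ideal:
  assumes "keys m \<notin> \<Delta>"
  shows "Poly_Mapping.single m c \<in> (SR_ideal \<Delta> :: ('v, 'k::field) mpoly set)"
proof -
  have "m - squarefree_exp (keys m) + squarefree_exp (keys m) = m"
    by (rule poly_mapping_eqI) (auto simp: lookup_add lookup_minus lookup_squarefree_exp in_keys_iff)
  then have "Poly_Mapping.single m c =
      Poly_Mapping.single (m - squarefree_exp (keys m)) c * (\<Prod>v\<in>keys m. pvar v)"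
    by (simp add: prod_pvar mult_single)
  then show ?thesis
    using is_ideal_mult_left[OF is_ideal_SR_ideal prod_pvar_in_SR_ideal[OF finite_keys assms]] by metis
qed

lemma SR_ideal_iff:
  fixes p :: "('v, 'k::field) mpoly"
  assumes "simplicial \<Delta>"
  shows "p \<in> SR_ideal \<Delta> \<longleftrightarrow> (\<forall>m. keys m \<in> \<Delta> \<longrightarrow> lookup p m = 0)"
proof
  let ?J = "{p :: ('v, 'k) mpoly. \<forall>m. keys m \<in> \<Delta> \<longrightarrow> lookup p m = 0}"
  have "r * p \<in> ?J" if p_in: "p \<in> ?J" for r p
  proof (clarify, rule ccontr)
    fix m assume m_face: "keys m \<in> \<Delta>" "lookup (r * p) m \<noteq> 0"
    then obtain a b where "m = a + b" and b_in: "b \<in> keys p"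
      using keys_mult[of r p] by (auto simp: in_keys_iff)
    then have "keys b \<in> \<Delta>" using simplicialD[OF assms m_face(1)] by (simp add: keys_add_nat)
    then show False using p_in b_in by (auto simp: in_keys_iff)
  qed
  then have "is_ideal ?J" by (auto simp: is_ideal_def lookup_add)
  moreover have "{\<Prod>v\<in>F. pvar v |F. finite F \<and> F \<notin> \<Delta>} \<subseteq> ?J"
    by (auto simp: prod_pvar lookup_single when_def keys_squarefree_exp)
  ultimately have "SR_ideal \<Delta> \<subseteq> ?J" unfolding SR_ideal_def by (intro gen_ideal_minimal)
  then show "p \<in> SR_ideal \<Delta> \<Longrightarrow> \<forall>m. keys m \<in> \<Delta> \<longrightarrow> lookup p m = 0" by auto
next
  assume "\<forall>m. keys m \<in> \<Delta> \<longrightarrow> lookup p m = 0"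
  then have "(\<Sum>m\<in>keys p. Poly_Mapping.single m (lookup p m)) \<in> SR_ideal \<Delta>"
    by (intro is_ideal_sum is_ideal_SR_ideal single_in_SR_ideal) (auto simp: in_keys_iff)
  then show "p \<in> SR_ideal \<Delta>" by (simp flip: poly_mapping_eq_sum_single)
qed

lemma var_ideal_combination:
  fixes a :: "('v, 'k::field) mpoly"
  assumes V_vertices: "finite V" "\<And>G. G \<in> \<Delta> \<Longrightarrow> G \<subseteq> V" and a_in: "a \<in> var_ideal"
  shows "\<exists>g. a - (\<Sum>u\<in>V. g u * pvar u) \<in> SR_ideal \<Delta>"
proof -
  let ?S = "SR_ideal \<Delta> \<union> pvar ` V :: ('v, 'k) mpoly set"
  have "pvar v \<in> ?S" for v
  proof (cases "v \<in> V")
    case False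
    then have "{v} \<notin> \<Delta>" using V_vertices(2) by blast
    then have "pvar v \<in> (SR_ideal \<Delta> :: ('v, 'k) mpoly set)"
      using prod_pvar_in_SR_ideal[of "{v}" \<Delta>] by simp
    then show ?thesis ..
  qed simp
  then have "range pvar \<subseteq> gen_ideal ?S" using gen_ideal_superset by blast
  then have "a \<in> gen_ideal ?S"
    using gen_ideal_minimal[OF _ is_ideal_gen_ideal] a_in unfolding var_ideal_def by blast
  then show ?thesis using gen_ideal_Un_image_iff[OF is_ideal_SR_ideal V_vertices(1)] by blast
qed

section \<open>From regular sequences to exactness\<close>

definition koszul_exact_at ::
    "('v \<Rightarrow> nat) \<Rightarrow> ('v \<Rightarrow> 'r::comm_ring_1) \<Rightarrow> 'v set \<Rightarrow> 'r set \<Rightarrow> nat \<Rightarrow> bool" where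
  "koszul_exact_at \<nu> x V J i \<longleftrightarrow>
     (\<forall>c. (\<forall>W. W \<subseteq> V \<and> card W = Suc i \<longrightarrow> weighted_coboundary \<nu> x (Pow V) c W \<in> J) \<longrightarrow>
        (\<exists>b. \<forall>W. W \<subseteq> V \<and> card W = i \<longrightarrow> c W - weighted_coboundary \<nu> x (Pow V) b W \<in> J))"

lemma orients_Pow: "finite V \<Longrightarrow> inj_on \<nu> V \<Longrightarrow> orients \<nu> (Pow V)"
  by (auto simp: orients_def finite_subset inj_on_subset)

lemma convex_family_Pow: "convex_family (Pow V)"
  by (auto simp: convex_family_def)

lemma weighted_coboundary_in_ideal:
  assumes J_ideal: "is_ideal J" and W_subset: "finite W" "card W = Suc i" "W \<subseteq> V"
    and c_in_J: "\<And>W. W \<subseteq> V \<Longrightarrow> card W = i \<Longrightarrow> c W \<in> J"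
  shows "weighted_coboundary \<nu> x (Pow V) c W \<in> J"
  unfolding weighted_coboundary_def using W_subset c_in_J
  by (intro is_ideal_sum[OF J_ideal] is_ideal_mult_left[OF J_ideal]) (auto simp: removable_def)

text \<open>Multiplication by an element of the ideal of the weights is null-homotopic on the Koszul complex.\<close>

lemma koszul_cocycle_multiple:
  fixes f :: "'r::comm_ring_1" and V :: "'v set"
  assumes V_oriented: "finite V" "inj_on \<nu> V" and J_ideal: "is_ideal J"
    and f_combination: "f - (\<Sum>u\<in>V. g u * x u) \<in> J"
    and c_cocycle: "\<And>W. W \<subseteq> V \<Longrightarrow> card W = Suc i \<Longrightarrow> weighted_coboundary \<nu> x (Pow V) c W \<in> J"
  obtains b where "\<And>W. W \<subseteq> V \<Longrightarrow> card W = i \<Longrightarrow> f * c W - weighted_coboundary \<nu> x (Pow V) b W \<in> J"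
proof -
  let ?\<delta> = "weighted_coboundary \<nu> x (Pow V) :: ('v set \<Rightarrow> 'r) \<Rightarrow> _"
    and ?h = "cone_homotopy \<nu> :: 'v \<Rightarrow> ('v set \<Rightarrow> 'r) \<Rightarrow> _"
  define b where "b W = (\<Sum>u\<in>V. g u * ?h u c W)" for W
  have "f * c W - ?\<delta> b W \<in> J" if W_subset: "W \<subseteq> V" "card W = i" for W
  proof -
    have homotopy_in_J: "?h u (?\<delta> c) W \<in> J" if "u \<in> V" for u
      using c_cocycle[of "insert u W"] W_subset that finite_subset[OF W_subset(1) V_oriented(1)] J_ideal
      by (auto simp: cone_homotopy_def is_ideal_0 intro!: is_ideal_mult_left)
    have "?\<delta> (?h u c) W = x u * c W - ?h u (?\<delta> c) W" if "u \<in> V" for u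
      using cone_homotopy_coboundary[OF orients_Pow[OF V_oriented], of u W x c] W_subset that
      by (auto simp: algebra_simps)
    then have "?\<delta> b W = (\<Sum>u\<in>V. g u * (x u * c W - ?h u (?\<delta> c) W))"
      unfolding b_def weighted_coboundary_sum weighted_coboundary_scale by (intro sum.cong) auto
    also have "\<dots> = (\<Sum>u\<in>V. g u * x u) * c W - (\<Sum>u\<in>V. g u * ?h u (?\<delta> c) W)"
      by (simp add: algebra_simps sum_subtractf sum_distrib_left)
    finally have "f * c W - ?\<delta> b W = (f - (\<Sum>u\<in>V. g u * x u)) * c W + (\<Sum>u\<in>V. g u * ?h u (?\<delta> c) W)"
      by (simp add: algebra_simps)
    also have "\<dots> \<in> J"
      using f_combination homotopy_in_J
      by (intro is_ideal_add[OF J_ideal] is_ideal_mult_right[OF J_ideal] is_ideal_sum[OF J_ideal]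
        is_ideal_mult_left[OF J_ideal])
    finally show ?thesis .
  qed
  then show ?thesis by (rule that)
qed

lemma koszul_cancel_multiple:
  fixes f :: "'r::comm_ring_1" and V :: "'v set"
  assumes V_oriented: "finite V" "inj_on \<nu> V" and J_ideal: "is_ideal J"
    and nonzerodivisor: "\<And>a. f * a \<in> J \<Longrightarrow> a \<in> J"
    and f_multiple: "f * c W - weighted_coboundary \<nu> x (Pow V) b W \<in> J"
    and u_cofactor: "\<And>W. W \<subseteq> V \<Longrightarrow> card W = j \<Longrightarrow> b W - weighted_coboundary \<nu> x (Pow V) e W - u W * f \<in> J"
    and W_subset: "W \<subseteq> V" "card W = Suc j"
  shows "c W - weighted_coboundary \<nu> x (Pow V) u W \<in> J"
proof -
  let ?\<delta> = "weighted_coboundary \<nu> x (Pow V) :: ('v set \<Rightarrow> 'r) \<Rightarrow> _"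
  have "?\<delta> (\<lambda>W. b W - ?\<delta> e W - f * u W) W \<in> J"
    using W_subset u_cofactor finite_subset[OF W_subset(1) V_oriented(1)]
    by (intro weighted_coboundary_in_ideal[OF J_ideal]) (auto simp: mult.commute)
  then have "?\<delta> b W - f * ?\<delta> u W \<in> J"
    using weighted_coboundary_coboundary[OF orients_Pow[OF V_oriented] convex_family_Pow, of W x e] W_subset
    by (simp add: weighted_coboundary_diff weighted_coboundary_scale)
  then have "(f * c W - ?\<delta> b W) + (?\<delta> b W - f * ?\<delta> u W) \<in> J"
    by (rule is_ideal_add[OF J_ideal f_multiple])
  then show ?thesis using nonzerodivisor[of "c W - ?\<delta> u W"] by (simp add: algebra_simps)
qed

lemma koszul_exact_at_quotient:
  fixes f :: "'r::comm_ring_1" and V :: "'v set"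
  assumes V_oriented: "finite V" "inj_on \<nu> V" and J_ideal: "is_ideal J"
    and f_combination: "f - (\<Sum>u\<in>V. g u * x u) \<in> J" and nonzerodivisor: "\<And>a. f * a \<in> J \<Longrightarrow> a \<in> J"
    and exact_f: "\<And>j. i = Suc j \<Longrightarrow> koszul_exact_at \<nu> x V (gen_ideal (insert f J)) j"
  shows "koszul_exact_at \<nu> x V J i"
  unfolding koszul_exact_at_def
proof (intro allI impI)
  let ?\<delta> = "weighted_coboundary \<nu> x (Pow V) :: ('v set \<Rightarrow> 'r) \<Rightarrow> _"
  fix c :: "'v set \<Rightarrow> 'r"
  assume "\<forall>W. W \<subseteq> V \<and> card W = Suc i \<longrightarrow> ?\<delta> c W \<in> J"
  then obtain b where b_primitive: "\<And>W. W \<subseteq> V \<Longrightarrow> card W = i \<Longrightarrow> f * c W - ?\<delta> b W \<in> J"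
    using koszul_cocycle_multiple[OF V_oriented J_ideal f_combination, of i c] by blast
  show "\<exists>b. \<forall>W. W \<subseteq> V \<and> card W = i \<longrightarrow> c W - ?\<delta> b W \<in> J"
  proof (cases i)
    case 0
    have "c W - ?\<delta> b W \<in> J" if W_subset: "W \<subseteq> V" "card W = i" for W
    proof -
      have "W = {}" using W_subset 0 finite_subset[OF W_subset(1) V_oriented(1)] by simp
      then show ?thesis using b_primitive[OF W_subset] nonzerodivisor
        by (simp add: weighted_coboundary_def removable_def)
    qed
    then show ?thesis by blast
  next
    case (Suc j)
    let ?K = "gen_ideal (insert f J)"
    have K_ideal: "is_ideal ?K" "J \<subseteq> ?K" "f \<in> ?K"
      using is_ideal_gen_ideal gen_ideal_superset[of "insert f J"] by auto
    have "?\<delta> b W \<in> ?K" if W_subset: "W \<subseteq> V" "card W = Suc j" for W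
    proof -
      have "f * c W - ?\<delta> b W \<in> ?K" using b_primitive[of W] W_subset Suc K_ideal(2) by auto
      from is_ideal_diff[OF K_ideal(1) is_ideal_mult_right[OF K_ideal(1,3), of "c W"] this] show ?thesis
        by simp
    qed
    then obtain e where "\<And>W. W \<subseteq> V \<Longrightarrow> card W = j \<Longrightarrow> b W - ?\<delta> e W \<in> ?K"
      using exact_f[OF Suc] unfolding koszul_exact_at_def by metis
    then obtain u where u_cofactor: "\<And>W. W \<subseteq> V \<Longrightarrow> card W = j \<Longrightarrow> b W - ?\<delta> e W - u W * f \<in> J"
      unfolding gen_ideal_insert_iff gen_ideal_ideal[OF J_ideal] by metis
    have "c W - ?\<delta> u W \<in> J" if "W \<subseteq> V" "card W = i" for W
      using V_oriented J_ideal nonzerodivisor b_primitive[OF that] u_cofactor that[unfolded Suc]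
      by (rule koszul_cancel_multiple)
    then show ?thesis by blast
  qed
qed

lemma koszul_exact_at_of_regular_seq:
  assumes V_oriented: "finite V" "inj_on \<nu> V" and I_ideal: "is_ideal I"
    and regular: "regular_seq_quot I m n f" and m_combination: "\<And>a. a \<in> m \<Longrightarrow> \<exists>g. a - (\<Sum>u\<in>V. g u * x u) \<in> I"
    and "i < n"
  shows "koszul_exact_at \<nu> x V I i"
proof -
  have "\<forall>i<n - l. koszul_exact_at \<nu> x V (gen_ideal (I \<union> f ` {..<l})) i" if "l \<le> n" for l
    using that
  proof (induction l rule: inc_induct)
    case (step l)
    let ?J = "gen_ideal (I \<union> f ` {..<l})"
    have "f l \<in> m" using regular step.hyps by (auto simp: regular_seq_quot_def)
    then obtain g where "f l - (\<Sum>u\<in>V. g u * x u) \<in> I" using m_combination by blast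
    then have g_combination: "f l - (\<Sum>u\<in>V. g u * x u) \<in> ?J" using gen_ideal_superset[of "I \<union> f ` {..<l}"]
      by auto
    have nonzerodivisor: "a \<in> ?J" if "f l * a \<in> ?J" for a
      using regular step.hyps that unfolding regular_seq_quot_def by blast
    have J_Suc: "gen_ideal (insert (f l) ?J) = gen_ideal (I \<union> f ` {..<Suc l})"
      by (auto simp: lessThan_Suc gen_ideal_insert_iff gen_ideal_ideal[OF is_ideal_gen_ideal])
    show ?case
    proof (intro allI impI koszul_exact_at_quotient[OF V_oriented is_ideal_gen_ideal g_combination
      nonzerodivisor])
      fix i j assume "i < n - l" "i = Suc j"
      then show "koszul_exact_at \<nu> x V (gen_ideal (insert (f l) ?J)) j"
        using step.IH unfolding J_Suc by auto
    qed
  qed simp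
  from this[of 0] show ?thesis using I_ideal \<open>i < n\<close> by (simp add: gen_ideal_ideal)
qed

lemma lookup_orient_sign_times:
  fixes p :: "('v, 'k::field) mpoly"
  shows "lookup (orient_sign \<nu> v W * p) m = orient_sign \<nu> v W * lookup p m"
  by (simp add: orient_sign_def minus_one_power_iff)

text \<open>The deletion of \<open>U\<close> is the part of the Koszul complex in the multidegree that is \<open>-1\<close> on \<open>U\<close> and \<open>0\<close>
  elsewhere. Since \<open>U\<close> comes last in the orientation, no signs arise.\<close>

context
  fixes \<Delta> :: "'v set set" and V U :: "'v set" and \<nu> :: "'v \<Rightarrow> nat"
  assumes V_oriented: "finite V" "inj_on \<nu> V" and \<Delta>_complex: "simplicial \<Delta>" "\<And>G. G \<in> \<Delta> \<Longrightarrow> G \<subseteq> V"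
    and U_initial: "U \<subseteq> V" "\<And>u v. u \<in> U \<Longrightarrow> v \<in> V - U \<Longrightarrow> \<nu> v < \<nu> u"
begin

lemma finite_deleted: "finite U"
  using U_initial(1) V_oriented(1) by (rule finite_subset)

lemma deletionD: "G \<in> deletion \<Delta> U \<Longrightarrow> G \<in> \<Delta> \<and> G \<subseteq> V \<and> G \<inter> U = {} \<and> finite G"
  using \<Delta>_complex(2) V_oriented(1) finite_subset by (fastforce simp: deletion_def)

lemma lookup_koszul_coboundary:
  fixes B :: "'v set \<Rightarrow> ('v, 'k::field) mpoly"
  assumes G_in: "G \<in> deletion \<Delta> U"
  shows "lookup (weighted_coboundary \<nu> pvar (Pow V) B (G \<union> U)) (squarefree_exp G) =
    coboundary \<nu> (deletion \<Delta> U) (\<lambda>H. lookup (B (H \<union> U)) (squarefree_exp H)) G"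
proof -
  have G_face: "G \<in> \<Delta>" "G \<subseteq> V" "G \<inter> U = {}" "finite G"
    using deletionD[OF G_in] by auto
  have "lookup (weighted_coboundary \<nu> pvar (Pow V) B (G \<union> U)) (squarefree_exp G) =
      (\<Sum>v\<in>G \<union> U. orient_sign \<nu> v (G \<union> U) * lookup (pvar v * B (G \<union> U - {v})) (squarefree_exp G))"
    unfolding weighted_coboundary_def lookup_sum
    using G_face U_initial(1)
    by (intro sum.cong) (auto simp: removable_def lookup_orient_sign_times mult.assoc)
  also have "\<dots> = (\<Sum>v\<in>G. orient_sign \<nu> v G * 1 * lookup (B (G - {v} \<union> U)) (squarefree_exp (G - {v})))"
  proof (rule sum.mono_neutral_cong_right)
    fix v assume v_in: "v \<in> G"
    then have "{w \<in> G \<union> U. \<nu> w < \<nu> v} = {w \<in> G. \<nu> w < \<nu> v}" using U_initial(2)[of _ v] G_face by fastforce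
    moreover have "G \<union> U - {v} = G - {v} \<union> U" using v_in G_face by auto
    ultimately show "orient_sign \<nu> v (G \<union> U) * lookup (pvar v * B (G \<union> U - {v})) (squarefree_exp G) =
        orient_sign \<nu> v G * 1 * lookup (B (G - {v} \<union> U)) (squarefree_exp (G - {v}))"
      using v_in G_face
      by (simp add: orient_sign_def lookup_pvar_times keys_squarefree_exp squarefree_exp_minus_unit_exp)
  qed (use G_face finite_deleted in \<open>auto simp: lookup_pvar_times keys_squarefree_exp\<close>)
  also have "\<dots> = coboundary \<nu> (deletion \<Delta> U) (\<lambda>H. lookup (B (H \<union> U)) (squarefree_exp H)) G"
    unfolding weighted_coboundary_def using G_in simplicialD[OF \<Delta>_complex(1) G_face(1)]
    by (intro sum.cong) (auto simp: removable_def deletion_def)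
  finally show ?thesis .
qed

definition koszul_cochain :: "('v set \<Rightarrow> 'k::field) \<Rightarrow> 'v set \<Rightarrow> ('v, 'k) mpoly" where
  "koszul_cochain c W = (if U \<subseteq> W then Poly_Mapping.single (squarefree_exp (W - U)) (c (W - U)) else 0)"

lemma lookup_koszul_cochain:
  "H \<inter> U = {} \<Longrightarrow> lookup (koszul_cochain c (H \<union> U)) (squarefree_exp H) = c H"
  by (simp add: koszul_cochain_def Un_Diff Diff_triv)

lemma pvar_times_koszul_cochain:
  assumes "finite W" "v \<in> W"
  shows "pvar v * koszul_cochain c (W - {v}) =
    (if U \<subseteq> W - {v} then Poly_Mapping.single (squarefree_exp (W - U)) (c (W - U - {v})) else 0)"
proof -
  have "unit_exp v + squarefree_exp (W - U - {v}) = squarefree_exp (W - U)" if "U \<subseteq> W - {v}"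
    using that assms by (intro poly_mapping_eqI) (auto simp: lookup_add lookup_squarefree_exp lookup_unit_exp)
  moreover have "W - {v} - U = W - U - {v}" by auto
  ultimately show ?thesis by (simp add: koszul_cochain_def pvar_eq_single mult_single)
qed

lemma koszul_cochain_cocycle:
  fixes c :: "'v set \<Rightarrow> 'k::field"
  assumes cocycle: "cocycle \<nu> (deletion \<Delta> U) i c" and W_subset: "W \<subseteq> V" "card W = Suc (i + card U)"
  shows "weighted_coboundary \<nu> pvar (Pow V) (koszul_cochain c) W \<in> SR_ideal \<Delta>"
  unfolding SR_ideal_iff[OF \<Delta>_complex(1)]
proof (intro allI impI)
  fix m :: "'v \<Rightarrow>\<^sub>0 nat"
  assume m_face: "keys m \<in> \<Delta>"
  have fin: "finite W" using W_subset(1) V_oriented(1) by (rule finite_subset)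
  show "lookup (weighted_coboundary \<nu> pvar (Pow V) (koszul_cochain c) W) m = 0"
  proof (cases "U \<subseteq> W \<and> m = squarefree_exp (W - U)")
    case True
    then have "keys m = W - U" using fin by (auto simp: keys_squarefree_exp)
    then have G_in: "W - U \<in> deletion \<Delta> U" "W - U \<union> U = W" using m_face True by (auto simp: deletion_def)
    have "coboundary \<nu> (deletion \<Delta> U) (\<lambda>H. lookup (koszul_cochain c (H \<union> U)) (squarefree_exp H)) (W - U)
        = coboundary \<nu> (deletion \<Delta> U) c (W - U)"
      by (rule weighted_coboundary_cong) (simp add: lookup_koszul_cochain removable_def deletion_def)
    also have "\<dots> = 0"
      using cocycle G_in(1) True W_subset(2) fin finite_deleted
      by (intro cocycleD) (auto simp: card_Diff_subset)
    finally show ?thesis using lookup_koszul_coboundary[OF G_in(1), of "koszul_cochain c"] G_in(2) True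
      by simp
  next
    case False
    have "lookup (pvar v * koszul_cochain c (W - {v})) m = 0" if "v \<in> W" for v
      using False that by (auto simp: pvar_times_koszul_cochain[OF fin] lookup_single when_def)
    then show ?thesis
      by (simp add: weighted_coboundary_def lookup_sum lookup_orient_sign_times mult.assoc removable_def)
  qed
qed

lemma exact_at_deletion:
  assumes exact: "koszul_exact_at \<nu> pvar V (SR_ideal \<Delta> :: ('v, 'k::field) mpoly set) (i + card U)"
  shows "exact_at TYPE('k) \<nu> (deletion \<Delta> U) i"
proof (rule exact_atI)
  fix c :: "'v set \<Rightarrow> 'k"
  assume "cocycle \<nu> (deletion \<Delta> U) i c"
  then obtain B where B_primitive: "\<And>W. W \<subseteq> V \<Longrightarrow> card W = i + card U \<Longrightarrow>
      koszul_cochain c W - weighted_coboundary \<nu> pvar (Pow V) B W \<in> SR_ideal \<Delta>"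
    using exact koszul_cochain_cocycle[of i c] unfolding koszul_exact_at_def by metis
  have "c G = coboundary \<nu> (deletion \<Delta> U) (\<lambda>H. lookup (B (H \<union> U)) (squarefree_exp H)) G"
    if G_in: "G \<in> deletion \<Delta> U" "card G = i" for G
  proof -
    have G_face: "G \<in> \<Delta>" "G \<inter> U = {}" "G \<subseteq> V" "finite G"
      using deletionD[OF G_in(1)] by auto
    then have "koszul_cochain c (G \<union> U) - weighted_coboundary \<nu> pvar (Pow V) B (G \<union> U) \<in> SR_ideal \<Delta>"
      using G_in(2) U_initial(1) finite_deleted by (intro B_primitive) (auto simp: card_Un_disjoint)
    then have
      "lookup (koszul_cochain c (G \<union> U) - weighted_coboundary \<nu> pvar (Pow V) B (G \<union> U)) (squarefree_exp G) = 0"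
      using G_face unfolding SR_ideal_iff[OF \<Delta>_complex(1)] by (simp add: keys_squarefree_exp)
    then show ?thesis
      by (simp add: lookup_minus lookup_koszul_cochain[OF G_face(2)] lookup_koszul_coboundary[OF G_in(1)])
  qed
  then show "\<exists>b. \<forall>G\<in>deletion \<Delta> U. card G = i \<longrightarrow> c G = coboundary \<nu> (deletion \<Delta> U) b G" by blast
qed

end

lemma exact_at_star_of_deletions:
  fixes \<Delta> :: "'v set set"
  assumes V_vertices: "finite V" "\<And>G. G \<in> \<Delta> \<Longrightarrow> G \<subseteq> V" and \<Delta>_complex: "simplicial \<Delta>" "orients \<nu> \<Delta>"
    and exact: "\<And>U i. U \<subseteq> V \<Longrightarrow> i + card U < d \<Longrightarrow> exact_at TYPE('k::field) \<nu> (deletion \<Delta> U) i"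
    and F_subset: "finite F" "F \<subseteq> V"
  shows "U \<subseteq> V - F \<Longrightarrow> i + card U < d \<Longrightarrow> exact_at TYPE('k) \<nu> {G \<in> \<Delta>. F \<subseteq> G \<and> G \<inter> U = {}} i"
  using F_subset
proof (induction F arbitrary: U i rule: finite_induct)
  case empty
  then show ?case using exact by (simp add: deletion_def)
next
  case (insert v F)
  show ?case
  proof (rule exact_at_upper)
    show "orients \<nu> {G \<in> \<Delta>. F \<subseteq> G \<and> G \<inter> U = {}}" by (rule orients_subset[OF \<Delta>_complex(2)]) auto
    show "convex_family {G \<in> \<Delta>. F \<subseteq> G \<and> G \<inter> U = {}}"
      by (rule convex_family_simplicial[OF \<Delta>_complex(1)]) auto
    show "exact_at TYPE('k) \<nu> {G \<in> \<Delta>. F \<subseteq> G \<and> G \<inter> U = {}} i"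
      using insert by auto
    have "card (insert v U) = Suc (card U)"
      using insert.prems V_vertices(1) by (subst card_insert_disjoint) (auto intro: finite_subset)
    then show "exact_at TYPE('k) \<nu> {G \<in> \<Delta>. F \<subseteq> G \<and> G \<inter> insert v U = {}} j" if "i = Suc j" for j
      using insert that by (intro insert.IH) auto
  qed auto
qed

lemma orientation_with_last:
  fixes V U :: "'v set"
  assumes "finite V"
  obtains \<nu> :: "'v \<Rightarrow> nat" where "inj_on \<nu> V" "\<And>u v. u \<in> U \<Longrightarrow> v \<in> V - U \<Longrightarrow> \<nu> v < \<nu> u"
proof -
  obtain g :: "'v \<Rightarrow> nat" and N where g_bij: "g ` V = {i. i < N}" "inj_on g V"
    using finite_imp_inj_to_nat_seg[OF assms] by auto
  then have less: "g v < N" if "v \<in> V" for v using that by auto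
  show ?thesis
  proof (rule that)
    show "inj_on (\<lambda>v. if v \<in> U then g v + N else g v) V"
      using g_bij(2) less by (intro inj_onI) (fastforce dest: inj_onD split: if_splits)
  qed (use less in \<open>auto simp: trans_less_add2\<close>)
qed

theorem reisner_of_regular_seq:
  fixes \<Delta> :: "'v set set"
  assumes V_vertices: "finite V" "\<And>G. G \<in> \<Delta> \<Longrightarrow> G \<subseteq> V" and \<Delta>_complex: "simplicial \<Delta>" "orients \<nu> \<Delta>"
    and regular: "regular_seq_quot (SR_ideal \<Delta> :: ('v, 'k::field) mpoly set) var_ideal d f"
  shows "reisner TYPE('k) \<nu> \<Delta> d"
proof -
  have "exact_at TYPE('k) \<nu> (deletion \<Delta> U) i" if U_small: "U \<subseteq> V" "i + card U < d" for U i
  proof -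
    obtain \<mu> :: "'v \<Rightarrow> nat" where \<mu>_orders: "inj_on \<mu> V" "\<And>u v. u \<in> U \<Longrightarrow> v \<in> V - U \<Longrightarrow> \<mu> v < \<mu> u"
      using orientation_with_last[OF V_vertices(1)] by blast
    have "koszul_exact_at \<mu> pvar V (SR_ideal \<Delta> :: ('v, 'k) mpoly set) (i + card U)"
      using var_ideal_combination[OF V_vertices]
      by (rule koszul_exact_at_of_regular_seq[OF V_vertices(1) \<mu>_orders(1) is_ideal_SR_ideal regular _
        U_small(2)])
    then have "exact_at TYPE('k) \<mu> (deletion \<Delta> U) i"
      by (intro exact_at_deletion[OF V_vertices(1) \<mu>_orders(1) \<Delta>_complex(1) V_vertices(2) U_small(1)
        \<mu>_orders(2)])
    moreover have "orients \<mu> (deletion \<Delta> U)"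
      by (rule orients_subset[OF orients_Pow[OF V_vertices(1) \<mu>_orders(1)]])
        (use V_vertices(2) in \<open>auto simp: deletion_def\<close>)
    moreover have "orients \<nu> (deletion \<Delta> U)"
      by (rule orients_subset[OF \<Delta>_complex(2)]) (auto simp: deletion_def)
    ultimately show ?thesis using exact_at_reorient by blast
  qed
  then have "exact_at TYPE('k) \<nu> {G \<in> \<Delta>. F \<subseteq> G} i" if "F \<in> \<Delta>" "i < d" for F i
    using exact_at_star_of_deletions[where ?'k = 'k, OF V_vertices \<Delta>_complex, of d F "{}" i] that
      V_vertices(2)[OF that(1)] finite_subset[OF _ V_vertices(1)]
    by simp
  then show ?thesis by (simp add: reisner_def star_def)
qed

section \<open>From exactness to regular sequences\<close>

locale coloured_complex =
  fixes \<Gamma> :: "'v set set" and V :: "'v set" and \<rho> :: "'v \<Rightarrow> nat" and n :: nat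
  assumes finite_vertices: "finite V" and simplicial: "simplicial \<Gamma>"
    and face_subset: "G \<in> \<Gamma> \<Longrightarrow> G \<subseteq> V" and colour_less: "v \<in> V \<Longrightarrow> \<rho> v < n"
    and inj_on_colour: "G \<in> \<Gamma> \<Longrightarrow> inj_on \<rho> G"
begin

lemma finite_face: "G \<in> \<Gamma> \<Longrightarrow> finite G"
  using face_subset finite_vertices by (rule finite_subset)

lemma finite_complex: "finite \<Gamma>"
  using face_subset finite_vertices by (intro finite_subset[of \<Gamma> "Pow V"]) auto

lemma subface: "G \<in> \<Gamma> \<Longrightarrow> F \<subseteq> G \<Longrightarrow> F \<in> \<Gamma>"
  by (rule simplicialD[OF simplicial])

lemma orients_colour: "orients \<rho> \<Gamma>"
  by (simp add: orients_def finite_face inj_on_colour)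

lemma colours_less: "G \<in> \<Gamma> \<Longrightarrow> \<rho> ` G \<subseteq> {..<n}"
  using face_subset colour_less by blast

lemma same_colour: "G \<in> \<Gamma> \<Longrightarrow> v \<in> G \<Longrightarrow> w \<in> G \<Longrightarrow> \<rho> v = \<rho> w \<Longrightarrow> v = w"
  using inj_on_colour by (auto dest: inj_onD)

lemma card_face_le: "G \<in> \<Gamma> \<Longrightarrow> card G \<le> n"
  using card_image[OF inj_on_colour] card_mono[OF _ colours_less] by fastforce

definition colour_interval :: "nat set \<Rightarrow> nat set \<Rightarrow> 'v set set" where
  "colour_interval U T = {G \<in> \<Gamma>. U \<subseteq> \<rho> ` G \<and> \<rho> ` G \<subseteq> T}"

lemma orients_colour_interval: "orients \<rho> (colour_interval U T)"
  by (rule orients_subset[OF orients_colour]) (auto simp: colour_interval_def)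

lemma convex_family_colour_interval: "convex_family (colour_interval U T)"
  unfolding colour_interval_def by (rule convex_family_simplicial[OF simplicial]) blast

lemma removable_colour_interval:
  assumes "G \<in> colour_interval U T"
  shows "removable (colour_interval U T) G = {v \<in> G. \<rho> v \<notin> U}"
proof -
  have G_in: "G \<in> \<Gamma>" "U \<subseteq> \<rho> ` G" "\<rho> ` G \<subseteq> T" using assms by (auto simp: colour_interval_def)
  have "\<rho> ` (G - {v}) = \<rho> ` G - {\<rho> v}" if "v \<in> G" for v
    using inj_on_image_set_diff[OF inj_on_colour[OF G_in(1)], of G "{v}"] that by simp
  then show ?thesis
    using G_in subface[OF G_in(1)] by (auto simp: removable_def colour_interval_def)
qed

lemma exact_at_colour_interval_top:
  assumes reisner: "reisner TYPE('k::field) \<rho> \<Gamma> n" and "i < n"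
  shows "exact_at TYPE('k) \<rho> (colour_interval U {..<n}) i"
proof (rule exact_at_filtration[where key = "\<lambda>G. {v \<in> G. \<rho> v \<in> U}" and rank = "\<lambda>_. 0",
      OF orients_colour_interval convex_family_colour_interval])
  let ?X = "colour_interval U {..<n}" and ?key = "\<lambda>G. {v \<in> G. \<rho> v \<in> U}"
  have key_eq: "?key H = F" if "F \<subseteq> H" "H \<in> \<Gamma>" "\<rho> ` F = U" for F H
    using that same_colour[OF that(2)] by blast
  show "finite ?X" using finite_complex by (simp add: colour_interval_def)
  have image_key: "\<rho> ` ?key G = U" if "G \<in> ?X" for G
    using that by (auto simp: colour_interval_def)
  show "?key G = ?key H \<or> (0::nat) < 0" if "G \<in> ?X" "H \<in> ?X" "G \<subseteq> H" for G H
    using key_eq[of "?key G" H] image_key[OF that(1)] that by (auto simp: colour_interval_def)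
  fix F assume "F \<in> ?key ` ?X"
  then obtain G where G_in: "G \<in> ?X" "F = ?key G" by blast
  then have F_in: "F \<in> \<Gamma>" "\<rho> ` F = U" using subface[of G F] image_key[OF G_in(1)]
    by (auto simp: colour_interval_def)
  have "H \<in> ?X \<and> ?key H = F \<longleftrightarrow> H \<in> star \<Gamma> F" for H
    using key_eq[OF _ _ F_in(2), of H] F_in(2) colours_less[of H] unfolding star_def colour_interval_def
    by blast
  then have "{H \<in> ?X. ?key H = F} = star \<Gamma> F" by blast
  then show "exact_at TYPE('k) \<rho> {H \<in> ?X. ?key H = F} i"
    using reisner F_in(1) \<open>i < n\<close> by (simp add: reisner_def)
qed

theorem exact_at_colour_interval:
  assumes reisner: "reisner TYPE('k::field) \<rho> \<Gamma> n" and "T \<subseteq> {..<n}" "i < card T"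
  shows "exact_at TYPE('k) \<rho> (colour_interval U T) i"
  using assms(2,3)
proof (induction "card ({..<n} - T)" arbitrary: T U i)
  case 0
  then have "T = {..<n}" by auto
  then show ?case using exact_at_colour_interval_top[OF reisner] 0 by simp
next
  case (Suc k)
  then obtain j where j_new: "j < n" "j \<notin> T"
    by (metis DiffE card.empty ex_in_conv lessThan_iff nat.distinct(1))
  have "finite T" using Suc.prems(1) by (rule finite_subset) simp
  then have card_insert: "card (insert j T) = Suc (card T)" using j_new by simp
  have "{..<n} - insert j T = ({..<n} - T) - {j}" by auto
  then have "k = card ({..<n} - insert j T)" using Suc.hyps(2) j_new by simp
  note IH = Suc.hyps(1)[OF this]
  have "exact_at TYPE('k) \<rho> (colour_interval U (insert j T)) i"
    using Suc.prems j_new card_insert by (intro IH) auto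
  moreover have "exact_at TYPE('k) \<rho> (colour_interval (insert j U) (insert j T)) (Suc i)"
    using Suc.prems j_new card_insert by (intro IH) auto
  ultimately show ?case
  proof (rule exact_at_lower[OF orients_colour_interval convex_family_colour_interval, rotated 3])
    show "colour_interval U T \<inter> colour_interval (insert j U) (insert j T) = {}"
      using j_new by (auto simp: colour_interval_def)
  qed (use j_new in \<open>auto simp: colour_interval_def\<close>)
qed

lemma orient_sign_colour:
  assumes "G \<in> \<Gamma>" "v \<in> G"
  shows "orient_sign \<rho> v G = orient_sign id (\<rho> v) (\<rho> ` G)"
proof -
  have "{l \<in> \<rho> ` G. l < \<rho> v} = \<rho> ` {w \<in> G. \<rho> w < \<rho> v}" by auto
  moreover have "inj_on \<rho> {w \<in> G. \<rho> w < \<rho> v}" using inj_on_colour[OF assms(1)] by (rule inj_on_subset) auto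
  ultimately show ?thesis by (simp add: orient_sign_def card_image)
qed

definition colour_cochain :: "nat set \<Rightarrow> (nat \<Rightarrow> 'v set \<Rightarrow> 'k::field) \<Rightarrow> 'v set \<Rightarrow> 'k" where
  "colour_cochain T f G = (\<Sum>l\<in>T - \<rho> ` G. orient_sign id l T * f l G)"

lemma colour_cochain_eq:
  assumes "\<rho> ` G = T - {l}" "l \<in> T"
  shows "colour_cochain T f G = orient_sign id l T * f l G"
proof -
  have "T - \<rho> ` G = {l}" using assms by auto
  then show ?thesis by (simp add: colour_cochain_def)
qed

text \<open>A relation between functions \<open>f l\<close> on the faces that miss exactly the colour \<open>l\<close> of \<open>T\<close> is a cocycle
  condition in the top degree but one of the chains with colours in \<open>T\<close>.\<close>

lemma cocycle_colour_cochain: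
  fixes f :: "nat \<Rightarrow> 'v set \<Rightarrow> 'k::field"
  assumes T: "finite T" "card T = Suc d"
    and relation: "\<And>G. G \<in> \<Gamma> \<Longrightarrow> \<rho> ` G = T \<Longrightarrow> (\<Sum>v | v \<in> G \<and> \<rho> v \<notin> U. f (\<rho> v) (G - {v})) = 0"
  shows "cocycle \<rho> (colour_interval U T) d (colour_cochain T f)"
  unfolding cocycle_def
proof (intro ballI impI)
  fix G assume G_in: "G \<in> colour_interval U T" "card G = Suc d"
  then have G_face: "G \<in> \<Gamma>" and "\<rho> ` G \<subseteq> T" by (auto simp: colour_interval_def)
  then have colours_G: "\<rho> ` G = T"
    using T G_in(2) inj_on_colour[OF G_face] by (intro card_subset_eq) (auto simp: card_image)
  have "orient_sign \<rho> v G * 1 * colour_cochain T f (G - {v}) = f (\<rho> v) (G - {v})" if "v \<in> G" for v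
  proof -
    have "\<rho> ` (G - {v}) = T - {\<rho> v}"
      using inj_on_image_set_diff[OF inj_on_colour[OF G_face], of G "{v}"] that colours_G by simp
    then show ?thesis using that colours_G by (auto simp: colour_cochain_eq orient_sign_colour[OF G_face])
  qed
  then have "coboundary \<rho> (colour_interval U T) (colour_cochain T f) G =
      (\<Sum>v | v \<in> G \<and> \<rho> v \<notin> U. f (\<rho> v) (G - {v}))"
    unfolding weighted_coboundary_def removable_colour_interval[OF G_in(1)] by (intro sum.cong) auto
  then show "coboundary \<rho> (colour_interval U T) (colour_cochain T f) G = 0"
    using relation[OF G_face colours_G] by simp
qed

lemma colour_relation_trivial:
  fixes f :: "nat \<Rightarrow> 'v set \<Rightarrow> 'k::field"
  assumes reisner: "reisner TYPE('k) \<rho> \<Gamma> n" and T_colours: "T \<subseteq> {..<n}" and U_subset: "U \<subseteq> T"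
    and j_in: "j \<in> T - U"
    and relation: "\<And>G. G \<in> \<Gamma> \<Longrightarrow> \<rho> ` G = T \<Longrightarrow> (\<Sum>v | v \<in> G \<and> \<rho> v \<notin> U. f (\<rho> v) (G - {v})) = 0"
  obtains h where "\<And>G. G \<in> \<Gamma> \<Longrightarrow> \<rho> ` G = T - {j} \<Longrightarrow> f j G = (\<Sum>v | v \<in> G \<and> \<rho> v \<notin> U. h (\<rho> v) (G - {v}))"
proof -
  let ?X = "colour_interval U T"
  have finite_T: "finite T" using T_colours by (rule finite_subset) simp
  obtain d where card_T: "card T = Suc d" using j_in finite_T by (metis DiffD1 card_Suc_Diff1)
  have "cocycle \<rho> ?X d (colour_cochain T f)"
    using finite_T card_T relation by (rule cocycle_colour_cochain)
  moreover have "exact_at TYPE('k) \<rho> ?X d" using card_T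
    by (intro exact_at_colour_interval[OF reisner T_colours]) simp
  ultimately obtain b where b_primitive: "\<And>G. G \<in> ?X \<Longrightarrow> card G = d \<Longrightarrow>
      colour_cochain T f G = coboundary \<rho> ?X b G"
    using exact_atE by blast
  let ?h = "\<lambda>i H. orient_sign id j T * (orient_sign id i (T - {j}) * b H)"
  have "f j G = (\<Sum>v | v \<in> G \<and> \<rho> v \<notin> U. ?h (\<rho> v) (G - {v}))" if G_in: "G \<in> \<Gamma>" "\<rho> ` G = T - {j}" for G
  proof -
    have G_in_X: "G \<in> ?X" using G_in U_subset j_in by (auto simp: colour_interval_def)
    have "card G = d" using G_in j_in card_T finite_T card_image[OF inj_on_colour[OF G_in(1)]] by simp
    then have "orient_sign id j T * f j G = coboundary \<rho> ?X b G"
      using b_primitive[OF G_in_X] colour_cochain_eq[OF G_in(2), of f] j_in by simp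
    then have "f j G = orient_sign id j T * coboundary \<rho> ?X b G" by (metis orient_sign_square_left)
    also have "\<dots> = (\<Sum>v | v \<in> G \<and> \<rho> v \<notin> U. ?h (\<rho> v) (G - {v}))"
      unfolding weighted_coboundary_def removable_colour_interval[OF G_in_X] sum_distrib_left
      using G_in by (intro sum.cong) (auto simp: orient_sign_colour)
    finally show ?thesis .
  qed
  then show ?thesis by (rule that)
qed

section \<open>Monomials by colour degree\<close>

text \<open>Relations between the colour sums are analysed one colour degree at a time, where a monomial
  is determined by its support.\<close>

definition colour_monomial :: "(nat \<Rightarrow> nat) \<Rightarrow> 'v set \<Rightarrow> 'v \<Rightarrow>\<^sub>0 nat" where
  "colour_monomial a G = exponent (\<lambda>v. a (\<rho> v)) G"

definition colour_degree :: "('v \<Rightarrow>\<^sub>0 nat) \<Rightarrow> nat \<Rightarrow> nat" where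
  "colour_degree m l = (\<Sum>v | v \<in> keys m \<and> \<rho> v = l. lookup m v)"

definition coloured_part :: "(nat \<Rightarrow> nat) \<Rightarrow> 'v set \<Rightarrow> 'v set" where
  "coloured_part a G = {v \<in> G. 0 < a (\<rho> v)}"

definition lower :: "(nat \<Rightarrow> nat) \<Rightarrow> nat \<Rightarrow> nat \<Rightarrow> nat" where
  "lower a i = a(i := a i - 1)"

definition raise :: "(nat \<Rightarrow> nat) \<Rightarrow> nat \<Rightarrow> nat \<Rightarrow> nat" where
  "raise a i = a(i := Suc (a i))"

lemma lower_raise: "lower (raise a i) i = a"
  by (simp add: lower_def raise_def)

lemma raise_lower: "0 < a i \<Longrightarrow> raise (lower a i) i = a"
  by (simp add: lower_def raise_def)

lemma keys_colour_monomial: "finite G \<Longrightarrow> keys (colour_monomial a G) = coloured_part a G"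
  by (simp add: colour_monomial_def keys_exponent coloured_part_def)

lemma colour_monomial_coloured_part: "finite G \<Longrightarrow> colour_monomial a (coloured_part a G) = colour_monomial a G"
  unfolding colour_monomial_def exponent_def coloured_part_def
  by (rule sum.mono_neutral_left) auto

lemma coloured_part_id: "\<rho> ` G \<subseteq> {l. 0 < a l} \<Longrightarrow> coloured_part a G = G"
  by (auto simp: coloured_part_def)

lemma coloured_part_lower:
  assumes "G \<in> \<Gamma>" "\<rho> ` G = {l. 0 < a l}" "v \<in> G" "a (\<rho> v) = 1"
  shows "coloured_part (lower a (\<rho> v)) G = G - {v}"
proof -
  have "\<rho> w = \<rho> v \<longleftrightarrow> w = v" "0 < a (\<rho> w)" if "w \<in> G" for w
    using same_colour[OF assms(1)] assms(2,3) that by auto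
  then show ?thesis using assms(4) by (auto simp: coloured_part_def lower_def)
qed

lemma colour_degree_eq_0_iff: "colour_degree m l = 0 \<longleftrightarrow> l \<notin> \<rho> ` keys m"
  by (auto simp: colour_degree_def in_keys_iff)

lemma colour_degree_vertex:
  assumes "keys m \<in> \<Gamma>" "v \<in> keys m"
  shows "colour_degree m (\<rho> v) = lookup m v"
proof -
  have "{w. w \<in> keys m \<and> \<rho> w = \<rho> v} = {v}" using same_colour[OF assms(1)] assms(2) by auto
  then show ?thesis by (simp add: colour_degree_def)
qed

lemma image_colour_keys: "\<rho> ` keys m = {l. 0 < colour_degree m l}"
proof (rule set_eqI)
  fix l show "l \<in> \<rho> ` keys m \<longleftrightarrow> l \<in> {l. 0 < colour_degree m l}"
    using colour_degree_eq_0_iff[of m l] by (simp add: neq0_conv[symmetric] del: neq0_conv)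
qed

lemma colour_monomial_colour_degree:
  assumes "keys m \<in> \<Gamma>"
  shows "colour_monomial (colour_degree m) (keys m) = m"
proof (rule poly_mapping_eqI)
  fix v show "lookup (colour_monomial (colour_degree m) (keys m)) v = lookup m v"
    using colour_degree_vertex[OF assms] by (simp add: colour_monomial_def lookup_exponent in_keys_iff)
qed

lemma colour_degree_colour_monomial:
  assumes "G \<in> \<Gamma>" "\<And>l. 0 < a l \<Longrightarrow> l \<in> \<rho> ` G"
  shows "colour_degree (colour_monomial a G) = a"
proof
  fix l
  let ?m = "colour_monomial a G"
  have fin: "finite G" by (rule finite_face[OF assms(1)])
  have keys: "keys ?m \<in> \<Gamma>" using assms(1)
    by (auto simp: keys_colour_monomial[OF fin] coloured_part_def intro: subface)
  show "colour_degree ?m l = a l"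
  proof (cases "0 < a l")
    case True
    then obtain v where "v \<in> G" "\<rho> v = l" using assms(2) by blast
    then show ?thesis
      using colour_degree_vertex[OF keys, of v] True
      by (simp add: keys_colour_monomial[OF fin] coloured_part_def)
        (simp add: colour_monomial_def lookup_exponent[OF fin])
  next
    case False
    then show ?thesis using colour_degree_eq_0_iff[of ?m l]
      by (auto simp: keys_colour_monomial[OF fin] coloured_part_def)
  qed
qed

lemma colour_monomial_minus_unit_exp:
  assumes G_in: "G \<in> \<Gamma>" "v \<in> G"
  shows "colour_monomial a G - unit_exp v = colour_monomial (lower a (\<rho> v)) G"
proof (rule poly_mapping_eqI)
  fix w
  have "\<rho> w \<noteq> \<rho> v" if "w \<in> G" "w \<noteq> v" using same_colour G_in that by blast
  then show "lookup (colour_monomial a G - unit_exp v) w = lookup (colour_monomial (lower a (\<rho> v)) G) w"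
    using G_in finite_face[OF G_in(1)]
    by (auto simp: colour_monomial_def lookup_minus lookup_exponent lookup_unit_exp lower_def)
qed

lemma minus_unit_exp:
  assumes m_face: "keys m \<in> \<Gamma>" "v \<in> keys m"
  shows "keys (m - unit_exp v) = coloured_part (lower (colour_degree m) (\<rho> v)) (keys m)"
    and "colour_degree (m - unit_exp v) = lower (colour_degree m) (\<rho> v)"
proof -
  have remove_eq: "m - unit_exp v = colour_monomial (lower (colour_degree m) (\<rho> v)) (keys m)"
    using colour_monomial_minus_unit_exp[OF m_face] colour_monomial_colour_degree[OF m_face(1)] by metis
  show "keys (m - unit_exp v) = coloured_part (lower (colour_degree m) (\<rho> v)) (keys m)"
    unfolding remove_eq by (rule keys_colour_monomial) simp
  show "colour_degree (m - unit_exp v) = lower (colour_degree m) (\<rho> v)"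
    unfolding remove_eq
  proof (rule colour_degree_colour_monomial[OF m_face(1)])
    fix l assume "0 < lower (colour_degree m) (\<rho> v) l"
    then have "0 < colour_degree m l" by (auto simp: lower_def split: if_splits)
    then show "l \<in> \<rho> ` keys m" using image_colour_keys by blast
  qed
qed

lemma finite_monomials_of_colour_degrees:
  assumes "finite A"
  shows "finite {m. keys m \<in> \<Gamma> \<and> colour_degree m \<in> A}"
proof (rule finite_subset)
  show "{m. keys m \<in> \<Gamma> \<and> colour_degree m \<in> A} \<subseteq> (\<lambda>(a, G). colour_monomial a G) ` (A \<times> \<Gamma>)"
    using colour_monomial_colour_degree by force
qed (use assms finite_complex in auto)

section \<open>The colour sums form a regular sequence\<close>

text \<open>The hypothesis \<open>rel\<close> is a relation \<open>\<Sum>i\<le>j. \<theta>\<^sub>i q\<^sub>i = 0\<close> between the colour sums \<open>\<theta>\<^sub>i\<close>, where \<open>\<gamma> i a G\<close> is the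
  coefficient in \<open>q\<^sub>i\<close> of the monomial of colour degree \<open>a\<close> on the face \<open>G\<close>. The conclusion says that in
  colour degree \<open>a\<close> the coefficient \<open>q\<^sub>j\<close> lies in the ideal of the \<open>\<theta>\<^sub>i\<close> with \<open>i < j\<close>.\<close>

context
  fixes \<gamma> :: "nat \<Rightarrow> (nat \<Rightarrow> nat) \<Rightarrow> 'v set \<Rightarrow> 'k::field" and a :: "nat \<Rightarrow> nat" and j :: nat
  assumes rel: "\<And>a G. G \<in> \<Gamma> \<Longrightarrow> \<rho> ` G = {l. 0 < a l} \<Longrightarrow>
      (\<Sum>v | v \<in> G \<and> \<rho> v \<le> j. \<gamma> (\<rho> v) (lower a (\<rho> v)) (coloured_part (lower a (\<rho> v)) G)) = 0"
begin

definition lifts :: "(nat \<Rightarrow> 'v set \<Rightarrow> 'k) \<Rightarrow> bool" where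
  "lifts h \<longleftrightarrow> (\<forall>G\<in>\<Gamma>. \<rho> ` G = {l. 0 < a l} \<longrightarrow>
      \<gamma> j a G = (\<Sum>v | v \<in> G \<and> \<rho> v < j. h (\<rho> v) (coloured_part (lower a (\<rho> v)) G)))"

lemma lifts_nonsquarefree:
  assumes l_less: "l < j" "2 \<le> a l"
  shows "lifts (\<lambda>i H. if i = l then \<gamma> j a H else 0)" (is "lifts ?h")
  unfolding lifts_def
proof (intro ballI impI)
  fix G assume G_in: "G \<in> \<Gamma>" "\<rho> ` G = {l. 0 < a l}"
  have "l \<in> \<rho> ` G" using G_in(2) l_less(2) by simp
  then obtain v where v_in: "v \<in> G" "\<rho> v = l" by blast
  have "coloured_part (lower a l) G = G"
    using l_less(2) G_in(2) by (intro coloured_part_id) (auto simp: lower_def)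
  moreover have "(\<Sum>w | w \<in> G \<and> \<rho> w < j. ?h (\<rho> w) (coloured_part (lower a (\<rho> w)) G)) =
      (\<Sum>w\<in>{v}. ?h (\<rho> w) (coloured_part (lower a (\<rho> w)) G))"
    using v_in l_less(1) same_colour[OF G_in(1)] finite_face[OF G_in(1)]
    by (intro sum.mono_neutral_right) auto
  ultimately show "\<gamma> j a G = (\<Sum>w | w \<in> G \<and> \<rho> w < j. ?h (\<rho> w) (coloured_part (lower a (\<rho> w)) G))"
    using v_in by simp
qed

lemma lifts_colour_present:
  assumes "0 < a j"
  shows "lifts (\<lambda>i H. - \<gamma> i (lower (raise a j) i) H)" (is "lifts ?h")
  unfolding lifts_def
proof (intro ballI impI)
  fix G assume G_in: "G \<in> \<Gamma>" "\<rho> ` G = {l. 0 < a l}"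
  have "j \<in> \<rho> ` G" using G_in(2) assms by simp
  then obtain w where w_in: "w \<in> G" "\<rho> w = j" by blast
  have parts: "coloured_part (lower (raise a j) j) G = G"
    "\<And>i. i < j \<Longrightarrow> coloured_part (lower (raise a j) i) G = coloured_part (lower a i) G"
    using assms G_in(2) by (auto simp: coloured_part_def lower_def raise_def)
  have "{v. v \<in> G \<and> \<rho> v \<le> j} = insert w {v. v \<in> G \<and> \<rho> v < j}"
    using w_in same_colour[OF G_in(1)] by (auto simp: le_less)
  moreover have "\<rho> ` G = {l. 0 < raise a j l}" using G_in(2) assms by (auto simp: raise_def)
  ultimately have "\<gamma> j a G +
      (\<Sum>v | v \<in> G \<and> \<rho> v < j. \<gamma> (\<rho> v) (lower (raise a j) (\<rho> v)) (coloured_part (lower a (\<rho> v)) G)) = 0"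
    using rel[OF G_in(1), of "raise a j"] w_in finite_face[OF G_in(1)] parts by (simp add: lower_raise)
  then show "\<gamma> j a G = (\<Sum>v | v \<in> G \<and> \<rho> v < j. ?h (\<rho> v) (coloured_part (lower a (\<rho> v)) G))"
    by (simp add: sum_negf eq_neg_iff_add_eq_0)
qed

lemma lifts_squarefree:
  assumes reisner: "reisner TYPE('k) \<rho> \<Gamma> n" and j_less: "j < n" and a_bounded: "a j = 0" "\<And>l. l < j \<Longrightarrow> a l \<le> 1"
  shows "\<exists>h. lifts h"
proof (cases "\<exists>G\<in>\<Gamma>. \<rho> ` G = {l. 0 < a l}")
  case True
  define T where "T = insert j {l. 0 < a l}"
  define U where "U = {l. 0 < a l \<and> j < l}"
  let ?f = "\<lambda>l H. \<gamma> l (lower (raise a j) l) H"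
  have colours_T: "{l. 0 < raise a j l} = T" by (auto simp: T_def raise_def)
  have TU: "T \<subseteq> {..<n}" "U \<subseteq> T" "j \<in> T - U"
    using True colours_less j_less by (force simp: T_def U_def)+
  have f_rel: "(\<Sum>v | v \<in> G \<and> \<rho> v \<notin> U. ?f (\<rho> v) (G - {v})) = 0" if G_in: "G \<in> \<Gamma>" "\<rho> ` G = T" for G
  proof -
    have colours_G: "\<rho> v \<le> j \<longleftrightarrow> \<rho> v \<notin> U" if "v \<in> G" for v
      using G_in(2) that by (auto simp: T_def U_def)
    have "raise a j (\<rho> v) = 1" if "v \<in> G" "\<rho> v \<notin> U" for v
      using a_bounded(1) a_bounded(2)[of "\<rho> v"] G_in(2) that by (force simp: raise_def T_def U_def)
    then have "(\<Sum>v | v \<in> G \<and> \<rho> v \<notin> U. ?f (\<rho> v) (G - {v})) =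
        (\<Sum>v | v \<in> G \<and> \<rho> v \<le> j. ?f (\<rho> v) (coloured_part (lower (raise a j) (\<rho> v)) G))"
      using G_in colours_T colours_G by (intro sum.cong) (auto simp: coloured_part_lower)
    then show ?thesis using rel[OF G_in(1), of "raise a j"] G_in(2) colours_T by simp
  qed
  obtain h where h_relation: "\<And>G. G \<in> \<Gamma> \<Longrightarrow> \<rho> ` G = T - {j} \<Longrightarrow>
      ?f j G = (\<Sum>v | v \<in> G \<and> \<rho> v \<notin> U. h (\<rho> v) (G - {v}))"
    using colour_relation_trivial[OF reisner TU, of ?f] f_rel by blast
  have "lifts h"
    unfolding lifts_def
  proof (intro ballI impI)
    fix G assume G_in: "G \<in> \<Gamma>" "\<rho> ` G = {l. 0 < a l}"
    have colours_G: "\<rho> v < j \<longleftrightarrow> \<rho> v \<notin> U" if "v \<in> G" for v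
    proof -
      have "0 < a (\<rho> v)" using G_in(2) that by blast
      then have "\<rho> v \<noteq> j" using a_bounded(1) by auto
      then show ?thesis using \<open>0 < a (\<rho> v)\<close> by (auto simp: U_def)
    qed
    have "a (\<rho> v) = 1" if "v \<in> G" "\<rho> v < j" for v using a_bounded(2)[OF that(2)] G_in(2) that(1) by force
    then have "(\<Sum>v | v \<in> G \<and> \<rho> v \<notin> U. h (\<rho> v) (G - {v})) =
        (\<Sum>v | v \<in> G \<and> \<rho> v < j. h (\<rho> v) (coloured_part (lower a (\<rho> v)) G))"
      using G_in colours_G by (intro sum.cong) (auto simp: coloured_part_lower)
    moreover have "\<rho> ` G = T - {j}" using G_in(2) a_bounded(1) by (auto simp: T_def)
    ultimately show "\<gamma> j a G = (\<Sum>v | v \<in> G \<and> \<rho> v < j. h (\<rho> v) (coloured_part (lower a (\<rho> v)) G))"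
      using h_relation[OF G_in(1)] by (simp add: lower_raise)
  qed
  then show ?thesis by blast
qed (auto simp: lifts_def)

lemma colour_syzygy:
  assumes "reisner TYPE('k) \<rho> \<Gamma> n" "j < n"
  shows "\<exists>h. \<forall>G\<in>\<Gamma>. \<rho> ` G = {l. 0 < a l} \<longrightarrow>
      \<gamma> j a G = (\<Sum>v | v \<in> G \<and> \<rho> v < j. h (\<rho> v) (coloured_part (lower a (\<rho> v)) G))"
proof -
  consider l where "l < j" "2 \<le> a l" | "0 < a j" | "a j = 0" "\<And>l. l < j \<Longrightarrow> a l \<le> 1"
    by fastforce
  then have "\<exists>h. lifts h"
    using lifts_nonsquarefree lifts_colour_present lifts_squarefree[OF assms] by cases blast+
  then show ?thesis unfolding lifts_def .
qed

end

definition colour_sum :: "nat \<Rightarrow> ('v, 'k::field) mpoly" where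
  "colour_sum j = (\<Sum>v | v \<in> V \<and> \<rho> v = j. pvar v)"

lemma lookup_colour_sum_combination:
  fixes p :: "nat \<Rightarrow> ('v, 'k::field) mpoly"
  assumes "keys m \<in> \<Gamma>"
  shows "lookup (\<Sum>i<k. p i * colour_sum i) m = (\<Sum>v | v \<in> keys m \<and> \<rho> v < k. lookup (p (\<rho> v)) (m - unit_exp v))"
proof -
  have "lookup (p i * colour_sum i) m = (\<Sum>v | v \<in> keys m \<and> \<rho> v = i. lookup (p i) (m - unit_exp v))" for i
  proof -
    have "lookup (p i * colour_sum i) m =
        (\<Sum>v | v \<in> V \<and> \<rho> v = i. if v \<in> keys m then lookup (p i) (m - unit_exp v) else 0)"
      by (simp add: colour_sum_def sum_distrib_left lookup_sum lookup_pvar_times mult.commute[of "p i"])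
    also have "\<dots> = (\<Sum>v\<in>{v. v \<in> V \<and> \<rho> v = i} \<inter> keys m. lookup (p i) (m - unit_exp v))"
      using finite_vertices by (simp add: sum.inter_restrict)
    also have "{v. v \<in> V \<and> \<rho> v = i} \<inter> keys m = {v. v \<in> keys m \<and> \<rho> v = i}"
      using face_subset[OF assms] by auto
    finally show ?thesis .
  qed
  then have "lookup (\<Sum>i<k. p i * colour_sum i) m =
      (\<Sum>i<k. \<Sum>v | v \<in> {v. v \<in> keys m \<and> \<rho> v < k} \<and> \<rho> v = i. lookup (p (\<rho> v)) (m - unit_exp v))"
    unfolding lookup_sum by (intro sum.cong refl) (auto intro: sum.cong)
  also have "\<dots> = (\<Sum>v | v \<in> keys m \<and> \<rho> v < k. lookup (p (\<rho> v)) (m - unit_exp v))"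
    by (rule sum.group) auto
  finally show ?thesis .
qed

lemma polynomial_of_colour_lift:
  fixes g :: "('v, 'k::field) mpoly"
  assumes f_lifts: "\<And>a G. G \<in> \<Gamma> \<Longrightarrow> \<rho> ` G = {l. 0 < a l} \<Longrightarrow>
    lookup g (colour_monomial a G) = (\<Sum>v | v \<in> G \<and> \<rho> v < j. f a (\<rho> v) (coloured_part (lower a (\<rho> v)) G))"
  shows "\<exists>p. g - (\<Sum>i<j. p i * colour_sum i) \<in> SR_ideal \<Gamma>"
proof -
  let ?A = "colour_degree ` keys g"
  let ?u = "\<lambda>i m. if keys m \<in> \<Gamma> \<and> raise (colour_degree m) i \<in> ?A
      then f (raise (colour_degree m) i) i (keys m) else 0"
  define p where "p i = Abs_poly_mapping (?u i)" for i
  have lookup_p: "lookup (p i) = ?u i" for i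
  proof -
    have "colour_degree m \<in> (\<lambda>a. lower a i) ` ?A" if "raise (colour_degree m) i \<in> ?A" for m
      using imageI[OF that, of "\<lambda>a. lower a i"] by (simp add: lower_raise)
    then have "{m. ?u i m \<noteq> 0} \<subseteq> {m. keys m \<in> \<Gamma> \<and> colour_degree m \<in> (\<lambda>a. lower a i) ` ?A}"
      by (auto split: if_splits)
    then have "finite {m. ?u i m \<noteq> 0}"
      by (rule finite_subset) (intro finite_monomials_of_colour_degrees finite_imageI finite_keys)
    then show ?thesis unfolding p_def by (rule lookup_Abs_poly_mapping)
  qed
  have "lookup g m = (\<Sum>v | v \<in> keys m \<and> \<rho> v < j. lookup (p (\<rho> v)) (m - unit_exp v))"
    if m_face: "keys m \<in> \<Gamma>" for m
  proof -
    let ?a = "colour_degree m"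
    have coeff: "lookup (p (\<rho> v)) (m - unit_exp v) =
        (if ?a \<in> ?A then f ?a (\<rho> v) (coloured_part (lower ?a (\<rho> v)) (keys m)) else 0)" if "v \<in> keys m" for v
    proof -
      have "0 < ?a (\<rho> v)" using that image_colour_keys[of m] by blast
      moreover have "coloured_part (lower ?a (\<rho> v)) (keys m) \<in> \<Gamma>"
        by (rule subface[OF m_face]) (auto simp: coloured_part_def)
      ultimately show ?thesis
        unfolding lookup_p minus_unit_exp[OF m_face that] by (simp add: raise_lower)
    qed
    show ?thesis
    proof (cases "?a \<in> ?A")
      case True
      then show ?thesis
        using f_lifts[OF m_face image_colour_keys] coeff
        by (simp add: colour_monomial_colour_degree[OF m_face])
    next
      case False
      then have "m \<notin> keys g" by blast
      then show ?thesis using False coeff by (simp add: in_keys_iff)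
    qed
  qed
  then have "g - (\<Sum>i<j. p i * colour_sum i) \<in> SR_ideal \<Gamma>"
    unfolding SR_ideal_iff[OF simplicial] by (simp add: lookup_minus lookup_colour_sum_combination)
  then show ?thesis by blast
qed

lemma colour_sum_nonzerodivisor:
  fixes g :: "('v, 'k::field) mpoly"
  assumes reisner: "reisner TYPE('k) \<rho> \<Gamma> n" and j_less: "j < n"
    and g_relation: "g * colour_sum j - (\<Sum>i<j. h i * colour_sum i) \<in> SR_ideal \<Gamma>"
  shows "\<exists>p. g - (\<Sum>i<j. p i * colour_sum i) \<in> SR_ideal \<Gamma>"
proof -
  define q where "q i = (if i = j then g else - h i)" for i
  define \<gamma> where "\<gamma> i a G = lookup (q i) (colour_monomial a G)" for i a G
  have "(\<Sum>i<Suc j. q i * colour_sum i) \<in> SR_ideal \<Gamma>"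
    using g_relation by (simp add: q_def sum_negf)
  then have q_rel: "(\<Sum>v | v \<in> keys m \<and> \<rho> v \<le> j. lookup (q (\<rho> v)) (m - unit_exp v)) = 0" if "keys m \<in> \<Gamma>" for m
    using that lookup_colour_sum_combination[OF that, of q "Suc j"]
    unfolding SR_ideal_iff[OF simplicial] by (simp add: less_Suc_eq_le)
  have "(\<Sum>v | v \<in> G \<and> \<rho> v \<le> j. \<gamma> (\<rho> v) (lower a (\<rho> v)) (coloured_part (lower a (\<rho> v)) G)) = 0"
    if G_in: "G \<in> \<Gamma>" "\<rho> ` G = {l. 0 < a l}" for a G
  proof -
    have "keys (colour_monomial a G) = G"
      using G_in finite_face[OF G_in(1)] by (simp add: keys_colour_monomial coloured_part_id)
    then show ?thesis
      using q_rel[of "colour_monomial a G"] G_in finite_face[OF G_in(1)]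
      by (simp add: \<gamma>_def colour_monomial_coloured_part colour_monomial_minus_unit_exp cong: conj_cong)
  qed
  then have "\<forall>a. \<exists>h. \<forall>G\<in>\<Gamma>. \<rho> ` G = {l. 0 < a l} \<longrightarrow>
      \<gamma> j a G = (\<Sum>v | v \<in> G \<and> \<rho> v < j. h (\<rho> v) (coloured_part (lower a (\<rho> v)) G))"
    by (intro allI colour_syzygy[OF _ reisner j_less])
  from choice[OF this] obtain f where f_lifts: "\<forall>a. \<forall>G\<in>\<Gamma>. \<rho> ` G = {l. 0 < a l} \<longrightarrow>
      \<gamma> j a G = (\<Sum>v | v \<in> G \<and> \<rho> v < j. f a (\<rho> v) (coloured_part (lower a (\<rho> v)) G))" ..
  have "lookup g (colour_monomial a G) = \<gamma> j a G" for a G by (simp add: \<gamma>_def q_def)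
  then show ?thesis using f_lifts by (intro polynomial_of_colour_lift[where f = f]) simp
qed

theorem regular_seq_colour_sums:
  assumes reisner: "reisner TYPE('k::field) \<rho> \<Gamma> n"
  shows "regular_seq_quot (SR_ideal \<Gamma> :: ('v, 'k) mpoly set) var_ideal n colour_sum"
  unfolding regular_seq_quot_def
proof (intro conjI allI impI)
  let ?I = "SR_ideal \<Gamma> :: ('v, 'k) mpoly set"
  note colour_ideal_iff = gen_ideal_Un_image_iff[OF is_ideal_SR_ideal finite_lessThan]
  show "colour_sum j \<in> (var_ideal :: ('v, 'k) mpoly set)" for j
    unfolding colour_sum_def var_ideal_def
    using gen_ideal_superset by (intro is_ideal_sum is_ideal_gen_ideal) blast
  show "g \<in> gen_ideal (?I \<union> colour_sum ` {..<j})"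
    if "j < n" "colour_sum j * g \<in> gen_ideal (?I \<union> colour_sum ` {..<j})" for j and g :: "('v, 'k) mpoly"
    using that colour_sum_nonzerodivisor[OF reisner that(1), of g]
    unfolding colour_ideal_iff by (auto simp: mult.commute[of _ g])
  show "gen_ideal (?I \<union> colour_sum ` {..<n}) \<noteq> UNIV"
  proof
    assume "gen_ideal (?I \<union> colour_sum ` {..<n}) = UNIV"
    then obtain h where h_unit: "1 - (\<Sum>i<n. h i * colour_sum i) \<in> ?I"
      using colour_ideal_iff[of "1 :: ('v, 'k) mpoly" \<Gamma> colour_sum n] by auto
    have empty: "keys (0 :: 'v \<Rightarrow>\<^sub>0 nat) \<in> \<Gamma>" using simplicial by (simp add: simplicial_def)
    then have "lookup (1 - (\<Sum>i<n. h i * colour_sum i)) 0 = 0"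
      using h_unit unfolding SR_ideal_iff[OF simplicial] by blast
    then show False using lookup_colour_sum_combination[OF empty, of h n] by (simp add: lookup_minus)
  qed
qed

corollary depth_ge_colours:
  assumes "reisner TYPE('k::field) \<rho> \<Gamma> n"
  shows "enat n \<le> depth_quot (SR_ideal \<Gamma> :: ('v, 'k) mpoly set) var_ideal"
  unfolding depth_quot_def using regular_seq_colour_sums[OF assms] by (intro Sup_upper) blast

end

section \<open>Linear algebra of finitely supported functions\<close>

definition pm_scale :: "'k::field \<Rightarrow> ('b \<Rightarrow>\<^sub>0 'k) \<Rightarrow> 'b \<Rightarrow>\<^sub>0 'k" where
  "pm_scale c = Poly_Mapping.map ((*) c)"

lemma lookup_pm_scale [simp]: "lookup (pm_scale c p) m = c * lookup p m"
  by (simp add: pm_scale_def Poly_Mapping.map.rep_eq when_def)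

lemma pm_scale_mpoly: "pm_scale c p = Poly_Mapping.single 0 c * (p :: ('v, 'k::field) mpoly)"
  by (simp add: pm_scale_def mult_map_scale_conv_mult)

interpretation pm: vector_space "pm_scale :: 'k::field \<Rightarrow> ('b \<Rightarrow>\<^sub>0 'k) \<Rightarrow> 'b \<Rightarrow>\<^sub>0 'k"
  by unfold_locales (auto intro!: poly_mapping_eqI simp: lookup_add algebra_simps)

definition basis_vector :: "'b \<Rightarrow> 'b \<Rightarrow>\<^sub>0 'k::field" where
  "basis_vector m = Poly_Mapping.single m 1"

lemma pm_eq_sum_basis_vector:
  fixes p :: "'b \<Rightarrow>\<^sub>0 'k::field"
  shows "p = (\<Sum>m\<in>keys p. pm_scale (lookup p m) (basis_vector m))"
proof -
  have "pm_scale c (basis_vector m) = Poly_Mapping.single m c" for c :: 'k and m :: 'b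
    by (rule poly_mapping_eqI) (simp add: basis_vector_def lookup_single when_def)
  then show ?thesis by (simp flip: poly_mapping_eq_sum_single)
qed

lemma in_span_basis_vector: "keys p \<subseteq> B \<Longrightarrow> p \<in> pm.span (basis_vector ` B)"
  by (subst pm_eq_sum_basis_vector, intro pm.span_sum pm.span_scale pm.span_base) auto

lemma (in vector_space) family_dependent:
  assumes fin: "finite A" "finite T" and span: "\<And>\<alpha>. \<alpha> \<in> A \<Longrightarrow> u \<alpha> \<in> span T" and card: "card T < card A"
  obtains c \<beta> where "\<beta> \<in> A" "c \<beta> \<noteq> 0" "(\<Sum>\<alpha>\<in>A. scale (c \<alpha>) (u \<alpha>)) = 0"
proof (cases "inj_on u A")
  case True
  have "dependent (u ` A)"
    using independent_span_bound[OF fin(2), of "u ` A"] span card card_image[OF True] by fastforce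
  then obtain d where "\<exists>x\<in>u ` A. d x \<noteq> 0" "(\<Sum>x\<in>u ` A. scale (d x) x) = 0"
    using fin(1) by (auto simp: dependent_finite)
  then show ?thesis using that[of _ "\<lambda>\<alpha>. d (u \<alpha>)"] by (auto simp: sum.reindex[OF True])
next
  case False
  then obtain \<beta> \<gamma> where collision: "\<beta> \<in> A" "\<gamma> \<in> A" "\<beta> \<noteq> \<gamma>" "u \<beta> = u \<gamma>" by (auto simp: inj_on_def)
  let ?c = "(\<lambda>_. 0)(\<beta> := 1, \<gamma> := -1)"
  have "(\<Sum>\<alpha>\<in>A. scale (?c \<alpha>) (u \<alpha>)) = (\<Sum>\<alpha>\<in>{\<beta>, \<gamma>}. scale (?c \<alpha>) (u \<alpha>))"
    using collision fin(1) by (intro sum.mono_neutral_right) auto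
  also have "\<dots> = 0" using collision by simp
  finally show ?thesis using that[of \<beta> ?c] collision by simp
qed

section \<open>The Krull dimension of a Stanley--Reisner ring\<close>

lemma prime_ideal_power: "is_prime_ideal p \<Longrightarrow> a \<notin> p \<Longrightarrow> a ^ t \<notin> p"
  by (induction t) (auto dest: is_prime_idealD)

lemma sum_powers_lowest_term:
  fixes a :: "'r::comm_ring_1"
  assumes p_ideal: "is_ideal p" "a \<in> p" and S_bounded: "finite S" "\<And>\<alpha>. \<alpha> \<in> S \<Longrightarrow> t \<le> e \<alpha>"
  obtains q where "(\<Sum>\<alpha>\<in>S. c \<alpha> * a ^ e \<alpha>) = a ^ t * q" "q - (\<Sum>\<alpha> | \<alpha> \<in> S \<and> e \<alpha> = t. c \<alpha>) \<in> p"
proof (rule that)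
  let ?q = "\<Sum>\<alpha>\<in>S. c \<alpha> * a ^ (e \<alpha> - t)"
  show "(\<Sum>\<alpha>\<in>S. c \<alpha> * a ^ e \<alpha>) = a ^ t * ?q"
    unfolding sum_distrib_left
  proof (rule sum.cong[OF refl])
    fix \<alpha> assume "\<alpha> \<in> S"
    then have "a ^ e \<alpha> = a ^ t * a ^ (e \<alpha> - t)" using S_bounded(2) by (simp flip: power_add)
    then show "c \<alpha> * a ^ e \<alpha> = a ^ t * (c \<alpha> * a ^ (e \<alpha> - t))" by (simp add: mult_ac)
  qed
  have "?q = (\<Sum>\<alpha> | \<alpha> \<in> S \<and> e \<alpha> = t. c \<alpha> * a ^ (e \<alpha> - t)) + (\<Sum>\<alpha> | \<alpha> \<in> S \<and> e \<alpha> \<noteq> t. c \<alpha> * a ^ (e \<alpha> - t))"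
    using S_bounded(1) by (subst sum.union_disjoint[symmetric]) (auto intro: sum.cong)
  moreover have "(\<Sum>\<alpha> | \<alpha> \<in> S \<and> e \<alpha> \<noteq> t. c \<alpha> * a ^ (e \<alpha> - t)) \<in> p"
  proof (intro is_ideal_sum[OF p_ideal(1)] is_ideal_mult_left[OF p_ideal(1)])
    fix \<alpha> assume "\<alpha> \<in> {\<alpha>. \<alpha> \<in> S \<and> e \<alpha> \<noteq> t}"
    then have "t < e \<alpha>" using S_bounded(2) by (auto simp: le_less)
    then show "a ^ (e \<alpha> - t) \<in> p"
      using is_ideal_mult_right[OF p_ideal, of "a ^ (e \<alpha> - t - 1)"] by (simp add: power_eq_if)
  qed
  ultimately show "?q - (\<Sum>\<alpha> | \<alpha> \<in> S \<and> e \<alpha> = t. c \<alpha>) \<in> p" by simp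
qed

text \<open>A polynomial relation between elements \<open>a\<^sub>i \<in> p\<^sub>i\<^sub>+\<^sub>1 - p\<^sub>i\<close> of a chain of primes is impossible:
  cancelling, one prime after the other, the lowest power of \<open>a\<^sub>i\<close>, puts the coefficient of the
  lexicographically smallest monomial into the last prime.\<close>

lemma prime_chain_algebraically_independent:
  fixes a :: "nat \<Rightarrow> 'r::comm_ring_1" and p :: "nat \<Rightarrow> 'r set"
  assumes p_chain: "\<And>i. i \<le> N \<Longrightarrow> is_prime_ideal (p i)" "\<And>i. i < N \<Longrightarrow> p i \<subseteq> p (Suc i)"
    and a_in: "\<And>i. i < N \<Longrightarrow> a i \<in> p (Suc i) - p i"
    and "l \<le> N"
    and S_finite: "finite S" "S \<noteq> {}" "S \<subseteq> extensional {..<N}" "\<And>\<alpha>. \<alpha> \<in> S \<Longrightarrow> c \<alpha> \<notin> p N"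
      "\<And>\<alpha> \<beta> i. \<alpha> \<in> S \<Longrightarrow> \<beta> \<in> S \<Longrightarrow> i < l \<Longrightarrow> \<alpha> i = \<beta> i"
  shows "(\<Sum>\<alpha>\<in>S. c \<alpha> * (\<Prod>i\<in>{l..<N}. a i ^ \<alpha> i)) \<notin> p l"
  using \<open>l \<le> N\<close> S_finite
proof (induction l arbitrary: S rule: inc_induct)
  case base
  obtain \<alpha> where \<alpha>_in: "\<alpha> \<in> S" using base.prems(2) by blast
  have "\<beta> = \<alpha>" if "\<beta> \<in> S" for \<beta>
    using base.prems(3) base.prems(5)[OF that \<alpha>_in] that \<alpha>_in by (intro extensionalityI[of \<beta> "{..<N}" \<alpha>]) auto
  then have "S = {\<alpha>}" using \<alpha>_in by blast
  then show ?case using base.prems(4)[OF \<alpha>_in] by simp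
next
  case (step l)
  note l_less = step.hyps(2)
  have prime: "is_prime_ideal (p l)" and ideal_Suc: "is_ideal (p (Suc l))"
    using p_chain(1)[of l] p_chain(1)[of "Suc l"] l_less by (auto dest: is_prime_idealD)
  let ?R = "\<lambda>\<alpha>. c \<alpha> * (\<Prod>i\<in>{Suc l..<N}. a i ^ \<alpha> i)"
  define t where "t = Min ((\<lambda>\<alpha>. \<alpha> l) ` S)"
  define S' where "S' = {\<alpha>. \<alpha> \<in> S \<and> \<alpha> l = t}"
  have t_min: "t \<le> \<alpha> l" if "\<alpha> \<in> S" for \<alpha> unfolding t_def using step.prems(1) that by (intro Min_le) auto
  have "t \<in> (\<lambda>\<alpha>. \<alpha> l) ` S" unfolding t_def using step.prems(1,2) by (intro Min_in) auto
  then have S'_finite: "finite S'" "S' \<noteq> {}" "S' \<subseteq> S" using step.prems(1) by (auto simp: S'_def)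
  have "a l \<in> p (Suc l)" using a_in[OF l_less] by simp
  then obtain q where q_cofactor: "(\<Sum>\<alpha>\<in>S. ?R \<alpha> * a l ^ \<alpha> l) = a l ^ t * q" "q - (\<Sum>\<alpha>\<in>S'. ?R \<alpha>) \<in> p (Suc l)"
    using sum_powers_lowest_term[OF ideal_Suc _ step.prems(1), where c = ?R and e = "\<lambda>\<alpha>. \<alpha> l" and t = t] t_min
    unfolding S'_def by blast
  have "\<alpha> i = \<beta> i" if "\<alpha> \<in> S'" "\<beta> \<in> S'" "i < Suc l" for \<alpha> \<beta> i
    using step.prems(5)[of \<alpha> \<beta> i] that by (cases "i = l") (auto simp: S'_def)
  then have "(\<Sum>\<alpha>\<in>S'. ?R \<alpha>) \<notin> p (Suc l)"
    using S'_finite step.prems(3,4) by (intro step.IH) auto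
  then have "q \<notin> p (Suc l)" using is_ideal_diff[OF ideal_Suc _ q_cofactor(2), of q] by auto
  then have "q \<notin> p l" using p_chain(2)[OF l_less] by blast
  moreover have "a l ^ t \<notin> p l" using prime_ideal_power[OF prime] a_in[OF l_less] by simp
  ultimately have "a l ^ t * q \<notin> p l" using is_prime_idealD(3)[OF prime] by blast
  moreover have "(\<Sum>\<alpha>\<in>S. c \<alpha> * (\<Prod>i\<in>{l..<N}. a i ^ \<alpha> i)) = (\<Sum>\<alpha>\<in>S. ?R \<alpha> * a l ^ \<alpha> l)"
    using l_less by (intro sum.cong) (simp_all add: prod.atLeast_Suc_lessThan mult_ac)
  ultimately show ?case using q_cofactor(1) by simp
qed

definition exponent_box :: "'v set \<Rightarrow> nat \<Rightarrow> ('v \<Rightarrow>\<^sub>0 nat) set" where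
  "exponent_box F L = {m. keys m \<subseteq> F \<and> (\<forall>v. lookup m v \<le> L)}"

lemma exponent_box_mono: "L \<le> M \<Longrightarrow> exponent_box F L \<subseteq> exponent_box F M"
  by (auto simp: exponent_box_def intro: order_trans)

lemma exponent_box_finite_card:
  fixes F :: "'v set"
  assumes "finite F"
  shows "finite (exponent_box F L)" "card (exponent_box F L) \<le> Suc L ^ card F"
proof -
  let ?f = "\<lambda>m :: 'v \<Rightarrow>\<^sub>0 nat. restrict (lookup m) F"
  have inj: "inj_on ?f (exponent_box F L)"
  proof (intro inj_onI poly_mapping_eqI)
    fix m m' v assume box: "m \<in> exponent_box F L" "m' \<in> exponent_box F L" and same_image: "?f m = ?f m'"
    show "lookup m v = lookup m' v"
    proof (cases "v \<in> F")
      case True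
      then show ?thesis using fun_cong[OF same_image, of v] by simp
    next
      case False
      then have "v \<notin> keys m" "v \<notin> keys m'" using box by (auto simp: exponent_box_def)
      then show ?thesis by (simp add: in_keys_iff)
    qed
  qed
  have sub: "?f ` exponent_box F L \<subseteq> PiE F (\<lambda>_. {..L})" by (auto simp: exponent_box_def)
  have fin: "finite (PiE F (\<lambda>_. {..L}))" using assms by (intro finite_PiE) auto
  show "finite (exponent_box F L)" using inj finite_subset[OF sub fin] by (rule finite_imageD[rotated])
  show "card (exponent_box F L) \<le> Suc L ^ card F"
    using card_inj_on_le[OF inj sub fin] assms by (simp add: card_PiE)
qed

lemma keys_mult_exponent_box:
  fixes q r :: "('v, 'k::field) mpoly"
  assumes "keys q \<subseteq> exponent_box F L" "keys r \<subseteq> exponent_box F M"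
  shows "keys (q * r) \<subseteq> exponent_box F (L + M)"
proof
  fix m assume "m \<in> keys (q * r)"
  then obtain a b where "m = a + b" "a \<in> keys q" "b \<in> keys r" using keys_mult[of q r] by auto
  moreover from this have "a \<in> exponent_box F L" "b \<in> exponent_box F M" using assms by auto
  ultimately show "m \<in> exponent_box F (L + M)"
    by (auto simp: exponent_box_def keys_add_nat lookup_add intro: add_mono)
qed

lemma keys_one_exponent_box: "keys (1 :: ('v, 'k::field) mpoly) \<subseteq> exponent_box F 0"
  by (simp add: exponent_box_def)

lemma keys_power_exponent_box:
  fixes q :: "('v, 'k::field) mpoly"
  shows "keys q \<subseteq> exponent_box F L \<Longrightarrow> keys (q ^ t) \<subseteq> exponent_box F (t * L)"
  by (induction t) (simp_all add: keys_one_exponent_box keys_mult_exponent_box del: keys_one)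

lemma keys_prod_exponent_box:
  fixes q :: "'i \<Rightarrow> ('v, 'k::field) mpoly"
  shows "(\<And>i. i \<in> A \<Longrightarrow> keys (q i) \<subseteq> exponent_box F (L i)) \<Longrightarrow> keys (prod q A) \<subseteq> exponent_box F (sum L A)"
  by (induction A rule: infinite_finite_induct)
     (simp_all add: keys_one_exponent_box keys_mult_exponent_box del: keys_one)

lemma exists_exponent_box:
  fixes q :: "('v, 'k::field) mpoly"
  assumes "\<And>m. m \<in> keys q \<Longrightarrow> keys m \<subseteq> F"
  shows "\<exists>L. keys q \<subseteq> exponent_box F L"
proof -
  let ?L = "\<Sum>m\<in>keys q. \<Sum>v\<in>keys m. lookup m v"
  have "lookup m v \<le> ?L" if "m \<in> keys q" for m v
  proof (cases "v \<in> keys m")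
    case True
    then have "lookup m v \<le> (\<Sum>v\<in>keys m. lookup m v)" by (intro member_le_sum) auto
    also have "\<dots> \<le> ?L" using that by (intro member_le_sum) auto
    finally show ?thesis .
  qed (simp add: in_keys_iff)
  then have "keys q \<subseteq> exponent_box F ?L" using assms by (auto simp: exponent_box_def)
  then show ?thesis by blast
qed

lemma exists_power_gt: "\<exists>M. Suc (M * D) ^ k < M ^ Suc k" for D k :: nat
proof
  define M where "M = Suc (Suc D ^ k)"
  have "Suc (M * D) ^ k \<le> (M * Suc D) ^ k" by (rule power_mono) (simp_all add: M_def)
  also have "\<dots> = M ^ k * Suc D ^ k" by (rule power_mult_distrib)
  also have "\<dots> < M ^ k * M" by (rule mult_strict_left_mono) (simp_all add: M_def)
  finally show "Suc (M * D) ^ k < M ^ Suc k" by (simp add: mult.commute)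
qed

text \<open>There are \<open>M ^ N\<close> power products with exponents below \<open>M\<close> of \<open>N\<close> polynomials, but their own monomials
  lie in a box of size of order \<open>M ^ card F\<close>.\<close>

lemma algebraic_dependence:
  fixes f :: "nat \<Rightarrow> ('v, 'k::field) mpoly"
  assumes F_small: "finite F" "card F < N" and f_supported: "\<And>i m. i < N \<Longrightarrow> m \<in> keys (f i) \<Longrightarrow> keys m \<subseteq> F"
  obtains S c where "finite S" "S \<noteq> {}" "S \<subseteq> extensional {..<N}" "\<And>\<alpha>. \<alpha> \<in> S \<Longrightarrow> c \<alpha> \<noteq> (0::'k)"
    "(\<Sum>\<alpha>\<in>S. Poly_Mapping.single 0 (c \<alpha>) * (\<Prod>i<N. f i ^ \<alpha> i)) = 0"
proof -
  have "\<exists>L. keys (f i) \<subseteq> exponent_box F L" if "i < N" for i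
    using f_supported[OF that] by (rule exists_exponent_box)
  then obtain d where d_bound: "\<And>i. i < N \<Longrightarrow> keys (f i) \<subseteq> exponent_box F (d i)" by metis
  obtain M where M_large: "Suc (M * (\<Sum>i<N. d i)) ^ card F < M ^ Suc (card F)" using exists_power_gt by blast
  then have "0 < M" by (cases M) auto
  then have M_power_le: "M ^ Suc (card F) \<le> M ^ N" using F_small(2) by (intro power_increasing) auto
  let ?A = "PiE {..<N} (\<lambda>_. {..<M})"
  let ?u = "\<lambda>\<alpha>. \<Prod>i<N. f i ^ \<alpha> i"
  let ?B = "exponent_box F (M * (\<Sum>i<N. d i))"
  have span: "?u \<alpha> \<in> pm.span (basis_vector ` ?B)" if \<alpha>_in: "\<alpha> \<in> ?A" for \<alpha>
  proof (rule in_span_basis_vector, rule order_trans)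
    show "keys (?u \<alpha>) \<subseteq> exponent_box F (\<Sum>i<N. \<alpha> i * d i)"
      using d_bound by (intro keys_prod_exponent_box keys_power_exponent_box) auto
    show "exponent_box F (\<Sum>i<N. \<alpha> i * d i) \<subseteq> ?B"
      unfolding sum_distrib_left
      using \<alpha>_in by (intro exponent_box_mono sum_mono mult_right_mono) (auto simp: PiE_iff less_imp_le)
  qed
  have finite_A: "finite ?A" by (intro finite_PiE) auto
  note finite_B = exponent_box_finite_card(1)[OF F_small(1)]
  have "card (basis_vector ` ?B :: ('v, 'k) mpoly set) \<le> card ?B" by (rule card_image_le[OF finite_B])
  also have "\<dots> \<le> Suc (M * (\<Sum>i<N. d i)) ^ card F" by (rule exponent_box_finite_card(2)[OF F_small(1)])
  also note M_large
  also note M_power_le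
  also have "M ^ N = card ?A" by (simp add: card_PiE)
  finally have "card (basis_vector ` ?B :: ('v, 'k) mpoly set) < card ?A" .
  from pm.family_dependent[OF finite_A finite_imageI[OF finite_B] span this] obtain c \<beta>
    where c_relation: "\<beta> \<in> ?A" "c \<beta> \<noteq> 0" "(\<Sum>\<alpha>\<in>?A. pm_scale (c \<alpha>) (?u \<alpha>)) = 0" .
  let ?S = "{\<alpha> \<in> ?A. c \<alpha> \<noteq> 0}"
  show ?thesis
  proof (rule that)
    show "finite ?S" by (rule finite_subset[OF _ finite_A]) blast
    show "?S \<noteq> {}" using c_relation(1,2) by blast
    show "?S \<subseteq> extensional {..<N}" by (auto simp: PiE_iff)
    have "(\<Sum>\<alpha>\<in>?S. pm_scale (c \<alpha>) (?u \<alpha>)) = (\<Sum>\<alpha>\<in>?A. pm_scale (c \<alpha>) (?u \<alpha>))"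
      using finite_A by (intro sum.mono_neutral_left) auto
    then show "(\<Sum>\<alpha>\<in>?S. Poly_Mapping.single 0 (c \<alpha>) * ?u \<alpha>) = 0"
      using c_relation(3) by (simp only: pm_scale_mpoly)
  qed simp
qed

definition restrict_vars :: "'v set \<Rightarrow> ('v, 'k::field) mpoly \<Rightarrow> ('v, 'k) mpoly" where
  "restrict_vars F q = (\<Sum>m | m \<in> keys q \<and> keys m \<subseteq> F. Poly_Mapping.single m (lookup q m))"

lemma keys_restrict_vars: "m \<in> keys (restrict_vars F q) \<Longrightarrow> keys m \<subseteq> F"
  using keys_sum[of "\<lambda>m. Poly_Mapping.single m (lookup q m)"] unfolding restrict_vars_def
  by (fastforce split: if_splits)

lemma restrict_vars_cong:
  fixes q :: "('v, 'k::field) mpoly"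
  assumes p_ideal: "is_ideal p" "\<And>v. v \<notin> F \<Longrightarrow> pvar v \<in> p"
  shows "q - restrict_vars F q \<in> p"
proof -
  let ?rest = "\<Sum>m | m \<in> keys q \<and> \<not> keys m \<subseteq> F. Poly_Mapping.single m (lookup q m)"
  have "q = (\<Sum>m\<in>keys q. Poly_Mapping.single m (lookup q m))"
    by (rule poly_mapping_eq_sum_single)
  also have "\<dots> = restrict_vars F q + ?rest"
    unfolding restrict_vars_def by (subst sum.union_disjoint[symmetric]) (auto intro: sum.cong)
  finally have "q - restrict_vars F q = ?rest"
    unfolding diff_eq_eq by (subst add.commute)
  also have "\<dots> \<in> p"
  proof (rule is_ideal_sum[OF p_ideal(1)])
    fix m assume "m \<in> {m. m \<in> keys q \<and> \<not> keys m \<subseteq> F}"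
    then obtain v where v_in: "v \<in> keys m" "v \<notin> F" by blast
    have "Poly_Mapping.single m (lookup q m) = pvar v * Poly_Mapping.single (m - unit_exp v) (lookup q m)"
      by (simp add: pvar_eq_single mult_single unit_exp_plus_minus[OF v_in(1)])
    then show "Poly_Mapping.single m (lookup q m) \<in> p"
      using is_ideal_mult_right[OF p_ideal(1) p_ideal(2)[OF v_in(2)]] by metis
  qed
  finally show ?thesis .
qed

lemma prime_over_SR_ideal_face:
  fixes p :: "('v, 'k::field) mpoly set"
  assumes p_prime: "is_prime_ideal p" "SR_ideal \<Delta> \<subseteq> p" and V_vertices: "finite V" "\<And>G. G \<in> \<Delta> \<Longrightarrow> G \<subseteq> V"
  shows "{v. pvar v \<notin> p} \<in> \<Delta>"
proof -
  let ?F = "{v. pvar v \<notin> p}"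
  have nonface: "(\<Prod>v\<in>G. pvar v) \<in> p" if "finite G" "G \<notin> \<Delta>" for G
    using prod_pvar_in_SR_ideal[OF that] p_prime(2) by blast
  have "v \<in> V" if "v \<in> ?F" for v
    using nonface[of "{v}"] V_vertices(2)[of "{v}"] that by auto
  then have "finite ?F" using finite_subset[OF _ V_vertices(1)] by blast
  moreover have "(\<Prod>v\<in>G. pvar v) \<notin> p" if "finite G" "G \<subseteq> ?F" for G
    using that
    by (induction G rule: finite_induct)
       (auto dest: is_prime_idealD(3)[OF p_prime(1)] simp: is_prime_idealD(2)[OF p_prime(1)])
  ultimately show ?thesis using nonface by blast
qed

lemma ideal_cong_mult:
  assumes J_ideal: "is_ideal J" and "x - y \<in> J" "x' - y' \<in> J"
  shows "x * x' - y * y' \<in> J"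
proof -
  have "(x - y) * x' + y * (x' - y') \<in> J"
    using assms by (intro is_ideal_add[OF J_ideal]) (auto intro: is_ideal_mult_left is_ideal_mult_right)
  then show ?thesis by (simp add: algebra_simps)
qed

lemma ideal_cong_power: "is_ideal J \<Longrightarrow> x - y \<in> J \<Longrightarrow> x ^ t - y ^ t \<in> J"
  by (induction t) (auto intro: ideal_cong_mult is_ideal_0)

lemma ideal_cong_prod:
  "is_ideal J \<Longrightarrow> (\<And>i. i \<in> A \<Longrightarrow> f i - g i \<in> J) \<Longrightarrow> prod f A - prod g A \<in> J"
  by (induction A rule: infinite_finite_induct) (auto intro: ideal_cong_mult is_ideal_0)

theorem krull_dim_quot_SR_ideal_le:
  fixes \<Delta> :: "'v set set"
  assumes V_vertices: "finite V" "\<And>G. G \<in> \<Delta> \<Longrightarrow> G \<subseteq> V" and card: "\<And>G. G \<in> \<Delta> \<Longrightarrow> card G \<le> n"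
  shows "krull_dim_quot (SR_ideal \<Delta> :: ('v, 'k::field) mpoly set) \<le> enat n"
  unfolding krull_dim_quot_def
proof (rule Sup_least, clarify, rule ccontr)
  fix N and p :: "nat \<Rightarrow> ('v, 'k) mpoly set"
  assume prime: "\<forall>i\<le>N. is_prime_ideal (p i) \<and> SR_ideal \<Delta> \<subseteq> p i" and chain: "\<forall>i<N. p i \<subset> p (Suc i)"
    and "\<not> enat N \<le> enat n"
  then have "n < N" by simp
  have p_prime: "is_prime_ideal (p i)" "is_ideal (p i)" if "i \<le> N" for i
    using prime that by (auto dest: is_prime_idealD)
  define F where "F = {v. pvar v \<notin> p 0}"
  have "F \<in> \<Delta>" unfolding F_def using prime by (intro prime_over_SR_ideal_face[OF _ _ V_vertices]) auto
  then have F_small: "finite F" "card F < N" using finite_subset[OF V_vertices(2) V_vertices(1)] card \<open>n < N\<close>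
    by (auto intro: le_less_trans)
  have "\<exists>a. \<forall>i<N. a i \<in> p (Suc i) - p i" using chain by (intro choice allI) blast
  then obtain a where a_in: "\<And>i. i < N \<Longrightarrow> a i \<in> p (Suc i) - p i" by blast
  obtain S and c :: "(nat \<Rightarrow> nat) \<Rightarrow> 'k" where S_finite: "finite S" "S \<noteq> {}" "S \<subseteq> extensional {..<N}"
    "\<And>\<alpha>. \<alpha> \<in> S \<Longrightarrow> c \<alpha> \<noteq> 0"
    and dep: "(\<Sum>\<alpha>\<in>S. Poly_Mapping.single 0 (c \<alpha>) * (\<Prod>i<N. restrict_vars F (a i) ^ \<alpha> i)) = 0"
    by (rule algebraic_dependence[OF F_small, of "\<lambda>i. restrict_vars F (a i)"])
       (blast dest: keys_restrict_vars)+
  let ?c = "\<lambda>\<alpha>. Poly_Mapping.single 0 (c \<alpha>) :: ('v, 'k) mpoly"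
  have "a i - restrict_vars F (a i) \<in> p 0" for i
    by (rule restrict_vars_cong[OF p_prime(2)]) (auto simp: F_def)
  then have "(\<Sum>\<alpha>\<in>S. ?c \<alpha> * (\<Prod>i<N. a i ^ \<alpha> i)) - (\<Sum>\<alpha>\<in>S. ?c \<alpha> * (\<Prod>i<N. restrict_vars F (a i) ^ \<alpha> i)) \<in> p 0"
    unfolding sum_subtractf[symmetric] right_diff_distrib[symmetric]
    by (intro is_ideal_sum is_ideal_mult_left ideal_cong_prod ideal_cong_power p_prime(2)) auto
  then have "(\<Sum>\<alpha>\<in>S. ?c \<alpha> * (\<Prod>i\<in>{0..<N}. a i ^ \<alpha> i)) \<in> p 0"
    using dep by (simp add: lessThan_atLeast0)
  moreover have "?c \<alpha> \<notin> p N" if "\<alpha> \<in> S" for \<alpha>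
  proof
    assume "?c \<alpha> \<in> p N"
    then have "?c \<alpha> * Poly_Mapping.single 0 (inverse (c \<alpha>)) \<in> p N"
      by (intro is_ideal_mult_right p_prime(2)) auto
    then show False using S_finite(4)[OF that] is_prime_idealD(2)[OF p_prime(1)[of N]]
      by (simp add: mult_single)
  qed
  then have "(\<Sum>\<alpha>\<in>S. ?c \<alpha> * (\<Prod>i\<in>{0..<N}. a i ^ \<alpha> i)) \<notin> p 0"
    using p_prime(1) chain a_in S_finite
    by (intro prime_chain_algebraically_independent[where p = p and N = N]) blast+
  ultimately show False by simp
qed

lemma SR_ideal_antimono: "\<Gamma> \<subseteq> \<Delta> \<Longrightarrow> SR_ideal \<Delta> \<subseteq> SR_ideal \<Gamma>"
  unfolding SR_ideal_def by (intro gen_ideal_mono) blast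

text \<open>The quotient by the ideal of a full simplex is a polynomial ring; its variables form a regular
  sequence, which bounds the dimension from below.\<close>

theorem krull_dim_quot_ge_card_face:
  fixes \<Delta> :: "'v set set"
  assumes \<Delta>_simplicial: "simplicial \<Delta>" and F_in: "F \<in> \<Delta>" "finite F"
  shows "enat (card F) \<le> krull_dim_quot (SR_ideal \<Delta> :: ('v, 'k::field) mpoly set)"
proof -
  obtain \<rho> :: "'v \<Rightarrow> nat" and k where \<rho>_bij: "\<rho> ` F = {i. i < k}" "inj_on \<rho> F"
    using finite_imp_inj_to_nat_seg[OF F_in(2)] by auto
  then have "k = card F" using card_image[OF \<rho>_bij(2)] by simp
  then interpret simplex: coloured_complex "Pow F" F \<rho> "card F"
    using F_in(2) \<rho>_bij by unfold_locales (auto simp: simplicial_def intro: inj_on_subset)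
  have "exact_at TYPE('k) \<rho> (star (Pow F) A) i" if "A \<in> Pow F" "i < card F" for A i
  proof (cases "A = F")
    case True
    then show ?thesis using that(2) by (intro exact_at_trivial) (auto simp: star_def)
  next
    case False
    then have "A \<subset> F" using that(1) by blast
    then obtain u where u_in: "u \<in> F" "u \<notin> A" by blast
    show ?thesis
      by (rule exact_at_cone[where u = u, OF orients_subset[OF simplex.orients_colour]])
        (use u_in in \<open>auto simp: star_def\<close>)
  qed
  then have "reisner TYPE('k) \<rho> (Pow F) (card F)" by (simp add: reisner_def)
  then have "enat (card F) \<le> depth_quot (SR_ideal (Pow F) :: ('v, 'k) mpoly set) var_ideal"
    by (rule simplex.depth_ge_colours)
  also have "\<dots> \<le> krull_dim_quot (SR_ideal (Pow F) :: ('v, 'k) mpoly set)"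
    by (rule depth_quot_le_krull_dim_quot)
  also have "\<dots> \<le> krull_dim_quot (SR_ideal \<Delta> :: ('v, 'k) mpoly set)"
    using simplicialD[OF \<Delta>_simplicial F_in(1)] by (intro krull_dim_quot_antimono SR_ideal_antimono) blast
  finally show ?thesis .
qed

section \<open>Reisner's criterion for coloured complexes\<close>

theorem reisner_of_cohen_macaulay:
  fixes \<Delta> :: "'v set set"
  assumes CM: "SR_cohen_macaulay TYPE('k::field) \<Delta>"
    and V_vertices: "finite V" "\<And>G. G \<in> \<Delta> \<Longrightarrow> G \<subseteq> V" and \<Delta>_complex: "simplicial \<Delta>" "orients \<nu> \<Delta>"
    and K_in: "K \<in> \<Delta>"
  shows "reisner TYPE('k) \<nu> \<Delta> (card K)"
proof (cases "card K")
  case 0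
  then show ?thesis by (simp add: reisner_def)
next
  case (Suc k)
  have "enat (card K) \<le> krull_dim_quot (SR_ideal \<Delta> :: ('v, 'k) mpoly set)"
    using K_in orientsD(1)[OF \<Delta>_complex(2) K_in] by (rule krull_dim_quot_ge_card_face[OF \<Delta>_complex(1)])
  then have "enat (Suc k) \<le> depth_quot (SR_ideal \<Delta> :: ('v, 'k) mpoly set) var_ideal"
    using CM Suc by (simp add: SR_cohen_macaulay_def)
  then obtain f where "regular_seq_quot (SR_ideal \<Delta> :: ('v, 'k) mpoly set) var_ideal (Suc k) f"
    by (rule regular_seq_quot_of_depth)
  then show ?thesis unfolding Suc using V_vertices \<Delta>_complex by (intro reisner_of_regular_seq)
qed

theorem (in coloured_complex) cohen_macaulay_of_reisner:
  assumes "reisner TYPE('k::field) \<rho> \<Gamma> n"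
  shows "SR_cohen_macaulay TYPE('k) \<Gamma>"
proof -
  let ?I = "SR_ideal \<Gamma> :: ('v, 'k) mpoly set"
  have "krull_dim_quot ?I \<le> enat n"
    by (rule krull_dim_quot_SR_ideal_le[OF finite_vertices face_subset card_face_le])
  also have "\<dots> \<le> depth_quot ?I var_ideal" by (rule depth_ge_colours[OF assms])
  finally show ?thesis
    unfolding SR_cohen_macaulay_def using depth_quot_le_krull_dim_quot by (intro antisym)
qed

section \<open>Vanishing Euler characteristic\<close>

lemma (in vector_space) span_disjoint_Int_independent:
  assumes "independent (B \<union> D)" "B \<inter> D = {}" "x \<in> span B" "x \<in> span D"
  shows "x = 0"
proof -
  let ?r = "representation (B \<union> D) x"
  have "?r = representation B x" "?r = representation D x"
    by (rule representation_extend[OF assms(1)]; use assms in simp)+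
  then have zero: "?r v = 0" for v
    using representation_ne_zero[of B x v] representation_ne_zero[of D x v] assms(2) by auto
  have "x \<in> span (B \<union> D)" using assms(3) span_mono[of B "B \<union> D"] by auto
  from sum_nonzero_representation_eq[OF assms(1) this] show ?thesis by (simp add: zero)
qed

lemma (in Vector_Spaces.linear) dim_eq_dim_kernel_plus_dim_image:
  assumes S_subspace: "vs1.subspace S" "S \<subseteq> vs1.span T" "finite T"
  shows "vs1.dim S = vs1.dim {x \<in> S. f x = 0} + vs2.dim (f ` S)"
proof -
  let ?K = "{x \<in> S. f x = 0}"
  obtain B where B_basis: "B \<subseteq> ?K" "vs1.independent B" "?K \<subseteq> vs1.span B"
    using vs1.maximal_independent_subset[of ?K] by blast
  obtain C where C_basis: "B \<subseteq> C" "C \<subseteq> S" "vs1.independent C" "S \<subseteq> vs1.span C"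
    using vs1.maximal_independent_subset_extend[of B S] B_basis by blast
  let ?D = "C - B"
  have finC: "finite C" using vs1.independent_span_bound[OF S_subspace(3) C_basis(3)] C_basis(2) S_subspace(2)
    by blast
  have span_D: "vs1.span ?D \<subseteq> S" using C_basis(2) by (intro vs1.span_minimal[OF _ S_subspace(1)]) auto
  have inj: "inj_on f (vs1.span ?D)"
    unfolding inj_on_iff_eq_0[OF vs1.subspace_span]
  proof (intro ballI impI)
    fix x assume x_kernel: "x \<in> vs1.span ?D" "f x = 0"
    then have "x \<in> vs1.span B" using span_D B_basis(3) by blast
    then show "x = 0"
      using x_kernel(1) C_basis(1,3)
      by (intro vs1.span_disjoint_Int_independent[of B ?D]) (auto simp: Un_absorb1)
  qed
  have "f ` C \<subseteq> vs2.span (f ` ?D)"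
    using B_basis(1) vs2.span_zero vs2.span_base[of _ "f ` ?D"] by (force simp: image_subset_iff)
  then have "vs2.span (f ` C) \<subseteq> vs2.span (f ` ?D)" by (rule vs2.span_minimal[OF _ vs2.subspace_span])
  then have "f ` S \<subseteq> vs2.span (f ` ?D)" using image_mono[OF C_basis(4), of f] by (simp add: span_image)
  moreover have "vs2.independent (f ` ?D)"
    by (rule independent_injective_image[OF vs1.independent_mono[OF C_basis(3) Diff_subset] inj])
  ultimately have "vs2.dim (f ` S) = card (f ` ?D)"
    using C_basis(2) by (intro vs2.basis_card_eq_dim[symmetric]) auto
  also have "\<dots> = card ?D" using inj vs1.span_superset by (intro card_image) (rule inj_on_subset)
  finally have "vs2.dim (f ` S) = card C - card B" using C_basis(1) finC
    by (simp add: card_Diff_subset finite_subset)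
  moreover have "card B \<le> card C" using C_basis(1) finC by (rule card_mono[rotated])
  ultimately show ?thesis
    using vs1.basis_card_eq_dim[OF B_basis(1,3,2)] vs1.basis_card_eq_dim[OF C_basis(2,4,3)] by simp
qed

lemma (in vector_space) subspace_eq_of_dim_eq:
  assumes A_subspace: "subspace A" "A \<subseteq> S" and S_span: "S \<subseteq> span T" "finite T" and dim: "dim A = dim S"
  shows "A = S"
proof -
  obtain B where B_basis: "B \<subseteq> A" "independent B" "A \<subseteq> span B"
    using maximal_independent_subset[of A] by blast
  obtain C where C_basis: "B \<subseteq> C" "C \<subseteq> S" "independent C" "S \<subseteq> span C"
    using maximal_independent_subset_extend[of B S] B_basis A_subspace(2) by blast
  have "finite C" using independent_span_bound[OF S_span(2) C_basis(3)] C_basis(2) S_span(1) by blast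
  moreover have "card B = card C"
    using basis_card_eq_dim[OF B_basis(1,3,2)] basis_card_eq_dim[OF C_basis(2,4,3)] dim by simp
  ultimately have "B = C" using C_basis(1) by (metis card_subset_eq)
  then show ?thesis using C_basis(4) A_subspace(2) span_minimal[OF B_basis(1) A_subspace(1)] by blast
qed

lemma (in vector_space) exact_of_dim_eq:
  assumes f_linear: "Vector_Spaces.linear scale scale f"
    and P_subspace: "subspace P" "P \<subseteq> span T" and Q_subspace: "subspace Q" "Q \<subseteq> span T"
    and T_finite: "finite T"
    and complex: "f ` Q \<subseteq> P" "\<And>x. x \<in> Q \<Longrightarrow> f (f x) = 0"
    and exact: "{x \<in> Q. f x = 0} = f ` P" and dim: "dim P = dim Q"
  shows "{x \<in> P. f x = 0} = f ` Q"
proof -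
  interpret f: Vector_Spaces.linear scale scale f by (rule f_linear)
  have "dim {x \<in> P. f x = 0} = dim (f ` Q)"
    using f.dim_eq_dim_kernel_plus_dim_image[OF P_subspace T_finite]
      f.dim_eq_dim_kernel_plus_dim_image[OF Q_subspace T_finite] exact dim
    by simp
  moreover have "f ` Q \<subseteq> {x \<in> P. f x = 0}" using complex by blast
  moreover have "{x \<in> P. f x = 0} \<subseteq> span T" using P_subspace(2) by blast
  ultimately show ?thesis
    using subspace_eq_of_dim_eq[OF f.subspace_image[OF Q_subspace(1)] _ _ T_finite, of "{x \<in> P. f x = 0}"]
    by simp
qed

definition supported_on :: "'b set \<Rightarrow> ('b \<Rightarrow>\<^sub>0 'k::field) set" where
  "supported_on Y = {p. keys p \<subseteq> Y}"

lemma supported_on_iff: "p \<in> supported_on Y \<longleftrightarrow> (\<forall>G. G \<notin> Y \<longrightarrow> lookup p G = 0)"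
  by (auto simp: supported_on_def in_keys_iff)

lemma subspace_supported_on: "pm.subspace (supported_on Y)"
  by (auto simp: pm.subspace_def supported_on_iff lookup_add)

lemma supported_on_le_span: "supported_on Y \<subseteq> pm.span (basis_vector ` Y)"
  using in_span_basis_vector by (auto simp: supported_on_def)

lemma lookup_sum_basis_vector:
  "finite Y \<Longrightarrow> lookup (\<Sum>G\<in>Y. pm_scale (a G) (basis_vector G)) H = (if H \<in> Y then a H else 0)"
  by (simp add: lookup_sum basis_vector_def lookup_single when_def if_distrib cong: if_cong)

lemma dim_supported_on:
  assumes "finite Y"
  shows "pm.dim (supported_on Y :: ('b \<Rightarrow>\<^sub>0 'k::field) set) = card Y"
proof -
  have inj: "inj_on (basis_vector :: 'b \<Rightarrow> 'b \<Rightarrow>\<^sub>0 'k) Y"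
    by (auto simp: inj_on_def basis_vector_def dest: arg_cong[where f = keys])
  have "pm.independent (basis_vector ` Y :: ('b \<Rightarrow>\<^sub>0 'k) set)"
  proof (rule pm.independent_if_scalars_zero)
    fix a :: "('b \<Rightarrow>\<^sub>0 'k) \<Rightarrow> 'k" and x :: "'b \<Rightarrow>\<^sub>0 'k"
    assume zero: "(\<Sum>x\<in>basis_vector ` Y. pm_scale (a x) x) = 0" and "x \<in> basis_vector ` Y"
    then obtain H where H_in: "H \<in> Y" "x = basis_vector H" by blast
    have "a x = lookup (\<Sum>G\<in>Y. pm_scale (a (basis_vector G)) (basis_vector G)) H"
      using assms H_in by (simp add: lookup_sum_basis_vector)
    also have "\<dots> = 0" using zero by (simp add: sum.reindex[OF inj])
    finally show "a x = 0" .
  qed (use assms in simp)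
  moreover have "basis_vector ` Y \<subseteq> (supported_on Y :: ('b \<Rightarrow>\<^sub>0 'k) set)"
    by (auto simp: supported_on_def basis_vector_def)
  ultimately show ?thesis
    using pm.basis_card_eq_dim[OF _ supported_on_le_span] card_image[OF inj] by metis
qed

context
  fixes \<nu> :: "'v \<Rightarrow> nat" and X :: "'v set set"
  assumes orients: "orients \<nu> X" and conv: "convex_family X" and fin: "finite X"
begin

lemma lookup_pm_scale_fun: "lookup (pm_scale c p) = (\<lambda>m. c * lookup p m)"
  by (simp add: fun_eq_iff)

definition total_coboundary :: "('v set \<Rightarrow>\<^sub>0 'k::field) \<Rightarrow> 'v set \<Rightarrow>\<^sub>0 'k" where
  "total_coboundary p = (\<Sum>G\<in>X. Poly_Mapping.single G (coboundary \<nu> X (lookup p) G))"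

lemma lookup_total_coboundary:
  "lookup (total_coboundary p) G = (if G \<in> X then coboundary \<nu> X (lookup p) G else 0)"
  using fin by (simp add: total_coboundary_def lookup_sum lookup_single when_def)

lemma linear_total_coboundary: "Vector_Spaces.linear pm_scale pm_scale total_coboundary"
  unfolding Vector_Spaces.linear_iff
  by (intro conjI allI pm.vector_space_axioms poly_mapping_eqI)
     (simp_all add: lookup_total_coboundary plus_poly_mapping.rep_eq lookup_pm_scale_fun
       weighted_coboundary_add weighted_coboundary_scale)

lemma total_coboundary_twice: "total_coboundary (total_coboundary p) = 0"
proof (rule poly_mapping_eqI)
  fix G
  have "coboundary \<nu> X (lookup (total_coboundary p)) G = coboundary \<nu> X (coboundary \<nu> X (lookup p)) G"
    by (rule weighted_coboundary_cong) (simp add: lookup_total_coboundary removable_def)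
  then show "lookup (total_coboundary (total_coboundary p)) G = lookup 0 G"
    using weighted_coboundary_coboundary[OF orients conv, of G "\<lambda>_. 1" "lookup p"]
    by (simp add: lookup_total_coboundary)
qed

definition parity_part :: "bool \<Rightarrow> 'v set set" where
  "parity_part e = {G \<in> X. even (card G) = e}"

lemma total_coboundary_parity:
  assumes "p \<in> supported_on (parity_part e)"
  shows "total_coboundary p \<in> supported_on (parity_part (\<not> e))"
  unfolding supported_on_iff
proof (intro allI impI)
  fix G assume G_notin: "G \<notin> parity_part (\<not> e)"
  show "lookup (total_coboundary p) G = 0"
  proof (cases "G \<in> X")
    case True
    then have parity: "even (card G) = e" "finite G" using G_notin orientsD(1)[OF orients]
      by (auto simp: parity_part_def)
    have "lookup p (G - {v}) = 0" if "v \<in> removable X G" for v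
    proof -
      have "card G = Suc (card (G - {v}))" using parity(2) that by (rule card_removable)
      then have "G - {v} \<notin> parity_part e" using parity(1) by (auto simp: parity_part_def)
      then show ?thesis using assms by (simp add: supported_on_iff)
    qed
    then show ?thesis using True by (simp add: lookup_total_coboundary weighted_coboundary_eq_0)
  qed (simp add: lookup_total_coboundary)
qed

lemma total_coboundary_surj_of_exact:
  fixes p :: "'v set \<Rightarrow>\<^sub>0 'k::field"
  assumes exact: "\<And>G. G \<in> parity_part e \<Longrightarrow> exact_at TYPE('k) \<nu> X (card G)"
    and p_kernel: "p \<in> supported_on (parity_part e)" "total_coboundary p = 0"
  shows "p \<in> total_coboundary ` supported_on (parity_part (\<not> e))"
proof -
  have cocycle: "cocycle \<nu> X i (lookup p)" for i
    unfolding cocycle_def using lookup_total_coboundary[of p] p_kernel(2) by (metis lookup_zero)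
  have "\<forall>i\<in>card ` parity_part e. \<exists>b. \<forall>G\<in>X. card G = i \<longrightarrow> lookup p G = coboundary \<nu> X b G"
  proof
    fix i assume "i \<in> card ` parity_part e"
    then have "exact_at TYPE('k) \<nu> X i" using exact by blast
    then show "\<exists>b. \<forall>G\<in>X. card G = i \<longrightarrow> lookup p G = coboundary \<nu> X b G"
      using cocycle[of i] by (simp add: exact_at_def)
  qed
  from bchoice[OF this] obtain b where
    "\<forall>i\<in>card ` parity_part e. \<forall>G\<in>X. card G = i \<longrightarrow> lookup p G = coboundary \<nu> X (b i) G" ..
  then have b_primitive: "lookup p G = coboundary \<nu> X (b (card G)) G" if "G \<in> parity_part e" for G
    using that by (simp add: parity_part_def)
  define q where "q = (\<Sum>H\<in>parity_part (\<not> e). Poly_Mapping.single H (b (Suc (card H)) H))"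
  have lookup_q: "lookup q H = (if H \<in> parity_part (\<not> e) then b (Suc (card H)) H else 0)" for H
    using fin by (simp add: q_def lookup_sum lookup_single when_def parity_part_def)
  then have q_supported: "q \<in> supported_on (parity_part (\<not> e))" by (simp add: supported_on_iff)
  have "total_coboundary q = p"
  proof (rule poly_mapping_eqI)
    fix G show "lookup (total_coboundary q) G = lookup p G"
    proof (cases "G \<in> parity_part e")
      case True
      then have G_in: "G \<in> X" "finite G" using orientsD(1)[OF orients] by (auto simp: parity_part_def)
      have "coboundary \<nu> X (lookup q) G = coboundary \<nu> X (b (card G)) G"
      proof (rule weighted_coboundary_cong)
        fix v assume v_in: "v \<in> removable X G"
        then have "card G = Suc (card (G - {v}))" by (rule card_removable[OF G_in(2)])
        moreover from this have "G - {v} \<in> parity_part (\<not> e)" using True v_in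
          by (auto simp: parity_part_def removable_def)
        ultimately show "lookup q (G - {v}) = b (card G) (G - {v})" by (simp add: lookup_q)
      qed
      then show ?thesis using b_primitive[OF True] G_in(1) by (simp add: lookup_total_coboundary)
    next
      case False
      then show ?thesis using total_coboundary_parity[OF q_supported] p_kernel(1)
        by (simp add: supported_on_iff)
    qed
  qed
  then show ?thesis using q_supported by blast
qed

lemma exact_at_of_total_coboundary_surj:
  assumes surj: "\<And>p :: 'v set \<Rightarrow>\<^sub>0 'k::field.
      p \<in> supported_on (parity_part (even i)) \<Longrightarrow> total_coboundary p = 0 \<Longrightarrow> p \<in> range total_coboundary"
  shows "exact_at TYPE('k) \<nu> X i"
proof (rule exact_atI)
  fix c :: "'v set \<Rightarrow> 'k"
  assume cocycle: "cocycle \<nu> X i c"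
  define p where "p = (\<Sum>G | G \<in> X \<and> card G = i. Poly_Mapping.single G (c G))"
  have lookup_p: "lookup p G = (if G \<in> X \<and> card G = i then c G else 0)" for G
    using fin by (simp add: p_def lookup_sum lookup_single when_def)
  have "coboundary \<nu> X (lookup p) G = 0" if G_in: "G \<in> X" for G
  proof (cases "card G = Suc i")
    case True
    then have "coboundary \<nu> X (lookup p) G = coboundary \<nu> X c G"
      using card_removable[OF orientsD(1)[OF orients G_in]]
      by (intro weighted_coboundary_cong) (auto simp: lookup_p removable_def)
    then show ?thesis using cocycleD[OF cocycle G_in True] by simp
  next
    case False
    then show ?thesis
      using card_removable[OF orientsD(1)[OF orients G_in], of _ X]
      by (intro weighted_coboundary_eq_0) (auto simp: lookup_p)
  qed
  then have "total_coboundary p = 0" by (intro poly_mapping_eqI) (simp add: lookup_total_coboundary)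
  moreover have "p \<in> supported_on (parity_part (even i))"
    by (simp add: supported_on_iff lookup_p parity_part_def)
  ultimately obtain q where q_preimage: "p = total_coboundary q" using surj by blast
  have "c G = coboundary \<nu> X (lookup q) G" if "G \<in> X" "card G = i" for G
    using lookup_p[of G] lookup_total_coboundary[of q G] that unfolding q_preimage by simp
  then show "\<exists>b. \<forall>G\<in>X. card G = i \<longrightarrow> c G = coboundary \<nu> X b G" by blast
qed

lemma card_parity_parts_eq:
  assumes "(\<Sum>G\<in>X. (-1) ^ card G) = (0::int)"
  shows "card (parity_part e) = card (parity_part (\<not> e))"
proof -
  have "(\<Sum>G\<in>X. (-1) ^ card G) = (\<Sum>G\<in>parity_part True. (-1) ^ card G) +
      (\<Sum>G\<in>parity_part False. (-1::int) ^ card G)"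
    using fin by (subst sum.union_disjoint[symmetric]) (auto simp: parity_part_def intro: sum.cong)
  also have "\<dots> = int (card (parity_part True)) - int (card (parity_part False))"
    by (simp add: parity_part_def)
  finally show ?thesis using assms by (cases e) simp_all
qed

text \<open>The even and the odd cochains have the same dimension, so exactness of the total complex in one parity
  implies exactness in the other.\<close>

theorem exact_at_of_euler_char_zero:
  assumes exact: "\<And>i. i < d \<Longrightarrow> exact_at TYPE('k::field) \<nu> X i" and card_le: "\<And>G. G \<in> X \<Longrightarrow> card G \<le> d"
    and euler_char: "(\<Sum>G\<in>X. (-1) ^ card G) = (0::int)"
  shows "exact_at TYPE('k) \<nu> X i"
proof -
  let ?S = "\<lambda>e. supported_on (parity_part e) :: ('v set \<Rightarrow>\<^sub>0 'k) set"
  have span: "?S e \<subseteq> pm.span (basis_vector ` X)" for e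
    by (auto simp: supported_on_def parity_part_def intro!: in_span_basis_vector)
  have dim: "pm.dim (?S (even d)) = pm.dim (?S (odd d))"
    using card_parity_parts_eq[OF euler_char, of "even d"] fin by (simp add: dim_supported_on parity_part_def)
  have "card G < d" if "G \<in> parity_part (odd d)" for G
    using card_le[of G] that by (auto simp: parity_part_def le_less)
  then have "{p \<in> ?S (odd d). total_coboundary p = 0} \<subseteq> total_coboundary ` ?S (even d)"
    using exact total_coboundary_surj_of_exact[where ?'k = 'k, of "odd d"] unfolding not_not by blast
  then have exact_odd: "{p \<in> ?S (odd d). total_coboundary p = 0} = total_coboundary ` ?S (even d)"
    using total_coboundary_parity[of _ "even d"] total_coboundary_twice by auto
  have exact_even: "{p \<in> ?S (even d). total_coboundary p = 0} = total_coboundary ` ?S (odd d)"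
  proof (rule pm.exact_of_dim_eq[OF linear_total_coboundary subspace_supported_on span
        subspace_supported_on span])
    show "finite (basis_vector ` X :: ('v set \<Rightarrow>\<^sub>0 'k) set)" using fin by simp
    show "total_coboundary ` ?S (odd d) \<subseteq> ?S (even d)" using total_coboundary_parity[of _ "odd d"] by auto
  qed (rule total_coboundary_twice exact_odd dim)+
  consider (below) "i < d" | (top) "i = d" | (above) "d < i" by linarith
  then show ?thesis
  proof cases
    case below
    then show ?thesis by (rule exact)
  next
    case top
    then show ?thesis using exact_even by (intro exact_at_of_total_coboundary_surj) blast
  next
    case above
    then show ?thesis using card_le by (intro exact_at_trivial) fastforce
  qed
qed

end

section \<open>Order complexes\<close>

definition max_card :: "'a set set \<Rightarrow> nat" where
  "max_card X = Max (card ` X)"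

lemma card_le_max_card: "finite X \<Longrightarrow> G \<in> X \<Longrightarrow> card G \<le> max_card X"
  by (simp add: max_card_def)

lemma max_card_attained:
  assumes "finite X" "X \<noteq> {}"
  obtains G where "G \<in> X" "card G = max_card X"
proof -
  have "Max (card ` X) \<in> card ` X" using assms by (intro Max_in) auto
  then show ?thesis using that by (auto simp: max_card_def)
qed

lemma simplicial_order_complex: "simplicial (order_complex P le)"
  by (auto simp: simplicial_def order_complex_def intro: finite_subset)

locale finite_poset =
  fixes P :: "'a set" and le :: "'a \<Rightarrow> 'a \<Rightarrow> bool"
  assumes finite_P: "finite P" and partial_order: "partial_order_on' P le"
begin

abbreviation \<Delta> :: "'a set set" where "\<Delta> \<equiv> order_complex P le"

abbreviation chains_below :: "'a \<Rightarrow> 'a set set" where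
  "chains_below x \<equiv> order_complex (below P le x) le"

definition height :: nat where "height = max_card \<Delta>"

definition rk :: "'a \<Rightarrow> nat" where "rk x = max_card (chains_below x)"

lemma le_refl: "x \<in> P \<Longrightarrow> le x x"
  and le_antisym: "x \<in> P \<Longrightarrow> y \<in> P \<Longrightarrow> le x y \<Longrightarrow> le y x \<Longrightarrow> x = y"
  and le_trans: "x \<in> P \<Longrightarrow> y \<in> P \<Longrightarrow> z \<in> P \<Longrightarrow> le x y \<Longrightarrow> le y z \<Longrightarrow> le x z"
  using partial_order unfolding partial_order_on'_def by blast+

lemma chain_iff: "G \<in> \<Delta> \<longleftrightarrow> G \<subseteq> P \<and> (\<forall>x\<in>G. \<forall>y\<in>G. le x y \<or> le y x)"
  unfolding order_complex_def using finite_subset[OF _ finite_P] by blast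

lemma chainD:
  assumes "G \<in> \<Delta>"
  shows "G \<subseteq> P" "x \<in> G \<Longrightarrow> y \<in> G \<Longrightarrow> le x y \<or> le y x"
  using assms chain_iff by blast+

lemma finite_chains: "finite \<Delta>"
  using chainD(1) finite_P by (intro finite_subset[of \<Delta> "Pow P"]) auto

lemma chains_below_iff: "C \<in> chains_below x \<longleftrightarrow> C \<in> \<Delta> \<and> (\<forall>c\<in>C. strict le c x)"
  unfolding order_complex_def below_def by blast

lemma finite_chains_below: "finite (chains_below x)"
  using finite_chains by (rule finite_subset[rotated]) (auto simp: chains_below_iff)

lemma chain_insert_top:
  assumes "x \<in> P" "C \<in> chains_below x"
  shows "insert x C \<in> \<Delta>" "card (insert x C) = Suc (card C)"
proof -
  have C_below: "C \<in> \<Delta>" "\<And>c. c \<in> C \<Longrightarrow> strict le c x" using assms(2) by (auto simp: chains_below_iff)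
  then show "insert x C \<in> \<Delta>" using assms(1) le_refl unfolding chain_iff strict_def by blast
  have "x \<notin> C" using C_below(2) by (auto simp: strict_def)
  moreover have "finite C" using C_below(1) by (simp add: order_complex_def)
  ultimately show "card (insert x C) = Suc (card C)" by simp
qed

lemma rk_attained:
  obtains C where "C \<in> chains_below x" "card C = rk x"
proof (rule max_card_attained[OF finite_chains_below])
  have "{} \<in> chains_below x" by (simp add: order_complex_def)
  then show "chains_below x \<noteq> {}" by blast
qed (use that in \<open>simp add: rk_def\<close>)

lemma rk_less_height:
  assumes "x \<in> P"
  shows "rk x < height"
proof -
  obtain C where C_max: "C \<in> chains_below x" "card C = rk x" by (rule rk_attained)
  then show ?thesis
    using card_le_max_card[OF finite_chains chain_insert_top(1)[OF assms C_max(1)]]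
      chain_insert_top(2)[OF assms C_max(1)]
    by (simp add: height_def)
qed

lemma rk_strict_mono:
  assumes xy_less: "x \<in> P" "y \<in> P" "strict le x y"
  shows "rk x < rk y"
proof -
  obtain C where C_max: "C \<in> chains_below x" "card C = rk x" by (rule rk_attained)
  have "strict le c y" if "c \<in> C" for c
  proof -
    have c_less: "c \<in> P" "strict le c x" using that C_max(1) chainD(1) by (auto simp: chains_below_iff)
    then have "le c y" using le_trans[of c x y] xy_less by (simp add: strict_def)
    moreover have "c \<noteq> y" using c_less xy_less le_antisym by (auto simp: strict_def)
    ultimately show ?thesis by (simp add: strict_def)
  qed
  then have "insert x C \<in> chains_below y"
    using chain_insert_top(1)[OF xy_less(1) C_max(1)] xy_less(3) by (simp add: chains_below_iff)
  then have "card (insert x C) \<le> rk y" unfolding rk_def by (rule card_le_max_card[OF finite_chains_below])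
  then show ?thesis using chain_insert_top(2)[OF xy_less(1) C_max(1)] C_max(2) by simp
qed

lemma rk_mono: "x \<in> P \<Longrightarrow> y \<in> P \<Longrightarrow> le x y \<Longrightarrow> rk x \<le> rk y"
  using rk_strict_mono[of x y] by (cases "x = y") (auto simp: strict_def)

lemma rk_le_iff:
  assumes G_in: "G \<in> \<Delta>" "x \<in> G" "y \<in> G"
  shows "rk x \<le> rk y \<longleftrightarrow> le x y"
proof -
  have xy_in_P: "x \<in> P" "y \<in> P" using chainD(1)[OF G_in(1)] G_in(2,3) by auto
  show ?thesis
    using chainD(2)[OF G_in] rk_strict_mono[OF xy_in_P(2,1)] rk_mono[OF xy_in_P] le_refl[OF xy_in_P(1)]
    by (cases "x = y") (auto simp: strict_def)
qed

sublocale chains: coloured_complex \<Delta> P rk height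
proof
  fix G assume G_in: "G \<in> \<Delta>"
  show "inj_on rk G"
  proof (rule inj_onI)
    fix x y assume "x \<in> G" "y \<in> G" "rk x = rk y"
    then show "x = y"
      using rk_le_iff[OF G_in, of x y] rk_le_iff[OF G_in, of y x] le_antisym chainD(1)[OF G_in] by auto
  qed
qed (use finite_P simplicial_order_complex chainD(1) rk_less_height in auto)

lemma chain_Un:
  assumes "A \<in> \<Delta>" "B \<in> \<Delta>" "y \<in> P" "\<And>a. a \<in> A \<Longrightarrow> le a y" "\<And>b. b \<in> B \<Longrightarrow> le y b"
  shows "A \<union> B \<in> \<Delta>"
proof -
  have "le a b" if "a \<in> A" "b \<in> B" for a b
    using le_trans[of a y b] assms chainD(1) that by blast
  then show ?thesis using assms(1,2) unfolding chain_iff by blast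
qed

definition greatest_elems :: "'a set \<Rightarrow> 'a set" where
  "greatest_elems C = {z \<in> C. \<forall>c\<in>C. le c z}"

definition least_elems :: "'a set \<Rightarrow> 'a set" where
  "least_elems C = {z \<in> C. \<forall>c\<in>C. le z c}"

lemma greatest_elems_chain:
  assumes "C \<in> \<Delta>" "z \<in> greatest_elems C"
  shows "greatest_elems C = {z}"
  using assms(2) le_antisym chainD(1)[OF assms(1)] unfolding greatest_elems_def by blast

lemma least_elems_chain:
  assumes "C \<in> \<Delta>" "z \<in> least_elems C"
  shows "least_elems C = {z}"
  using assms(2) le_antisym chainD(1)[OF assms(1)] unfolding least_elems_def by blast

lemma chain_has_greatest:
  assumes "C \<in> \<Delta>" "C \<noteq> {}"
  obtains z where "z \<in> greatest_elems C"
proof -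
  have fin: "finite C" by (rule chains.finite_face[OF assms(1)])
  then have "Max (rk ` C) \<in> rk ` C" using assms(2) by (intro Max_in) auto
  then obtain z where z_max: "z \<in> C" "rk z = Max (rk ` C)" by auto
  then have "rk c \<le> rk z" if "c \<in> C" for c using fin that by simp
  then show ?thesis using that[of z] z_max(1) rk_le_iff[OF assms(1)] by (simp add: greatest_elems_def)
qed

lemma greatest_elems_empty_iff:
  assumes "C \<in> \<Delta>"
  shows "greatest_elems C = {} \<longleftrightarrow> C = {}"
proof (cases "C = {}")
  case False
  then obtain z where "z \<in> greatest_elems C" by (rule chain_has_greatest[OF assms])
  with False show ?thesis by auto
qed (simp add: greatest_elems_def)

lemma chain_has_least:
  assumes "C \<in> \<Delta>" "C \<noteq> {}"
  obtains z where "z \<in> least_elems C"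
proof -
  have fin: "finite C" by (rule chains.finite_face[OF assms(1)])
  then have "Min (rk ` C) \<in> rk ` C" using assms(2) by (intro Min_in) auto
  then obtain z where z_min: "z \<in> C" "rk z = Min (rk ` C)" by auto
  then have "rk z \<le> rk c" if "c \<in> C" for c using fin that by simp
  then show ?thesis using that[of z] z_min(1) rk_le_iff[OF assms(1)] by (simp add: least_elems_def)
qed

lemma greatest_elems_grow:
  assumes C_chain: "C \<in> \<Delta>" and D_chain: "D \<in> \<Delta>" and "C \<subseteq> D"
  shows "greatest_elems C = greatest_elems D \<or>
    (\<Sum>z\<in>greatest_elems C. Suc (rk z)) < (\<Sum>z\<in>greatest_elems D. Suc (rk z))"
proof (cases "D = {}")
  case False
  then obtain z where "z \<in> greatest_elems D" by (rule chain_has_greatest[OF D_chain])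
  then have z_greatest: "greatest_elems D = {z}" "z \<in> D" "\<And>x. x \<in> D \<Longrightarrow> le x z"
    using greatest_elems_chain[OF D_chain] by (auto simp: greatest_elems_def)
  show ?thesis
  proof (cases "C = {}")
    case False
    then obtain x where "x \<in> greatest_elems C" by (rule chain_has_greatest[OF C_chain])
    then have x_greatest: "greatest_elems C = {x}" "x \<in> C"
      using greatest_elems_chain[OF C_chain] by (auto simp: greatest_elems_def)
    have "x = z \<or> rk x < rk z"
      using rk_strict_mono[of x z] x_greatest(2) z_greatest(2,3) \<open>C \<subseteq> D\<close> chainD(1)[OF D_chain]
      by (auto simp: strict_def)
    then show ?thesis by (auto simp: x_greatest z_greatest)
  qed (simp add: z_greatest(1) greatest_elems_def[of "{}"])
qed (use \<open>C \<subseteq> D\<close> in simp)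

lemma least_elems_shrink:
  assumes C_chain: "C \<in> \<Delta>" and D_chain: "D \<in> \<Delta>" and "C \<subseteq> D" "C \<noteq> {}"
  shows "least_elems C = least_elems D \<or>
    height - (\<Sum>z\<in>least_elems C. rk z) < height - (\<Sum>z\<in>least_elems D. rk z)"
proof -
  have "D \<noteq> {}" using \<open>C \<subseteq> D\<close> \<open>C \<noteq> {}\<close> by auto
  then obtain x z where x_least: "x \<in> least_elems C" and z_least: "z \<in> least_elems D"
    using chain_has_least[OF C_chain \<open>C \<noteq> {}\<close>] chain_has_least[OF D_chain] by metis
  then have "le z x" "x \<in> P" "z \<in> P"
    using \<open>C \<subseteq> D\<close> chainD(1)[OF D_chain] by (auto simp: least_elems_def)
  then have "x = z \<or> rk z < rk x \<and> rk x < height"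
    using rk_strict_mono[of z x] rk_less_height[of x] by (auto simp: strict_def)
  then show ?thesis
    by (auto simp: least_elems_chain[OF C_chain x_least] least_elems_chain[OF D_chain z_least])
qed

lemma bij_betw_star_least:
  assumes F_in: "F \<in> \<Delta>" and y_least: "y \<in> least_elems F"
  shows "bij_betw (\<lambda>(A, B). A \<union> B) (chains_below y \<times> {B \<in> star \<Delta> F. \<forall>b\<in>B. le y b}) (star \<Delta> F)"
proof (rule bij_betw_byWitness[where f' = "\<lambda>H. ({h \<in> H. strict le h y}, {h \<in> H. le y h})"])
  let ?S = "chains_below y \<times> {B \<in> star \<Delta> F. \<forall>b\<in>B. le y b}"
  have y_below: "y \<in> F" "\<And>b. b \<in> F \<Longrightarrow> le y b" using y_least by (auto simp: least_elems_def)
  then have y_in_P: "y \<in> P" using chainD(1)[OF F_in] by auto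
  have not_both: "\<not> (strict le h y \<and> le y h)" if "h \<in> P" for h
    using le_antisym[OF that y_in_P] by (auto simp: strict_def)
  show "\<forall>p\<in>?S. (\<lambda>H. ({h \<in> H. strict le h y}, {h \<in> H. le y h})) ((\<lambda>(A, B). A \<union> B) p) = p"
    using not_both chainD(1) by (fastforce simp: chains_below_iff star_def)
  show "\<forall>H\<in>star \<Delta> F. (\<lambda>(A, B). A \<union> B) ({h \<in> H. strict le h y}, {h \<in> H. le y h}) = H"
    using chainD(2) y_below(1) le_refl[OF y_in_P] by (fastforce simp: star_def strict_def)
  show "(\<lambda>(A, B). A \<union> B) ` ?S \<subseteq> star \<Delta> F"
    using chain_Un[OF _ _ y_in_P] by (fastforce simp: chains_below_iff star_def strict_def)
  show "(\<lambda>H. ({h \<in> H. strict le h y}, {h \<in> H. le y h})) ` star \<Delta> F \<subseteq> ?S"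
  proof clarify
    fix H assume H_in: "H \<in> star \<Delta> F"
    then have "{h \<in> H. strict le h y} \<in> \<Delta>" "{h \<in> H. le y h} \<in> \<Delta>"
      using chains.subface[of H] by (auto simp: star_def)
    then show "{h \<in> H. strict le h y} \<in> chains_below y \<and> {h \<in> H. le y h} \<in> {B \<in> star \<Delta> F. \<forall>b\<in>B. le y b}"
      using H_in y_below(2) by (auto simp: chains_below_iff star_def)
  qed
qed

lemma star_euler_char_least:
  assumes F_in: "F \<in> \<Delta>" and y_least: "y \<in> least_elems F"
    and euler_char: "red_euler_char (below P le y) le = 0"
  shows "(\<Sum>H\<in>star \<Delta> F. (-1) ^ card H) = (0::int)"
proof -
  let ?U = "{B \<in> star \<Delta> F. \<forall>b\<in>B. le y b}"
  have card_Un: "card (A \<union> B) = card A + card B" if "A \<in> chains_below y" "B \<in> ?U" for A B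
  proof (rule card_Un_disjoint)
    show "finite A" "finite B" using that chains.finite_face by (auto simp: chains_below_iff star_def)
    have "y \<in> P" using y_least chainD(1)[OF F_in] by (auto simp: least_elems_def)
    then show "A \<inter> B = {}"
      using that le_antisym[of y] chainD(1)[of A] by (fastforce simp: chains_below_iff strict_def)
  qed
  have "(\<Sum>H\<in>star \<Delta> F. (-1) ^ card H) = (\<Sum>(A, B)\<in>chains_below y \<times> ?U. (-1::int) ^ card (A \<union> B))"
    using sum.reindex_bij_betw[OF bij_betw_star_least[OF F_in y_least], of "\<lambda>H. (-1::int) ^ card H"]
    by (simp add: case_prod_unfold)
  also have "\<dots> = (\<Sum>(A, B)\<in>chains_below y \<times> ?U. (-1) ^ card A * (-1) ^ card B)"
    by (rule sum.cong) (auto simp: card_Un power_add)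
  also have "\<dots> = (\<Sum>A\<in>chains_below y. (-1) ^ card A) * (\<Sum>B\<in>?U. (-1) ^ card B)"
    by (simp add: sum_product sum.cartesian_product)
  also have "(\<Sum>A\<in>chains_below y. (-1) ^ card A) = (0::int)"
    using euler_char by (simp add: red_euler_char_def sum_negf)
  finally show ?thesis by simp
qed

theorem exact_at_star_of_euler_char_zero:
  assumes reisner: "reisner TYPE('k::field) rk \<Delta> height" and F_in: "F \<in> \<Delta>"
    and euler_char: "F = {} \<Longrightarrow> red_euler_char P le = 0" "\<And>y. y \<in> F \<Longrightarrow> red_euler_char (below P le y) le = 0"
  shows "exact_at TYPE('k) rk (star \<Delta> F) i"
proof (rule exact_at_of_euler_char_zero[where d = height])
  show "orients rk (star \<Delta> F)" by (rule orients_subset[OF chains.orients_colour]) (auto simp: star_def)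
  show "convex_family (star \<Delta> F)" by (rule convex_family_star[OF chains.simplicial])
  show "finite (star \<Delta> F)" using chains.finite_complex by (simp add: star_def)
  show "card G \<le> height" if "G \<in> star \<Delta> F" for G using that chains.card_face_le by (simp add: star_def)
  show "exact_at TYPE('k) rk (star \<Delta> F) i" if "i < height" for i
    using reisner F_in that by (simp add: reisner_def)
  show "(\<Sum>H\<in>star \<Delta> F. (-1) ^ card H) = (0::int)"
  proof (cases "F = {}")
    case True
    then show ?thesis using euler_char(1) by (simp add: star_def red_euler_char_def sum_negf)
  next
    case False
    then obtain y where y_least: "y \<in> least_elems F" by (rule chain_has_least[OF F_in])
    then show ?thesis using euler_char(2)[of y]
      by (intro star_euler_char_least[OF F_in y_least]) (simp add: least_elems_def)
  qed
qed

end

section \<open>The poset P \<uplus> Q\<close>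

abbreviation starred :: "('a + 'a) set \<Rightarrow> 'a set" where "starred G \<equiv> Inr -` G"

abbreviation unstarred :: "('a + 'a) set \<Rightarrow> 'a set" where "unstarred G \<equiv> Inl -` G"

definition unstar :: "'a + 'a \<Rightarrow> 'a" where "unstar = case_sum id id"

lemma unstar_simps [simp]: "unstar (Inl x) = x" "unstar (Inr x) = x"
  by (simp_all add: unstar_def)

lemma unstar_image: "unstar ` G = starred G \<union> unstarred G"
proof (rule set_eqI)
  fix x show "x \<in> unstar ` G \<longleftrightarrow> x \<in> starred G \<union> unstarred G"
    by (auto simp: image_iff Bex_def split_sum_ex)
qed

locale finite_poset_ideal = finite_poset P le for P :: "'a set" and le +
  fixes Q :: "'a set"
  assumes ideal: "poset_ideal P le Q"
begin

abbreviation \<Gamma> :: "('a + 'a) set set" where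
  "\<Gamma> \<equiv> order_complex (uplus_carrier P Q) (uplus_le le Q)"

lemma Q_subset: "Q \<subseteq> P" and Q_downward: "x \<in> Q \<Longrightarrow> y \<in> P \<Longrightarrow> le y x \<Longrightarrow> y \<in> Q"
  using ideal unfolding poset_ideal_def strict_def by auto

lemma finite_carrier: "finite (uplus_carrier P Q)"
  unfolding uplus_carrier_def using finite_P finite_subset[OF Q_subset finite_P] by simp

lemma uplus_comparable_iff:
  assumes "G \<subseteq> uplus_carrier P Q"
  shows "(\<forall>a\<in>G. \<forall>b\<in>G. uplus_le le Q a b \<or> uplus_le le Q b a) \<longleftrightarrow>
    (\<forall>x\<in>starred G. \<forall>y\<in>starred G. le x y \<or> le y x) \<and> (\<forall>x\<in>unstarred G. \<forall>y\<in>unstarred G. le x y \<or> le y x) \<and>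
    (\<forall>x\<in>starred G. \<forall>y\<in>unstarred G. le x y)"
proof -
  define comparable where "comparable a b \<longleftrightarrow> uplus_le le Q a b \<or> uplus_le le Q b a" for a b
  have "x \<in> P" if "x \<in> starred G \<union> unstarred G" for x
    using assms that Q_subset by (auto simp: uplus_carrier_def)
  then have same: "comparable (Inl x) (Inl y) \<longleftrightarrow> le x y \<or> le y x"
      "comparable (Inr x) (Inr y) \<longleftrightarrow> le x y \<or> le y x"
    if "x \<in> starred G \<union> unstarred G" for x y
    using that le_refl[of x] by (auto simp: comparable_def uplus_le_def strict_def)
  have mixed: "comparable (Inr x) (Inl y) \<longleftrightarrow> le x y" "comparable (Inl y) (Inr x) \<longleftrightarrow> le x y"
    if "x \<in> starred G" for x y
    using that assms by (auto simp: comparable_def uplus_le_def uplus_carrier_def)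
  have split: "(\<forall>a\<in>G. R a) \<longleftrightarrow> (\<forall>x\<in>starred G. R (Inr x)) \<and> (\<forall>x\<in>unstarred G. R (Inl x))" for R
    by (auto simp: Ball_def split_sum_all)
  have "(\<forall>a\<in>G. \<forall>b\<in>G. comparable a b) \<longleftrightarrow>
      (\<forall>x\<in>starred G. (\<forall>y\<in>starred G. le x y \<or> le y x) \<and> (\<forall>y\<in>unstarred G. le x y)) \<and>
      (\<forall>y\<in>unstarred G. (\<forall>x\<in>starred G. le x y) \<and> (\<forall>x\<in>unstarred G. le y x \<or> le x y))"
    unfolding split using same mixed by (intro conj_cong ball_cong refl) auto
  also have "\<dots> \<longleftrightarrow> (\<forall>x\<in>starred G. \<forall>y\<in>starred G. le x y \<or> le y x) \<and>
      (\<forall>x\<in>unstarred G. \<forall>y\<in>unstarred G. le x y \<or> le y x) \<and> (\<forall>x\<in>starred G. \<forall>y\<in>unstarred G. le x y)"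
    by blast
  finally show ?thesis unfolding comparable_def .
qed

lemma uplus_chain_iff:
  "G \<in> \<Gamma> \<longleftrightarrow> starred G \<subseteq> Q \<and> starred G \<in> \<Delta> \<and> unstarred G \<in> \<Delta> \<and>
    (\<forall>x\<in>starred G. \<forall>y\<in>unstarred G. le x y)"
proof -
  have carrier: "G \<subseteq> uplus_carrier P Q \<longleftrightarrow> starred G \<subseteq> Q \<and> unstarred G \<subseteq> P"
    by (auto simp: uplus_carrier_def subset_eq Ball_def split_sum_all)
  have "finite G" if "G \<subseteq> uplus_carrier P Q" using that finite_carrier by (rule finite_subset)
  then have "G \<in> \<Gamma> \<longleftrightarrow> G \<subseteq> uplus_carrier P Q \<and> (\<forall>a\<in>G. \<forall>b\<in>G. uplus_le le Q a b \<or> uplus_le le Q b a)"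
    by (auto simp: order_complex_def)
  also have "\<dots> \<longleftrightarrow> G \<subseteq> uplus_carrier P Q \<and>
      (\<forall>x\<in>starred G. \<forall>y\<in>starred G. le x y \<or> le y x) \<and> (\<forall>x\<in>unstarred G. \<forall>y\<in>unstarred G. le x y \<or> le y x) \<and>
      (\<forall>x\<in>starred G. \<forall>y\<in>unstarred G. le x y)"
    by (rule conj_cong[OF refl uplus_comparable_iff])
  finally have "G \<in> \<Gamma> \<longleftrightarrow> (starred G \<subseteq> Q \<and> unstarred G \<subseteq> P) \<and>
      (\<forall>x\<in>starred G. \<forall>y\<in>starred G. le x y \<or> le y x) \<and> (\<forall>x\<in>unstarred G. \<forall>y\<in>unstarred G. le x y \<or> le y x) \<and>
      (\<forall>x\<in>starred G. \<forall>y\<in>unstarred G. le x y)"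
    unfolding carrier .
  moreover have "starred G \<subseteq> Q \<Longrightarrow> starred G \<subseteq> P" using Q_subset by (rule subset_trans[rotated])
  ultimately show ?thesis unfolding chain_iff by argo
qed

lemma uplus_chainD:
  assumes "G \<in> \<Gamma>"
  shows "starred G \<subseteq> Q" "starred G \<in> \<Delta>" "unstarred G \<in> \<Delta>"
    "\<And>x y. Inr x \<in> G \<Longrightarrow> Inl y \<in> G \<Longrightarrow> le x y"
    "\<And>a. a \<in> G \<Longrightarrow> unstar a \<in> P"
proof -
  show parts: "starred G \<subseteq> Q" "starred G \<in> \<Delta>" "unstarred G \<in> \<Delta>"
    "\<And>x y. Inr x \<in> G \<Longrightarrow> Inl y \<in> G \<Longrightarrow> le x y"
    using assms uplus_chain_iff[of G] by auto
  show "unstar a \<in> P" if "a \<in> G" for a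
    using that chainD(1)[OF parts(2)] chainD(1)[OF parts(3)] by (cases a) auto
qed

definition uplus_rk :: "'a + 'a \<Rightarrow> nat" where "uplus_rk = case_sum (\<lambda>x. Suc (rk x)) rk"

lemma uplus_rk_simps [simp]: "uplus_rk (Inl x) = Suc (rk x)" "uplus_rk (Inr x) = rk x"
  by (simp_all add: uplus_rk_def)

lemma inj_on_uplus_rk:
  assumes G_in: "G \<in> \<Gamma>"
  shows "inj_on uplus_rk G"
proof (rule inj_onI)
  note G_parts = uplus_chainD[OF G_in]
  have mixed: "rk x < Suc (rk y)" if "Inr x \<in> G" "Inl y \<in> G" for x y
    using rk_mono[of x y] G_parts(4)[OF that] G_parts(5)[OF that(1)] G_parts(5)[OF that(2)] by simp
  fix a b assume ab_in: "a \<in> G" "b \<in> G" "uplus_rk a = uplus_rk b"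
  show "a = b"
  proof (cases a)
    case (Inl x)
    then obtain y where "b = Inl y" using ab_in mixed[of _ x] by (cases b) auto
    then show ?thesis using ab_in Inl chains.same_colour[OF G_parts(3), of x y] by simp
  next
    case (Inr x)
    then obtain y where "b = Inr y" using ab_in mixed[of x] by (cases b) auto
    then show ?thesis using ab_in Inr chains.same_colour[OF G_parts(2), of x y] by simp
  qed
qed

sublocale uplus: coloured_complex \<Gamma> "uplus_carrier P Q" uplus_rk "Suc height"
proof
  show "uplus_rk v < Suc height" if "v \<in> uplus_carrier P Q" for v
    using that rk_less_height Q_subset by (auto simp: uplus_carrier_def less_SucI)
  show "G \<subseteq> uplus_carrier P Q" if "G \<in> \<Gamma>" for G using that by (simp add: order_complex_def)
qed (use finite_carrier simplicial_order_complex inj_on_uplus_rk in auto)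

lemma orients_star: "orients uplus_rk (star \<Gamma> F)"
  by (rule orients_subset[OF uplus.orients_colour]) (auto simp: star_def)

lemma finite_star: "finite (star \<Gamma> F)"
  using uplus.finite_complex by (simp add: star_def)

lemma insert_unstarred_greatest:
  assumes G_in: "G \<in> \<Gamma>" and z_greatest: "z \<in> greatest_elems (starred G)"
  shows "insert (Inl z) G \<in> \<Gamma>"
proof -
  note G_parts = uplus_chainD[OF G_in]
  have z_above: "Inr z \<in> G" "\<And>x. Inr x \<in> G \<Longrightarrow> le x z" using z_greatest by (auto simp: greatest_elems_def)
  then have "{z} \<union> unstarred G \<in> \<Delta>"
    using G_parts(3,4) G_parts(5)[of "Inr z"] le_refl by (intro chain_Un[where y = z]) (auto simp: chain_iff)
  moreover have "starred (insert (Inl z) G) = starred G" "unstarred (insert (Inl z) G) = {z} \<union> unstarred G"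
    by auto
  ultimately show ?thesis using G_parts(1,2,4) z_above(2) by (auto simp: uplus_chain_iff[of "insert (Inl z) G"])
qed

lemma insert_starred_least:
  assumes G_in: "G \<in> \<Gamma>" and u_least: "u \<in> least_elems (unstarred G)" "u \<in> Q"
  shows "insert (Inr u) G \<in> \<Gamma>"
proof -
  note G_parts = uplus_chainD[OF G_in]
  have u_below: "Inl u \<in> G" "\<And>x. Inl x \<in> G \<Longrightarrow> le u x" using u_least by (auto simp: least_elems_def)
  then have "starred G \<union> {u} \<in> \<Delta>"
    using G_parts(2,4) G_parts(5)[of "Inl u"] le_refl by (intro chain_Un[where y = u]) (auto simp: chain_iff)
  moreover have "starred (insert (Inr u) G) = starred G \<union> {u}" "unstarred (insert (Inr u) G) = unstarred G"
    by auto
  ultimately show ?thesis using G_parts(1,3,4) u_below(2) u_least(2)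
    by (auto simp: uplus_chain_iff[of "insert (Inr u) G"])
qed

lemma exact_at_level_greatest_starred:
  assumes z_notin: "Inl z \<notin> F"
  shows "exact_at TYPE('k::field) uplus_rk {G \<in> star \<Gamma> F. greatest_elems (starred G) = {z}} i"
    (is "exact_at _ _ ?X _")
proof (rule exact_at_cone[where u = "Inl z"])
  show "orients uplus_rk ?X" by (rule orients_subset[OF orients_star]) auto
  fix G assume G_in: "G \<in> ?X"
  then have "G - {Inl z} \<in> \<Gamma>" using uplus.subface[of G "G - {Inl z}"] by (auto simp: star_def)
  moreover have "starred (G - {Inl z}) = starred G" by auto
  ultimately show "G - {Inl z} \<in> ?X" using G_in z_notin by (auto simp: star_def)
  have "insert (Inl z) G \<in> \<Gamma>" by (rule insert_unstarred_greatest) (use G_in in \<open>auto simp: star_def\<close>)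
  moreover have "starred (insert (Inl z) G) = starred G" by auto
  ultimately show "insert (Inl z) G \<in> ?X" using G_in by (auto simp: star_def)
qed

lemma exact_at_level_least_unstarred:
  assumes u_in_Q: "u \<in> Q" "Inr u \<notin> F"
  shows "exact_at TYPE('k::field) uplus_rk {G \<in> star \<Gamma> F. least_elems (unstarred G) = {u}} i"
    (is "exact_at _ _ ?X _")
proof (rule exact_at_cone[where u = "Inr u"])
  show "orients uplus_rk ?X" by (rule orients_subset[OF orients_star]) auto
  fix G assume G_in: "G \<in> ?X"
  then have "G - {Inr u} \<in> \<Gamma>" using uplus.subface[of G "G - {Inr u}"] by (auto simp: star_def)
  moreover have "unstarred (G - {Inr u}) = unstarred G" by auto
  ultimately show "G - {Inr u} \<in> ?X" using G_in u_in_Q(2) by (auto simp: star_def)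
  have "insert (Inr u) G \<in> \<Gamma>"
    by (rule insert_starred_least[OF _ _ u_in_Q(1)]) (use G_in in \<open>auto simp: star_def\<close>)
  moreover have "unstarred (insert (Inr u) G) = unstarred G" by auto
  ultimately show "insert (Inr u) G \<in> ?X" using G_in by (auto simp: star_def)
qed

lemma star_insert_starred_eq:
  assumes "Inl z \<in> F"
  shows "star \<Gamma> (insert (Inr z) F) = {G \<in> star \<Gamma> F. greatest_elems (starred G) = {z}}"
proof (rule set_eqI)
  fix G
  have "Inr z \<in> G \<longleftrightarrow> greatest_elems (starred G) = {z}" if G_in: "G \<in> star \<Gamma> F"
  proof
    assume "Inr z \<in> G"
    then have "z \<in> greatest_elems (starred G)"
      using G_in assms uplus_chainD(4)[of G _ z] by (auto simp: star_def greatest_elems_def)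
    then show "greatest_elems (starred G) = {z}"
      using G_in by (intro greatest_elems_chain uplus_chainD(2)) (auto simp: star_def)
  next
    assume "greatest_elems (starred G) = {z}"
    then have "z \<in> greatest_elems (starred G)" by simp
    then show "Inr z \<in> G" by (simp add: greatest_elems_def)
  qed
  then show "G \<in> star \<Gamma> (insert (Inr z) F) \<longleftrightarrow> G \<in> {G \<in> star \<Gamma> F. greatest_elems (starred G) = {z}}"
    by (auto simp: star_def)
qed

lemma exact_at_star_by_greatest_starred:
  assumes none: "exact_at TYPE('k::field) uplus_rk {G \<in> star \<Gamma> F. starred G = {}} i"
    and doubled: "\<And>z. Inl z \<in> F \<Longrightarrow> insert (Inr z) F \<in> \<Gamma> \<Longrightarrow> exact_at TYPE('k) uplus_rk (star \<Gamma> (insert (Inr z) F)) i"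
  shows "exact_at TYPE('k) uplus_rk (star \<Gamma> F) i"
proof (rule exact_at_filtration[where key = "\<lambda>G. greatest_elems (starred G)"
      and rank = "\<lambda>K. \<Sum>z\<in>K. Suc (rk z)"])
  let ?key = "\<lambda>G. greatest_elems (starred G)"
  show "convex_family (star \<Gamma> F)" by (rule convex_family_star[OF uplus.simplicial])
  show "?key G = ?key H \<or> (\<Sum>z\<in>?key G. Suc (rk z)) < (\<Sum>z\<in>?key H. Suc (rk z))"
    if "G \<in> star \<Gamma> F" "H \<in> star \<Gamma> F" "G \<subseteq> H" for G H
    using that uplus_chainD(2) by (intro greatest_elems_grow vimage_mono) (auto simp: star_def)
  fix K assume "K \<in> ?key ` star \<Gamma> F"
  then obtain G where G_in: "G \<in> \<Gamma>" "F \<subseteq> G" "K = ?key G" by (auto simp: star_def)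
  show "exact_at TYPE('k) uplus_rk {G \<in> star \<Gamma> F. ?key G = K} i"
  proof (cases "starred G = {}")
    case True
    have "?key H = {} \<longleftrightarrow> starred H = {}" if "H \<in> star \<Gamma> F" for H
    proof -
      have "starred H \<in> \<Delta>" using that uplus_chainD(2) by (simp add: star_def)
      then show ?thesis by (rule greatest_elems_empty_iff)
    qed
    moreover have "K = {}" using True G_in(3) by (simp add: greatest_elems_def)
    ultimately have "{G \<in> star \<Gamma> F. ?key G = K} = {G \<in> star \<Gamma> F. starred G = {}}" by auto
    then show ?thesis using none by simp
  next
    case False
    then obtain z where z_greatest: "z \<in> ?key G" by (rule chain_has_greatest[OF uplus_chainD(2)[OF G_in(1)]])
    then have K_eq: "K = {z}" using greatest_elems_chain[OF uplus_chainD(2)[OF G_in(1)]] G_in(3) by simp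
    have "insert (Inr z) F \<in> \<Gamma>"
      using z_greatest G_in(2) by (intro uplus.subface[OF G_in(1)]) (auto simp: greatest_elems_def)
    then show ?thesis
      unfolding K_eq
      using doubled[of z] star_insert_starred_eq[of z F] exact_at_level_greatest_starred[of z F]
      by (cases "Inl z \<in> F") auto
  qed
qed (rule orients_star finite_star)+

lemma exact_at_star_unstarred_in_Q:
  assumes y_in: "Inl y \<in> F" "y \<in> Q" and F_unstarred: "starred F = {}"
  shows "exact_at TYPE('k::field) uplus_rk (star \<Gamma> F) i"
proof (rule exact_at_filtration[where key = "\<lambda>G. least_elems (unstarred G)"
      and rank = "\<lambda>K. height - (\<Sum>z\<in>K. rk z)"])
  let ?key = "\<lambda>G. least_elems (unstarred G)"
  have nonempty: "unstarred G \<noteq> {}" if "G \<in> star \<Gamma> F" for G using that y_in(1) by (auto simp: star_def)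
  show "convex_family (star \<Gamma> F)" by (rule convex_family_star[OF uplus.simplicial])
  show "?key G = ?key H \<or> height - (\<Sum>z\<in>?key G. rk z) < height - (\<Sum>z\<in>?key H. rk z)"
    if "G \<in> star \<Gamma> F" "H \<in> star \<Gamma> F" "G \<subseteq> H" for G H
    using that nonempty[of G] uplus_chainD(3) by (intro least_elems_shrink vimage_mono) (auto simp: star_def)
  fix K assume "K \<in> ?key ` star \<Gamma> F"
  then obtain G where G_in: "G \<in> \<Gamma>" "F \<subseteq> G" "K = ?key G" by (auto simp: star_def)
  have "unstarred G \<noteq> {}" using nonempty G_in(1,2) by (simp add: star_def)
  then obtain u where u_least: "u \<in> ?key G" by (rule chain_has_least[OF uplus_chainD(3)[OF G_in(1)]])
  then have K_eq: "K = {u}" using least_elems_chain[OF uplus_chainD(3)[OF G_in(1)]] G_in(3) by simp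
  have "Inl u \<in> G" "le u y" using u_least y_in(1) G_in(2) by (auto simp: least_elems_def)
  then have "u \<in> Q" using Q_downward[OF y_in(2)] uplus_chainD(5)[OF G_in(1), of "Inl u"] by simp
  moreover have "Inr u \<notin> F" using F_unstarred by auto
  ultimately show "exact_at TYPE('k) uplus_rk {G \<in> star \<Gamma> F. ?key G = K} i"
    unfolding K_eq by (rule exact_at_level_least_unstarred)
qed (rule orients_star finite_star)+

definition double_at :: "'a \<Rightarrow> 'a set \<Rightarrow> ('a + 'a) set" where
  "double_at y H = Inr ` {h \<in> H. le h y} \<union> Inl ` {h \<in> H. le y h}"

lemma unstar_double_at:
  assumes H_in: "H \<in> \<Delta>" and y_in: "y \<in> H" "y \<in> Q"
  shows "double_at y H \<in> \<Gamma>" "unstar ` double_at y H = H"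
proof -
  have sets: "starred (double_at y H) = {h \<in> H. le h y}" "unstarred (double_at y H) = {h \<in> H. le y h}"
    by (auto simp: double_at_def)
  have "le x z" if "x \<in> H" "z \<in> H" "le x y" "le y z" for x z
    using le_trans[of x y z] chainD(1)[OF H_in] y_in(1) that by auto
  then show "double_at y H \<in> \<Gamma>"
    unfolding uplus_chain_iff sets
    using Q_downward[OF y_in(2)] chainD(1)[OF H_in] by (auto intro: chains.subface[OF H_in])
  show "unstar ` double_at y H = H"
    using chainD(2)[OF H_in] y_in(1) unfolding unstar_image sets by auto
qed

lemma doubled_chain:
  assumes G_in: "G \<in> \<Gamma>" and y_doubled: "Inl y \<in> G" "Inr y \<in> G"
  shows "unstar ` G \<in> \<Delta>" "inj_on unstar (G - {Inr y})" "unstar ` (G - {Inr y}) = unstar ` G"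
    "double_at y (unstar ` G) = G"
proof -
  note G_parts = uplus_chainD[OF G_in]
  have y_P: "y \<in> P" using G_parts(5)[OF y_doubled(1)] by simp
  have below: "le x y" if "Inr x \<in> G" for x by (rule G_parts(4)[OF that y_doubled(1)])
  have above: "le y x" if "Inl x \<in> G" for x by (rule G_parts(4)[OF y_doubled(2) that])
  have eq_y: "x = y" if "Inr x \<in> G" "le y x \<or> Inl x \<in> G" for x
    using that below[of x] above[of x] le_antisym[of x y] G_parts(5)[of "Inr x"] y_P by auto
  have eq_y': "x = y" if "Inl x \<in> G" "le x y" for x
    using that above[of x] le_antisym[of x y] G_parts(5)[of "Inl x"] y_P by auto
  show "unstar ` G \<in> \<Delta>"
    unfolding unstar_image using below above by (intro chain_Un[OF G_parts(2,3) y_P]) auto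
  show "inj_on unstar (G - {Inr y})"
  proof (rule inj_onI)
    fix a b assume "a \<in> G - {Inr y}" "b \<in> G - {Inr y}" "unstar a = unstar b"
    then show "a = b" using eq_y by (cases a; cases b) auto
  qed
  show "unstar ` (G - {Inr y}) = unstar ` G"
    unfolding unstar_image using y_doubled by (auto simp: vimage_def)
  show "double_at y (unstar ` G) = G"
  proof (rule set_eqI)
    fix a show "a \<in> double_at y (unstar ` G) \<longleftrightarrow> a \<in> G"
      unfolding double_at_def unstar_image using y_doubled below above eq_y eq_y' by (cases a) auto
  qed
qed

lemma unstar_image_star_doubled:
  assumes F_in: "F \<in> \<Gamma>" and y_doubled: "Inl y \<in> F" "Inr y \<in> F"
  shows "inj_on ((`) unstar) (star \<Gamma> F)" "(`) unstar ` star \<Gamma> F = star \<Delta> (unstar ` F)"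
proof -
  have double_at: "unstar ` G \<in> \<Delta>" "double_at y (unstar ` G) = G" if "G \<in> star \<Gamma> F" for G
    using that y_doubled doubled_chain(1,4)[of G y] by (auto simp: star_def)
  then show "inj_on ((`) unstar) (star \<Gamma> F)" by (intro inj_on_inverseI[where g = "double_at y"])
  have y_Q: "y \<in> Q" using uplus_chainD(1)[OF F_in] y_doubled(2) by auto
  show "(`) unstar ` star \<Gamma> F = star \<Delta> (unstar ` F)"
  proof
    show "(`) unstar ` star \<Gamma> F \<subseteq> star \<Delta> (unstar ` F)"
      using double_at(1) by (auto simp: star_def intro: imageI)
    show "star \<Delta> (unstar ` F) \<subseteq> (`) unstar ` star \<Gamma> F"
    proof
      fix H assume "H \<in> star \<Delta> (unstar ` F)"
      then have H_chain: "H \<in> \<Delta>" "unstar ` F \<subseteq> H" by (auto simp: star_def)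
      then have "y \<in> H" using y_doubled(1) by force
      note double_at = unstar_double_at[OF H_chain(1) this y_Q]
      have "double_at y (unstar ` F) \<subseteq> double_at y H" using H_chain(2) by (auto simp: double_at_def)
      then have "F \<subseteq> double_at y H" by (simp add: doubled_chain(4)[OF F_in y_doubled])
      then show "H \<in> (`) unstar ` star \<Gamma> F"
        using double_at by (intro image_eqI[where x = "double_at y H"]) (auto simp: star_def)
    qed
  qed
qed

text \<open>The orientation \<open>uplus_rk\<close> places \<open>Inr y\<close> and \<open>Inl y\<close> in the middle of a chain, where forgetting \<open>Inr y\<close>
  changes signs. Moving \<open>Inr y\<close> to the top avoids this.\<close>

lemma exact_at_star_doubled:
  assumes F_in: "F \<in> \<Gamma>" and y_doubled: "Inl y \<in> F" "Inr y \<in> F"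
    and exact: "exact_at TYPE('k::field) rk (star \<Delta> (unstar ` F)) i"
  shows "exact_at TYPE('k) uplus_rk (star \<Gamma> F) (Suc i)"
proof -
  define \<nu> where "\<nu> a = (if a = Inr y then height else rk (unstar a))" for a
  have chain: "G \<in> \<Gamma>" "Inl y \<in> G" "Inr y \<in> G" if "G \<in> star \<Gamma> F" for G
    using that y_doubled by (auto simp: star_def)
  have rk_less: "rk (unstar a) < height" if "a \<in> G" "G \<in> star \<Gamma> F" for a G
    using rk_less_height uplus_chainD(5)[OF chain(1)] that by blast
  have orients: "orients \<nu> (star \<Gamma> F)"
    unfolding orients_def
  proof (intro ballI conjI)
    fix G assume G_in: "G \<in> star \<Gamma> F"
    show "finite G" using uplus.finite_face chain(1)[OF G_in] by simp
    have "inj_on rk (unstar ` (G - {Inr y}))"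
      using doubled_chain(1,3)[OF chain[OF G_in]] chains.inj_on_colour by simp
    then have "inj_on (rk \<circ> unstar) (G - {Inr y})"
      by (rule comp_inj_on[OF doubled_chain(2)[OF chain[OF G_in]]])
    moreover have "rk (unstar a) \<noteq> height" "height \<noteq> rk (unstar a)" if "a \<in> G" for a
      using rk_less[OF that G_in] by simp_all
    ultimately show "inj_on \<nu> G" by (auto simp: inj_on_def \<nu>_def split: if_splits)
  qed
  have "exact_at TYPE('k) \<nu> (star \<Gamma> F) (i + card {Inr y :: 'a + 'a})"
  proof (rule exact_at_collapse[where \<pi> = unstar and F = F and \<nu>' = rk])
    note image = unstar_image_star_doubled[OF F_in y_doubled]
    show "inj_on ((`) unstar) (star \<Gamma> F)" by (rule image(1))
    show "exact_at TYPE('k) rk ((`) unstar ` star \<Gamma> F) i" using exact by (simp add: image(2))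
    show "removable ((`) unstar ` star \<Gamma> F) H = H - unstar ` F" if "H \<in> (`) unstar ` star \<Gamma> F" for H
      using removable_star[OF chains.simplicial] that by (simp only: image(2))
    show "removable (star \<Gamma> F) G = G - F" if "G \<in> star \<Gamma> F" for G
      by (rule removable_star[OF uplus.simplicial that])
    show "inj_on unstar (G - {Inr y})" "unstar ` (G - {Inr y}) = unstar ` G" if "G \<in> star \<Gamma> F" for G
      using doubled_chain(2,3)[OF chain[OF that]] .
    show "\<nu> w < \<nu> v \<longleftrightarrow> w \<notin> {Inr y} \<and> rk (unstar w) < rk (unstar v)"
      if "G \<in> star \<Gamma> F" "v \<in> G - F" "w \<in> G" for G v w
      using rk_less[of v G] that y_doubled by (auto simp: \<nu>_def)
  qed (use F_in y_doubled uplus.finite_face in \<open>auto simp: star_def\<close>)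
  then show ?thesis by (intro exact_at_reorient[OF orients orients_star]) simp
qed

lemma unstarred_face:
  assumes "G \<in> \<Gamma>" "starred G = {}"
  shows "unstar ` G \<in> \<Delta>" "Inl ` unstar ` G = G"
proof -
  have image: "unstar ` G = unstarred G" using assms(2) by (simp add: unstar_image)
  then show "unstar ` G \<in> \<Delta>" using uplus_chainD(3)[OF assms(1)] by simp
  show "Inl ` unstar ` G = G"
  proof (rule set_eqI)
    fix a show "a \<in> Inl ` unstar ` G \<longleftrightarrow> a \<in> G" unfolding image using assms(2) by (cases a) auto
  qed
qed

lemma unstar_image_star_unstarred_faces:
  assumes F_in: "F \<in> \<Gamma>" "starred F = {}"
  shows "(`) unstar ` {G \<in> star \<Gamma> F. starred G = {}} = star \<Delta> (unstar ` F)" (is "_ ` ?X = _")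
proof
  have "unstar ` G \<in> star \<Delta> (unstar ` F)" if "G \<in> ?X" for G
    using unstarred_face(1)[of G] that image_mono[of F G unstar] by (simp add: star_def)
  then show "(`) unstar ` ?X \<subseteq> star \<Delta> (unstar ` F)" by blast
  show "star \<Delta> (unstar ` F) \<subseteq> (`) unstar ` ?X"
  proof
    fix H assume "H \<in> star \<Delta> (unstar ` F)"
    then have H_in: "H \<in> \<Delta>" "Inl ` unstar ` F \<subseteq> Inl ` H" by (auto simp: star_def)
    have "starred (Inl ` H) = {}" "unstarred (Inl ` H) = H" by auto
    then have "Inl ` H \<in> ?X" "unstar ` Inl ` H = H"
      using H_in unstarred_face(2)[OF F_in]
      by (auto simp: star_def uplus_chain_iff unstar_image simplicialD[OF chains.simplicial])
    then show "H \<in> (`) unstar ` ?X" by (intro image_eqI[where x = "Inl ` H"]) simp_all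
  qed
qed

lemma exact_at_star_unstarred_faces:
  assumes F_in: "F \<in> \<Gamma>" "starred F = {}" and exact: "exact_at TYPE('k::field) rk (star \<Delta> (unstarred F)) i"
  shows "exact_at TYPE('k) uplus_rk {G \<in> star \<Gamma> F. starred G = {}} i" (is "exact_at _ _ ?X _")
proof -
  note image = unstar_image_star_unstarred_faces[OF F_in]
  have F_in_X: "F \<in> ?X" using F_in by (simp add: star_def)
  have X_unstarred: "Inl ` unstar ` G = G" if "G \<in> ?X" for G
    using that by (intro unstarred_face(2)) (auto simp: star_def)
  have "exact_at TYPE('k) uplus_rk ?X (i + card ({} :: ('a + 'a) set))"
  proof (rule exact_at_collapse[where \<pi> = unstar and F = F and \<nu>' = rk])
    show "exact_at TYPE('k) rk ((`) unstar ` ?X) i"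
      using exact F_in(2) unfolding image unstar_image[of F] by simp
    show "removable ((`) unstar ` ?X) H = H - unstar ` F" if "H \<in> (`) unstar ` ?X" for H
      using removable_star[OF chains.simplicial] that by (simp only: image)
    show "removable ?X G = G - F" if "G \<in> ?X" for G
      using removable_star[OF uplus.simplicial, of G F] that by (auto simp: removable_def)
    show "inj_on ((`) unstar) ?X"
      by (rule inj_on_inverseI[where g = "(`) Inl"]) (rule X_unstarred)
    show "inj_on unstar (G - {})" if "G \<in> ?X" for G
      by (subst X_unstarred[OF that, symmetric]) (auto simp: inj_on_def)
    show "uplus_rk w < uplus_rk v \<longleftrightarrow> w \<notin> {} \<and> rk (unstar w) < rk (unstar v)"
      if "G \<in> ?X" "v \<in> G - F" "w \<in> G" for G v w
      using that by (cases v; cases w) auto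
  qed (use F_in_X uplus.finite_face in \<open>auto simp: star_def\<close>)
  then show ?thesis by simp
qed

theorem reisner_uplus:
  assumes reisner: "reisner TYPE('k::field) rk \<Delta> height"
    and euler_char: "\<And>x. x \<in> P - Q \<Longrightarrow> red_euler_char (below P le x) le = 0" "red_euler_char P le = 0"
  shows "reisner TYPE('k) uplus_rk \<Gamma> (Suc height)"
  unfolding reisner_def
proof (intro ballI allI impI)
  fix F i assume F_in: "F \<in> \<Gamma>" and i_less: "i < Suc height"
  show "exact_at TYPE('k) uplus_rk (star \<Gamma> F) i"
  proof (cases "starred F = {} \<and> unstarred F \<inter> Q \<noteq> {}")
    case True
    then obtain y where "Inl y \<in> F" "y \<in> Q" by auto
    then show ?thesis using True by (intro exact_at_star_unstarred_in_Q) auto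
  next
    case False
    show ?thesis
    proof (rule exact_at_star_by_greatest_starred)
      show "exact_at TYPE('k) uplus_rk {G \<in> star \<Gamma> F. starred G = {}} i"
      proof (cases "starred F = {}")
        case True
        have chain: "unstarred F \<in> \<Delta>" by (rule uplus_chainD(3)[OF F_in])
        have "x \<in> P - Q" if "x \<in> unstarred F" for x
          using that True False chainD(1)[OF chain] by auto
        then show ?thesis
          using euler_char
          by (intro exact_at_star_unstarred_faces[OF F_in True]
              exact_at_star_of_euler_char_zero[OF reisner chain]) auto
      qed (auto simp: star_def intro!: exact_at_trivial)
      fix z assume z_in: "Inl z \<in> F" and doubled: "insert (Inr z) F \<in> \<Gamma>"
      show "exact_at TYPE('k) uplus_rk (star \<Gamma> (insert (Inr z) F)) i"
      proof (cases i)
        case 0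
        have "card G \<noteq> 0" if "G \<in> star \<Gamma> (insert (Inr z) F)" for G
          using that uplus.finite_face[of G] by (auto simp: star_def)
        then show ?thesis using 0 by (intro exact_at_trivial) auto
      next
        case (Suc j)
        have "unstar ` insert (Inr z) F \<in> \<Delta>" by (rule doubled_chain(1)[OF doubled]) (use z_in in auto)
        then have "exact_at TYPE('k) rk (star \<Delta> (unstar ` insert (Inr z) F)) j"
          using reisner Suc i_less unfolding reisner_def by simp
        then show ?thesis unfolding Suc by (intro exact_at_star_doubled[OF doubled]) (use z_in in auto)
      qed
    qed
  qed
qed

end

theorem theorem6p3:
  fixes P Q :: "'a set" and le :: "'a \<Rightarrow> 'a \<Rightarrow> bool"
  assumes "finite P"
    and "partial_order_on' P le"
    and "cohen_macaulay_poset TYPE('k::field) P le"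
    and "poset_ideal P le Q"
    and "\<forall>x \<in> P - Q. red_euler_char (below P le x) le = 0"
    and "red_euler_char P le = 0"
  shows "cohen_macaulay_poset TYPE('k) (uplus_carrier P Q) (uplus_le le Q)"
proof -
  interpret finite_poset_ideal P le Q
    by unfold_locales (fact assms)+
  have "\<Delta> \<noteq> {}" using chains.simplicial by (auto simp: simplicial_def)
  then obtain K where K_in: "K \<in> \<Delta>" "card K = height"
    unfolding height_def by (rule max_card_attained[OF finite_chains])
  have "SR_cohen_macaulay TYPE('k) \<Delta>"
    using assms(3) by (simp add: cohen_macaulay_poset_def)
  then have "reisner TYPE('k) rk \<Delta> (card K)"
    using finite_P chains.face_subset chains.simplicial chains.orients_colour K_in(1)
    by (rule reisner_of_cohen_macaulay)
  then have "reisner TYPE('k) uplus_rk \<Gamma> (Suc height)"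
    using assms(5,6) K_in(2) by (intro reisner_uplus) auto
  then show ?thesis
    unfolding cohen_macaulay_poset_def by (rule uplus.cohen_macaulay_of_reisner)
qed

end
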